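(* There exists a divergence-free vector field $u$ on $\mathbb{T}^2$ such that $u \in B^{1/3}_{3,\infty}(\mathbb{T}^2)$, $u\in W^{1,p}(\mathbb{T}^2)$ for every $1 \leq p < 3/2$, and $$\limsup_{q\to \infty} \Pi_q[u] \neq 0,$$ where $\Pi_q[u] = \int_{\mathbb{T}^2} S_q[u] \cdot S_q[ (u \cdot \nabla) u] \,dx$ is the Littlewood-Paley energy flux of $u$ through scale $q$.
   Context: Here $\mathbb{T}^2$ is the two-dimensional torus of unit period, $\mathbb{T}^2=\mathbb{R}^2/\mathbb{Z}^2$; vector fields are real, $\mathbb{R}^2$-valued. Fourier coefficients: $\widehat{f}(\alpha) = \int_{\mathbb{T}^2} e^{-2 \pi i \alpha \cdot x}f(x)\, dx$ for $\alpha\in\mathbb{Z}^2$, so $f(x) = \sum_{\alpha \in \mathbb{Z}^2} \widehat{f}(\alpha) e^{2 \pi i \alpha \cdot x}$. Set $\lambda_q=2^q$. Fix a nonnegative radial function $\chi\in C_c^\infty(\mathbb{R}^2)$ with support contained in the unit ball $B(0;1)$ and $\chi(\xi)=1$ if $|\xi|\le 1/2$, and let $\varphi(\xi)=\chi(\lambda_1^{-1}\xi)-\chi(\xi)$. The $q$-th Littlewood-Paley component and truncation ($q\geq 0$ an integer) are $$\Delta_q f=\sum_{\alpha\in\mathbb{Z}^2}\varphi(\lambda_q^{-1}\alpha)\widehat f(\alpha)e^{2\pi i\alpha\cdot x},\qquad S_q[f]=\sum_{\alpha\in\mathbb{Z}^2}\chi(\lambda_q^{-1}\alpha)\widehat f(\alpha)e^{2\pi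 i\alpha\cdot x},$$ applied componentwise to vector fields. The Besov space $B^{1/3}_{3,\infty}(\mathbb{T}^2)$ consists of those $f\in L^3(\mathbb{T}^2)$ with $\sup_{q\ge0}\lambda_q^{1/3}\|\Delta_q f\|_{L^3(\mathbb{T}^2)}<\infty$. *)

theory Defs
  imports "HOL-Analysis.Analysis"
begin

text \<open>
  A function on the torus is a \<open>\<int>\<^sup>2\<close>-periodic function on \<open>\<real>\<^sup>2\<close>; integrals and norms are taken
  over the unit square.
\<close>

abbreviation T2 :: "(real ^ 2) measure" where
  "T2 \<equiv> lebesgue_on (cbox 0 1)"

definition periodic :: "(real ^ 2 \<Rightarrow> 'b) \<Rightarrow> bool" where
  "periodic f \<longleftrightarrow> (\<forall>x j. f (x + axis j 1) = f x)"

definition in_Lp :: "real \<Rightarrow> (real ^ 2 \<Rightarrow> 'b::euclidean_space) \<Rightarrow> bool" where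
  "in_Lp p f \<longleftrightarrow> f \<in> borel_measurable T2 \<and> integrable T2 (\<lambda>x. norm (f x) powr p)"

definition Lp_norm :: "real \<Rightarrow> (real ^ 2 \<Rightarrow> 'b::euclidean_space) \<Rightarrow> real" where
  "Lp_norm p f = (LINT x|T2. norm (f x) powr p) powr (1 / p)"


definition partial :: "2 \<Rightarrow> (real ^ 2 \<Rightarrow> real) \<Rightarrow> real ^ 2 \<Rightarrow> real" where
  "partial j f x = frechet_derivative f (at x) (axis j 1)"

primrec iter_partial :: "2 list \<Rightarrow> (real ^ 2 \<Rightarrow> real) \<Rightarrow> real ^ 2 \<Rightarrow> real" where
  "iter_partial [] f = f"
| "iter_partial (j # js) f = partial j (iter_partial js f)"

text \<open>Continuity of all the partial derivatives is implied by their differentiability.\<close>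

definition smooth :: "(real ^ 2 \<Rightarrow> real) \<Rightarrow> bool" where
  "smooth f \<longleftrightarrow> (\<forall>js x. iter_partial js f differentiable (at x))"

definition test_fun :: "(real ^ 2 \<Rightarrow> real) \<Rightarrow> bool" where
  "test_fun \<phi> \<longleftrightarrow> smooth \<phi> \<and> periodic \<phi>"


definition has_weak_partial ::
    "2 \<Rightarrow> (real ^ 2 \<Rightarrow> 'b::euclidean_space) \<Rightarrow> (real ^ 2 \<Rightarrow> 'b) \<Rightarrow> bool" where
  "has_weak_partial j f g \<longleftrightarrow>
     integrable T2 f \<and> periodic f \<and> integrable T2 g \<and> periodic g \<and>
     (\<forall>\<phi>. test_fun \<phi> \<longrightarrow> (LINT x|T2. partial j \<phi> x *\<^sub>R f x) = - (LINT x|T2. \<phi> x *\<^sub>R g x))"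

text \<open>A weak derivative is unique up to a null set; \<open>weak_partial\<close> picks a representative.\<close>

definition weak_partial ::
    "2 \<Rightarrow> (real ^ 2 \<Rightarrow> 'b::euclidean_space) \<Rightarrow> real ^ 2 \<Rightarrow> 'b" where
  "weak_partial j f = (SOME g. has_weak_partial j f g)"

definition in_W1p :: "real \<Rightarrow> (real ^ 2 \<Rightarrow> 'b::euclidean_space) \<Rightarrow> bool" where
  "in_W1p p f \<longleftrightarrow> periodic f \<and> in_Lp p f \<and> (\<forall>j. \<exists>g. has_weak_partial j f g \<and> in_Lp p g)"

text \<open>The divergence is taken in the sense of distributions.\<close>

definition divergence_free :: "(real ^ 2 \<Rightarrow> real ^ 2) \<Rightarrow> bool" where
  "divergence_free u \<longleftrightarrow> integrable T2 u \<and>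
     (\<forall>\<phi>. test_fun \<phi> \<longrightarrow> (LINT x|T2. (\<Sum>j\<in>UNIV. u x $ j * partial j \<phi> x)) = 0)"

definition advection :: "(real ^ 2 \<Rightarrow> real ^ 2) \<Rightarrow> real ^ 2 \<Rightarrow> real ^ 2" where
  "advection u x = (\<Sum>j\<in>UNIV. (u x $ j) *\<^sub>R weak_partial j u x)"


definition freq :: "int ^ 2 \<Rightarrow> real ^ 2" where
  "freq \<alpha> = (\<chi> i. real_of_int (\<alpha> $ i))"

definition fourier_coeff :: "(real ^ 2 \<Rightarrow> real) \<Rightarrow> int ^ 2 \<Rightarrow> complex" where
  "fourier_coeff f \<alpha> = (LINT x|T2. cis (- 2 * pi * (freq \<alpha> \<bullet> x)) * complex_of_real (f x))"

text \<open>
  For a real function \<open>f\<close> and an even symbol \<open>m\<close> the Fourier series below is real-valued,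
  so that \<open>Re\<close> is merely a coercion. The symbols used here are radial with bounded support,
  hence all but finitely many terms vanish.
\<close>

definition fourier_multiplier ::
    "(real ^ 2 \<Rightarrow> real) \<Rightarrow> (real ^ 2 \<Rightarrow> real) \<Rightarrow> real ^ 2 \<Rightarrow> real" where
  "fourier_multiplier m f x =
     Re (\<Sum>\<^sub>\<infinity>\<alpha>. complex_of_real (m (freq \<alpha>)) * fourier_coeff f \<alpha> * cis (2 * pi * (freq \<alpha> \<bullet> x)))"

definition fourier_multiplier_vec ::
    "(real ^ 2 \<Rightarrow> real) \<Rightarrow> (real ^ 2 \<Rightarrow> real ^ 2) \<Rightarrow> real ^ 2 \<Rightarrow> real ^ 2" where
  "fourier_multiplier_vec m f x = (\<chi> i. fourier_multiplier m (\<lambda>y. f y $ i) x)"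

definition LP_cutoff :: "(real ^ 2 \<Rightarrow> real) \<Rightarrow> bool" where
  "LP_cutoff c \<longleftrightarrow>
     smooth c \<and> (\<forall>\<xi>. 0 \<le> c \<xi>) \<and> (\<forall>\<xi> \<eta>. norm \<xi> = norm \<eta> \<longrightarrow> c \<xi> = c \<eta>) \<and>
     closure {\<xi>. c \<xi> \<noteq> 0} \<subseteq> ball 0 1 \<and> (\<forall>\<xi>. norm \<xi> \<le> 1 / 2 \<longrightarrow> c \<xi> = 1)"

definition freq_scale :: "nat \<Rightarrow> real" where
  "freq_scale q = 2 ^ q"

definition LP_annulus :: "(real ^ 2 \<Rightarrow> real) \<Rightarrow> real ^ 2 \<Rightarrow> real" where
  "LP_annulus c \<xi> = c (inverse (freq_scale 1) *\<^sub>R \<xi>) - c \<xi>"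

definition LP_component ::
    "(real ^ 2 \<Rightarrow> real) \<Rightarrow> nat \<Rightarrow> (real ^ 2 \<Rightarrow> real ^ 2) \<Rightarrow> real ^ 2 \<Rightarrow> real ^ 2" where
  "LP_component c q = fourier_multiplier_vec (\<lambda>\<xi>. LP_annulus c (inverse (freq_scale q) *\<^sub>R \<xi>))"

definition LP_truncation ::
    "(real ^ 2 \<Rightarrow> real) \<Rightarrow> nat \<Rightarrow> (real ^ 2 \<Rightarrow> real ^ 2) \<Rightarrow> real ^ 2 \<Rightarrow> real ^ 2" where
  "LP_truncation c q = fourier_multiplier_vec (\<lambda>\<xi>. c (inverse (freq_scale q) *\<^sub>R \<xi>))"

definition in_Besov_third :: "(real ^ 2 \<Rightarrow> real) \<Rightarrow> (real ^ 2 \<Rightarrow> real ^ 2) \<Rightarrow> bool" where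
  "in_Besov_third c f \<longleftrightarrow> periodic f \<and> in_Lp 3 f \<and>
     bdd_above (range (\<lambda>q. freq_scale q powr (1 / 3) * Lp_norm 3 (LP_component c q f)))"

definition energy_flux ::
    "(real ^ 2 \<Rightarrow> real) \<Rightarrow> (real ^ 2 \<Rightarrow> real ^ 2) \<Rightarrow> nat \<Rightarrow> real" where
  "energy_flux c u q =
     (LINT x|T2. LP_truncation c q u x \<bullet> LP_truncation c q (advection u) x)"

end

theory Submission
  imports Defs
begin

text \<open>
  The field is a lacunary superposition of smooth divergence-free blocks. The block at frequency
  \<open>m = t\<^sup>3\<close> is a trigonometric polynomial with about \<open>m\<^sup>2\<close> modes of size
  \<open>m\<^bsup>-5/3\<^esup>\<close>, hence concentrated on a ball of radius \<open>1/m\<close> with amplitude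
  \<open>t = m\<^bsup>1/3\<^esup>\<close>. This is the scaling of a homogeneous field of degree \<open>-1/3\<close>, critical for
  the Besov space and subcritical for \<open>W\<^bsup>1,p\<^esup>\<close>, \<open>p < 3/2\<close>. The modes of a block form a cluster
  below the cut-off \<open>1024 m\<close> and two clusters above it whose difference is the first cluster. On
  these resonant triads all contributions to the flux through the cut-off have the same sign, and there
  are so many of them that the flux of the block is bounded below independently of \<open>m\<close>. The
  frequencies of the blocks grow so fast that different blocks do not interact in the limit: what
  remains is a product of low frequencies only, which vanishes by incompressibility.
\<close>

section \<open>Integration on the torus\<close>

text \<open>The scaling is exactly critical: on a set of area about \<open>t^-6\<close> a block has
  size \<open>t\<close> and its gradient size \<open>t^4\<close>, so the absolute value of the cubic
  flux density has an integral of order one at every scale. Size estimates alone therefore cannot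
  decide the limit, and the sign of the triads has to be used. Three choices keep the proof
  explicit. Taking \<open>m\<close> to be a cube makes \<open>m^(1/3)\<close> an integer. Counting a
  frequency once for every way of writing it as a center plus two grid points gives coefficients of
  Fejer type; these yield a sharp L^1 bound of the gradient, without the logarithmic loss of sharply
  truncated sums. Finally, no mode of the field lies between \<open>512 m\<close> and
  \<open>1024 m\<close> for the scale \<open>m\<close> of any block, so an arbitrary cut-off
  \<open>c\<close> at that block acts on the field as multiplication by 0 or 1. The truncation is
  then idempotent on the field, self-adjointness removes the second truncation from the flux, and
  one field independent of \<open>c\<close> serves every cut-off.\<close>

lemma measure_cube: "measure lebesgue (cbox 0 (1::real^2)) = 1"
  by (simp add: content_cbox_if_cart one_vec_def interval_eq_empty_cart)

lemma measure_space_T2: "measure T2 (space T2) = 1"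
  using measure_cube by (simp add: measure_restrict_space)

lemma integrable_continuous_T2:
  fixes f :: "real^2 \<Rightarrow> 'b::euclidean_space"
  assumes "continuous_on UNIV f"
  shows "integrable T2 f"
  by (meson assms continuous_imp_integrable continuous_on_subset top_greatest)

lemma LINT_T2_eq_integral:
  fixes f :: "real^2 \<Rightarrow> 'b::euclidean_space"
  assumes "continuous_on UNIV f"
  shows "(LINT x|T2. f x) = integral (cbox 0 1) f"
  by (rule lebesgue_integral_eq_integral) (use integrable_continuous_T2[OF assms] in auto)

lemma inner_axis1: "x \<bullet> axis (j::2) (1::real) = x $ j"
  by (simp add: inner_axis)

text \<open>The translated cube is cut by the hyperplane where coordinate \<open>j\<close> equals 1.
  The part beyond it, moved back by one period, fills exactly the slab of the unit cube that the
  translation has vacated.\<close>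

lemma integral_translate_periodic:
  fixes f :: "real^2 \<Rightarrow> 'b::euclidean_space"
  assumes cont: "continuous_on UNIV f" and per: "periodic f" and s: "0 \<le> s" "s \<le> 1"
  shows "(LINT x|T2. f (x + s *\<^sub>R axis j 1)) = (LINT x|T2. f x)"
proof -
  let ?e = "axis j 1 :: real^2"
  define c where "c = s *\<^sub>R ?e"
  have cn: "c $ i = (if i = j then s else 0)" and ax: "axis a (1::real) $ i = (if i = a then 1 else 0)" for i a :: 2
    by (auto simp: c_def axis_def)
  have int: "f integrable_on cbox a b" for a b
    by (rule integrable_continuous) (use cont continuous_on_subset in blast)
  have cont': "continuous_on UNIV (\<lambda>x. f (x + c))"
    by (intro continuous_on_compose2[OF cont] continuous_intros) auto
  have "(LINT x|T2. f (x + c)) = integral (cbox 0 1) (\<lambda>x. f (x + c))"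
    by (rule LINT_T2_eq_integral[OF cont'])
  also have "\<dots> = integral (cbox c (1 + c)) f"
    using integral_shift_cbox[of c c "1 + c" f] by simp
  also have "\<dots> = integral (cbox c (1+c) \<inter> {x. x \<bullet> ?e \<le> 1}) f + integral (cbox c (1+c) \<inter> {x. x \<bullet> ?e \<ge> 1}) f"
    by (rule integral_split[OF int]) simp
  also have "cbox c (1+c) \<inter> {x. x \<bullet> ?e \<le> 1} = cbox c 1"
    using s exhaust_2[of j] by (auto simp: mem_box_cart cn ax inner_axis1 forall_2)
  also have "cbox c (1+c) \<inter> {x. x \<bullet> ?e \<ge> 1} = cbox ?e (1 + c)"
    using s exhaust_2[of j] by (auto simp: mem_box_cart cn ax inner_axis1 forall_2)
  also have "integral (cbox ?e (1 + c)) f = integral (cbox 0 (1 + c - ?e)) (\<lambda>x. f (x + ?e))"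
    using integral_shift_cbox[of ?e ?e "1 + c" f] by simp
  also have "\<dots> = integral (cbox 0 (1 + c - ?e)) f"
    using per by (simp add: periodic_def)
  also have "integral (cbox c 1) f + integral (cbox 0 (1 + c - ?e)) f = integral (cbox 0 1) f"
  proof -
    have "cbox 0 1 \<inter> {x::real^2. x \<bullet> ?e \<le> s} = cbox 0 (1 + c - ?e)"
      using s exhaust_2[of j] by (auto simp: mem_box_cart cn ax inner_axis1 forall_2)
    moreover have "cbox 0 1 \<inter> {x::real^2. x \<bullet> ?e \<ge> s} = cbox c 1"
      using s exhaust_2[of j] by (auto simp: mem_box_cart cn ax inner_axis1 forall_2)
    moreover have "integral (cbox 0 1) f = integral (cbox 0 1 \<inter> {x. x \<bullet> ?e \<le> s}) f + integral (cbox 0 1 \<inter> {x. x \<bullet> ?e \<ge> s}) f"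
      by (rule integral_split[OF int]) simp
    ultimately show ?thesis by simp
  qed
  also have "\<dots> = (LINT x|T2. f x)"
    by (rule LINT_T2_eq_integral[OF cont, symmetric])
  finally show ?thesis by (simp add: c_def)
qed

section \<open>Derivatives and integration by parts on the torus\<close>

lemma has_derivative_frechet:
  "f differentiable (at x) \<Longrightarrow> (f has_derivative frechet_derivative f (at x)) (at x)"
  using frechet_derivative_works by blast

lemma partial_eqI: "(f has_derivative D) (at x) \<Longrightarrow> partial j f x = D (axis j 1)"
  by (simp add: partial_def frechet_derivative_at[symmetric])

lemma partial_mult:
  assumes "f differentiable (at x)" "g differentiable (at x)"
  shows "partial j (\<lambda>x. f x * g x) x = f x * partial j g x + partial j f x * g x"
  unfolding partial_def[of j f] partial_def[of j g]
  by (rule partial_eqI[THEN trans, OF has_derivative_mult[OF has_derivative_frechet[OF assms(1)] has_derivative_frechet[OF assms(2)]]]) simp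

lemma partial_add:
  assumes "f differentiable (at x)" "g differentiable (at x)"
  shows "partial j (\<lambda>x. f x + g x) x = partial j f x + partial j g x"
  unfolding partial_def[of j f] partial_def[of j g]
  by (rule partial_eqI[THEN trans, OF has_derivative_add[OF has_derivative_frechet[OF assms(1)] has_derivative_frechet[OF assms(2)]]]) simp

text \<open>The integral of \<open>f\<close> translated by \<open>s\<close> along axis
  \<open>j\<close> is constant in \<open>s\<close>, and differentiating under the integral at
  \<open>s = 0\<close> gives the integral of the partial derivative. The derivative is taken within
  \<open>{0..1}\<close>, the range of shifts treated above; it is still unique at the
  endpoint.\<close>

lemma integral_partial_zero:
  assumes diff: "\<And>x. f differentiable (at x)" and cont: "continuous_on UNIV (partial j f)" and per: "periodic f"
  shows "(LINT x|T2. partial j f x) = 0"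
proof -
  let ?e = "axis j 1 :: real^2"
  have cf: "continuous_on UNIV f"
    using diff by (simp add: continuous_at_imp_continuous_on differentiable_imp_continuous_within)
  have dv: "((\<lambda>s. integral (cbox 0 1) (\<lambda>x. f (x + s *\<^sub>R ?e))) has_vector_derivative
          integral (cbox 0 1) (\<lambda>x. partial j f (x + 0 *\<^sub>R ?e))) (at 0 within {0..1})"
  proof (rule leibniz_rule_vector_derivative[where U = "{0..1}" and fx = "\<lambda>s x. partial j f (x + s *\<^sub>R ?e)"])
    fix s :: real and x :: "real^2"
    assume s: "s \<in> {0..1}"
    have "((\<lambda>s. f (x + s *\<^sub>R ?e)) has_derivative (\<lambda>h. frechet_derivative f (at (x + s *\<^sub>R ?e)) (h *\<^sub>R ?e))) (at s within {0..1})"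
      by (rule has_derivative_in_compose2[where g = f and t = UNIV])
         (auto intro!: derivative_eq_intros has_derivative_at_withinI[OF has_derivative_frechet[OF diff]] s simp del: atLeastAtMost_iff)
    moreover have "linear (frechet_derivative f (at (x + s *\<^sub>R ?e)))"
      by (rule linear_frechet_derivative[OF diff])
    ultimately show "((\<lambda>s. f (x + s *\<^sub>R ?e)) has_vector_derivative partial j f (x + s *\<^sub>R ?e)) (at s within {0..1})"
      by (simp add: has_vector_derivative_def partial_def linear_scale)
  next
    show "(\<lambda>x. f (x + s *\<^sub>R ?e)) integrable_on cbox 0 1" for s
      by (rule integrable_continuous) (intro continuous_on_compose2[OF cf] continuous_intros, auto)
    show "continuous_on ({0..1} \<times> cbox 0 1) (\<lambda>(s, x). partial j f (x + s *\<^sub>R ?e))"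
      unfolding split_beta by (intro continuous_on_compose2[OF cont] continuous_intros) auto
  qed auto
  have const: "integral (cbox 0 1) (\<lambda>x. f (x + s *\<^sub>R ?e)) = integral (cbox 0 1) f" if "s \<in> {0..1}" for s
  proof -
    have "continuous_on UNIV (\<lambda>x. f (x + s *\<^sub>R ?e))"
      by (intro continuous_on_compose2[OF cf] continuous_intros) auto
    from LINT_T2_eq_integral[OF this] have "integral (cbox 0 1) (\<lambda>x. f (x + s *\<^sub>R ?e)) = (LINT x|T2. f (x + s *\<^sub>R ?e))"
      by (rule sym)
    also have "\<dots> = (LINT x|T2. f x)"
      by (rule integral_translate_periodic[OF cf per]) (use that in auto)
    also have "\<dots> = integral (cbox 0 1) f"
      by (rule LINT_T2_eq_integral[OF cf])
    finally show ?thesis .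
  qed
  have "((\<lambda>s. integral (cbox 0 1) f) has_vector_derivative
          integral (cbox 0 1) (partial j f)) (at 0 within {0..1::real})"
    by (rule has_vector_derivative_transform[OF _ const[symmetric] dv[simplified]]) auto
  then have "integral (cbox 0 1) (partial j f) = 0"
    by (rule vector_derivative_unique_within[rotated, OF _ has_vector_derivative_const])
      (simp add: at_within_Icc_at_right)
  then show ?thesis
    by (simp add: LINT_T2_eq_integral[OF cont])
qed

definition C1 :: "(real^2 \<Rightarrow> real) \<Rightarrow> bool" where
  "C1 f \<longleftrightarrow> periodic f \<and> (\<forall>x. f differentiable (at x)) \<and> (\<forall>j. continuous_on UNIV (partial j f))"

lemma C1_continuous: "C1 f \<Longrightarrow> continuous_on UNIV f"
  unfolding C1_def by (simp add: continuous_at_imp_continuous_on differentiable_imp_continuous_within)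

lemma C1_partial: "C1 f \<Longrightarrow> continuous_on UNIV (partial j f)" "C1 f \<Longrightarrow> f differentiable (at x)"
    "C1 f \<Longrightarrow> periodic f"
  by (simp_all add: C1_def)

lemma C1I: "\<lbrakk>periodic f; \<And>x. f differentiable (at x); \<And>j. continuous_on UNIV (partial j f)\<rbrakk> \<Longrightarrow> C1 f"
  by (simp add: C1_def)

lemma C1_mult:
  assumes "C1 f" "C1 g" shows "C1 (\<lambda>x. f x * g x)"
proof (rule C1I)
  fix j
  have "partial j (\<lambda>x. f x * g x) = (\<lambda>x. f x * partial j g x + partial j f x * g x)"
    using assms by (auto simp: C1_partial partial_mult)
  then show "continuous_on UNIV (partial j (\<lambda>x. f x * g x))"
    by (simp add: continuous_on_add continuous_on_mult C1_partial C1_continuous assms)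
qed (use C1_partial[OF assms(1)] C1_partial[OF assms(2)] in \<open>auto simp: periodic_def\<close>)

lemma C1_add:
  assumes "C1 f" "C1 g" shows "C1 (\<lambda>x. f x + g x)"
proof (rule C1I)
  fix j
  have "partial j (\<lambda>x. f x + g x) = (\<lambda>x. partial j f x + partial j g x)"
    using assms by (auto simp: C1_partial partial_add)
  then show "continuous_on UNIV (partial j (\<lambda>x. f x + g x))"
    by (simp add: continuous_on_add C1_partial assms)
qed (use C1_partial[OF assms(1)] C1_partial[OF assms(2)] in \<open>auto simp: periodic_def\<close>)

lemma test_fun_C1: "test_fun \<phi> \<Longrightarrow> C1 \<phi>"
proof -
  assume t: "test_fun \<phi>"
  then have d: "iter_partial js \<phi> differentiable (at x)" for js x
    by (simp add: test_fun_def smooth_def)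
  show ?thesis
    using t d[of "[]"] d[of "[j]" for j]
    by (simp add: C1_def test_fun_def continuous_at_imp_continuous_on differentiable_imp_continuous_within)
qed

lemma integral_by_parts_T2:
  assumes "C1 f" "C1 g"
  shows "(LINT x|T2. partial j f x * g x) = - (LINT x|T2. f x * partial j g x)"
proof -
  have "(LINT x|T2. partial j (\<lambda>x. f x * g x) x) = 0"
    using C1_mult[OF assms] by (intro integral_partial_zero) (auto simp: C1_def)
  moreover have "partial j (\<lambda>x. f x * g x) = (\<lambda>x. f x * partial j g x + partial j f x * g x)"
    using assms by (auto simp: C1_def partial_mult)
  moreover have "integrable T2 (\<lambda>x. f x * partial j g x)" "integrable T2 (\<lambda>x. partial j f x * g x)"
    by (intro integrable_continuous_T2 continuous_on_mult C1_continuous C1_partial assms)+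
  ultimately show ?thesis by simp
qed

section \<open>Trigonometric polynomials\<close>

definition wave :: "int^2 \<Rightarrow> real^2 \<Rightarrow> complex" where
  "wave \<alpha> x = cis (2 * pi * (freq \<alpha> \<bullet> x))"

lemma freq_add: "freq (\<alpha> + \<beta>) = freq \<alpha> + freq \<beta>"
  and freq_minus: "freq (- \<alpha>) = - freq \<alpha>"
  and freq_zero [simp]: "freq 0 = 0"
  by (simp_all add: freq_def vec_eq_iff)

lemma freq_axis: "freq \<alpha> \<bullet> axis j 1 = real_of_int (\<alpha> $ j)"
  by (simp add: inner_axis freq_def)

lemma wave_add: "wave (\<alpha> + \<beta>) x = wave \<alpha> x * wave \<beta> x"
  by (simp add: wave_def freq_add inner_add_left distrib_left cis_mult)

lemma wave_minus: "wave (- \<alpha>) x = cnj (wave \<alpha> x)"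
  by (simp add: wave_def freq_minus cis_cnj)

lemma wave_zero [simp]: "wave 0 x = 1"
  by (simp add: wave_def)

lemma norm_wave [simp]: "norm (wave \<alpha> x) = 1"
  by (simp add: wave_def)

lemma Re_wave_bound: "\<bar>Re (w * wave \<alpha> x)\<bar> \<le> norm w"
  using abs_Re_le_cmod[of "w * wave \<alpha> x"] by (simp add: norm_mult)

lemma continuous_wave [continuous_intros]: "continuous_on S (wave \<alpha>)"
  unfolding wave_def by (intro continuous_intros)

lemma cis_minus_pi: "cis (- pi) = - 1"
  by (simp add: complex_eq_iff)

lemma wave_shift: "wave \<alpha> (x + s *\<^sub>R axis j 1) = cis (2 * pi * \<alpha> $ j * s) * wave \<alpha> x"
  by (simp add: wave_def inner_add_right freq_axis cis_mult algebra_simps)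

lemma periodic_wave: "periodic (wave \<alpha>)"
  unfolding periodic_def
proof (intro allI)
  fix x j
  have "cis (2 * pi * \<alpha> $ j * 1) = 1"
    using cis_multiple_2pi[of "real_of_int (\<alpha> $ j)"] by (simp add: mult.commute)
  then show "wave \<alpha> (x + axis j 1) = wave \<alpha> x"
    using wave_shift[of \<alpha> x 1 j] by simp
qed

lemma integrable_wave: "integrable T2 (wave \<alpha>)"
  by (rule integrable_continuous_T2) (rule continuous_wave)

lemma integral_wave: "(LINT x|T2. wave \<alpha> x) = (if \<alpha> = 0 then 1 else 0)"
proof (cases "\<alpha> = 0")
  case True
  then show ?thesis using measure_cube by (simp add: measure_restrict_space)
next
  case False
  then obtain j where j: "\<alpha> $ j \<noteq> 0" by (auto simp: vec_eq_iff)
  \<comment> \<open>A translation by half a wavelength in direction \<open>j\<close> changes the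
    sign of the wave. This shift is at most 1 because \<open>\<alpha> $ j\<close> is a nonzero
    integer.\<close>
  define s where "s = 1 / (2 * \<bar>real_of_int (\<alpha> $ j)\<bar>)"
  have s: "0 \<le> s" "s \<le> 1" using j by (auto simp: s_def field_simps)
  have "2 * pi * \<alpha> $ j * s = pi \<or> 2 * pi * \<alpha> $ j * s = - pi"
    using j by (auto simp: s_def abs_if field_simps)
  then have c: "cis (2 * pi * \<alpha> $ j * s) = -1"
    by (elim disjE) (simp_all only: cis_pi cis_minus_pi)
  have "(LINT x|T2. wave \<alpha> x) = (LINT x|T2. wave \<alpha> (x + s *\<^sub>R axis j 1))"
    by (rule integral_translate_periodic[symmetric, OF continuous_wave periodic_wave s])
  also have "\<dots> = - (LINT x|T2. wave \<alpha> x)"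
    unfolding wave_shift c by simp
  finally show ?thesis using False by simp
qed

lemma integral_cos: "(LINT x|T2. Re (wave \<alpha> x)) = (if \<alpha> = 0 then 1 else 0)"
  using integral_Re[OF integrable_wave[of \<alpha>]] integral_wave[of \<alpha>] by simp

lemma has_derivative_wave:
  "((\<lambda>x. Re (w * wave \<alpha> x)) has_derivative (\<lambda>h. Re (2 * pi * \<i> * (freq \<alpha> \<bullet> h) * w * wave \<alpha> x))) (at x)"
proof -
  have "((\<lambda>x. wave \<alpha> x) has_derivative (\<lambda>h. 2 * pi * \<i> * (freq \<alpha> \<bullet> h) * wave \<alpha> x)) (at x)"
  proof -
    have "((\<lambda>x. \<i> * complex_of_real (2 * pi * (freq \<alpha> \<bullet> x))) has_derivative
            (\<lambda>h. \<i> * complex_of_real (2 * pi * (freq \<alpha> \<bullet> h)))) (at x)"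
      by (auto intro!: derivative_eq_intros)
    from has_derivative_compose[OF this DERIV_exp[unfolded has_field_derivative_def]] show ?thesis
      by (simp add: wave_def cis_conv_exp mult_ac)
  qed
  from has_derivative_mult_right[OF this, of w] have "((\<lambda>x. w * wave \<alpha> x) has_derivative (\<lambda>h. w * (2 * pi * \<i> * (freq \<alpha> \<bullet> h) * wave \<alpha> x))) (at x)" .
  from bounded_linear.has_derivative[OF bounded_linear_Re this] show ?thesis
    by (simp only: mult_ac)
qed

text \<open>The sum runs over an abstract index set, so a frequency may occur several times; the
  blocks rely on this. The real part supplies the reflected frequencies.\<close>

definition trig_poly :: "'i set \<Rightarrow> ('i \<Rightarrow> complex) \<Rightarrow> ('i \<Rightarrow> int^2) \<Rightarrow> real^2 \<Rightarrow> real" where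
  "trig_poly I w \<alpha> x = (\<Sum>i\<in>I. Re (w i * wave (\<alpha> i) x))"

lemma has_derivative_trig_poly:
  "(trig_poly I w \<alpha> has_derivative (\<lambda>h. trig_poly I (\<lambda>i. 2 * pi * \<i> * (freq (\<alpha> i) \<bullet> h) * w i) \<alpha> x)) (at x)"
  unfolding trig_poly_def[abs_def]
  by (rule has_derivative_sum) (use has_derivative_wave in auto)

lemma partial_trig_poly:
  "partial j (trig_poly I w \<alpha>) = trig_poly I (\<lambda>i. 2 * pi * \<i> * of_int (\<alpha> i $ j) * w i) \<alpha>"
  by (rule ext, rule partial_eqI[OF has_derivative_trig_poly, THEN trans]) (simp add: freq_axis)

lemma continuous_trig_poly [continuous_intros]: "continuous_on S (trig_poly I w \<alpha>)"
  unfolding trig_poly_def[abs_def] by (intro continuous_intros)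

lemma periodic_trig_poly: "periodic (trig_poly I w \<alpha>)"
  using periodic_wave by (simp add: periodic_def trig_poly_def)

lemma C1_trig_poly: "C1 (trig_poly I w \<alpha>)"
  by (rule C1I)
     (auto simp: partial_trig_poly periodic_trig_poly continuous_trig_poly differentiable_def
           intro!: has_derivative_trig_poly)

lemma trig_poly_bound:
  assumes "\<And>i. i \<in> I \<Longrightarrow> norm (w i) \<le> W"
  shows "\<bar>trig_poly I w \<alpha> x\<bar> \<le> W * card I"
proof -
  have "\<bar>trig_poly I w \<alpha> x\<bar> \<le> (\<Sum>i\<in>I. \<bar>Re (w i * wave (\<alpha> i) x)\<bar>)"
    unfolding trig_poly_def by (rule sum_abs)
  also have "\<dots> \<le> (\<Sum>i\<in>I. W)"
    by (rule sum_mono) (use assms Re_wave_bound order_trans in blast)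
  finally show ?thesis by (simp add: mult.commute)
qed

lemma integral_Re_wave_prod: "(LINT x|T2. Re (z * wave \<alpha> x * cnj (wave \<beta> x))) = (if \<alpha> = \<beta> then Re z else 0)"
proof -
  have eq: "z * wave \<alpha> x * cnj (wave \<beta> x) = z * wave (\<alpha> - \<beta>) x" for x
    by (simp add: wave_add[of \<alpha> "- \<beta>", simplified] wave_minus)
  have "(LINT x|T2. Re (z * wave (\<alpha> - \<beta>) x)) = Re (LINT x|T2. z * wave (\<alpha> - \<beta>) x)"
    using integrable_wave by (intro integral_Re) simp
  also have "\<dots> = (if \<alpha> = \<beta> then Re z else 0)"
    using integrable_wave by (simp add: integral_wave)
  finally show ?thesis unfolding eq .
qed

text \<open>Orthogonality leaves the pairs of indices with equal frequency. There are at most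
  \<open>card I * R\<close> of them, and each contributes at most \<open>W^2\<close>.\<close>

lemma parseval_bound:
  assumes fin: "finite I" and w: "\<And>i. i \<in> I \<Longrightarrow> norm (w i) \<le> W"
    and R: "\<And>i. i \<in> I \<Longrightarrow> card {j \<in> I. \<alpha> i = \<alpha> j} \<le> R"
  shows "(LINT x|T2. (norm (\<Sum>i\<in>I. w i * wave (\<alpha> i) x))\<^sup>2) \<le> W\<^sup>2 * card I * R"
proof -
  let ?S = "\<lambda>x. \<Sum>i\<in>I. w i * wave (\<alpha> i) x"
  have sq: "(norm (?S x))\<^sup>2 = (\<Sum>i\<in>I. \<Sum>j\<in>I. Re (w i * cnj (w j) * wave (\<alpha> i) x * cnj (wave (\<alpha> j) x)))" for x
  proof -
    have "(norm (?S x))\<^sup>2 = Re (?S x * cnj (?S x))"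
      by (metis Re_complex_of_real complex_norm_square)
    also have "?S x * cnj (?S x) = (\<Sum>i\<in>I. \<Sum>j\<in>I. w i * cnj (w j) * wave (\<alpha> i) x * cnj (wave (\<alpha> j) x))"
      by (simp add: sum_product mult_ac)
    finally show ?thesis by simp
  qed
  have int: "integrable T2 (\<lambda>x. Re (w i * cnj (w j) * wave (\<alpha> i) x * cnj (wave (\<alpha> j) x)))" for i j
    by (intro integrable_continuous_T2 continuous_intros)
  have "(LINT x|T2. (norm (?S x))\<^sup>2) = (\<Sum>i\<in>I. \<Sum>j\<in>I. if \<alpha> i = \<alpha> j then Re (w i * cnj (w j)) else 0)"
    unfolding sq by (simp only: Bochner_Integration.integral_sum Bochner_Integration.integrable_sum int integral_Re_wave_prod)
  also have "\<dots> \<le> (\<Sum>i\<in>I. \<Sum>j\<in>I. if \<alpha> i = \<alpha> j then W * W else 0)"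
  proof (intro sum_mono)
    fix i j assume ij: "i \<in> I" "j \<in> I"
    have "Re (w i * cnj (w j)) \<le> norm (w i) * norm (w j)"
      using complex_Re_le_cmod[of "w i * cnj (w j)"] by (simp add: norm_mult)
    also have "\<dots> \<le> W * W"
      by (rule mult_mono) (use w ij order_trans[OF norm_ge_zero] in auto)
    finally show "(if \<alpha> i = \<alpha> j then Re (w i * cnj (w j)) else 0) \<le> (if \<alpha> i = \<alpha> j then W * W else 0)"
      by simp
  qed
  also have "\<dots> = (\<Sum>i\<in>I. (W * W) * card {j \<in> I. \<alpha> i = \<alpha> j})"
    using fin by (simp add: sum.If_cases Int_def conj_commute mult.commute)
  also have "\<dots> \<le> (\<Sum>i\<in>I. (W * W) * R)"
    by (intro sum_mono mult_left_mono) (use R in auto)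
  finally show ?thesis by (simp add: power2_eq_square mult_ac)
qed

lemma trig_poly_eq_Re: "trig_poly I w \<alpha> x = Re (\<Sum>i\<in>I. w i * wave (\<alpha> i) x)"
  by (simp add: trig_poly_def)

lemma parseval_trig_poly:
  assumes "finite I" "\<And>i. i \<in> I \<Longrightarrow> norm (w i) \<le> W"
    and "\<And>i. i \<in> I \<Longrightarrow> card {j \<in> I. \<alpha> i = \<alpha> j} \<le> R"
  shows "(LINT x|T2. (trig_poly I w \<alpha> x)\<^sup>2) \<le> W\<^sup>2 * card I * R"
proof -
  have "(LINT x|T2. (trig_poly I w \<alpha> x)\<^sup>2) \<le> (LINT x|T2. (norm (\<Sum>i\<in>I. w i * wave (\<alpha> i) x))\<^sup>2)"
  proof (rule integral_mono)
    show "(trig_poly I w \<alpha> x)\<^sup>2 \<le> (norm (\<Sum>i\<in>I. w i * wave (\<alpha> i) x))\<^sup>2" for x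
      unfolding trig_poly_eq_Re by (rule abs_le_square_iff[THEN iffD1]) (simp only: abs_norm_cancel abs_Re_le_cmod)
  qed (intro integrable_continuous_T2 continuous_intros)+
  also have "\<dots> \<le> W\<^sup>2 * card I * R"
    by (rule parseval_bound[OF assms])
  finally show ?thesis .
qed

text \<open>The product structure of the coefficients gives an \<open>L\<^sup>1\<close> bound through Cauchy-Schwarz.\<close>

lemma integral_abs_product_trig_poly:
  fixes f k :: "'i \<Rightarrow> real" and \<gamma> :: "'i \<Rightarrow> int^2"
  assumes fin: "finite P" and inj: "inj_on \<gamma> P" and F: "0 < F" "0 < K"
    and f: "\<And>i. i \<in> P \<Longrightarrow> \<bar>f i\<bar> \<le> F" and k: "\<And>i. i \<in> P \<Longrightarrow> \<bar>k i\<bar> \<le> K"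
  shows "(LINT x|T2. \<bar>\<Sum>i\<in>P. \<Sum>j\<in>P. Re (of_real (f i * k j) * wave (\<delta> + \<gamma> i + \<gamma> j) x)\<bar>) \<le> F * K * card P"
proof -
  let ?A = "\<lambda>x. \<Sum>i\<in>P. of_real (f i) * wave (\<gamma> i) x"
  let ?B = "\<lambda>x. \<Sum>i\<in>P. of_real (k i) * wave (\<gamma> i) x"
  have eq: "(\<Sum>i\<in>P. \<Sum>j\<in>P. Re (of_real (f i * k j) * wave (\<delta> + \<gamma> i + \<gamma> j) x)) = Re (wave \<delta> x * ?A x * ?B x)" for x
    by (simp add: sum_product sum_distrib_left wave_add mult_ac)
  have c1: "card {j \<in> P. \<gamma> i = \<gamma> j} \<le> 1" if "i \<in> P" for i
  proof -
    have "{j \<in> P. \<gamma> i = \<gamma> j} = {i}" using inj that by (auto dest: inj_onD)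
    then show ?thesis by simp
  qed
  have A: "(LINT x|T2. (norm (?A x))\<^sup>2) \<le> F\<^sup>2 * card P * 1"
    using parseval_bound[of P "\<lambda>i. of_real (f i)" F \<gamma> 1] fin f c1 by simp
  have B: "(LINT x|T2. (norm (?B x))\<^sup>2) \<le> K\<^sup>2 * card P * 1"
    using parseval_bound[of P "\<lambda>i. of_real (k i)" K \<gamma> 1] fin k c1 by simp
  have int: "integrable T2 (\<lambda>x. (norm (?A x))\<^sup>2)" "integrable T2 (\<lambda>x. (norm (?B x))\<^sup>2)"
    by (intro integrable_continuous_T2 continuous_intros)+
  \<comment> \<open>The weights \<open>K / F\<close> and \<open>F / K\<close> balance the Parseval
    bounds \<open>F^2 * card P\<close> and \<open>K^2 * card P\<close>, so that each half
    contributes the same amount.\<close>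
  have "(LINT x|T2. \<bar>\<Sum>i\<in>P. \<Sum>j\<in>P. Re (of_real (f i * k j) * wave (\<delta> + \<gamma> i + \<gamma> j) x)\<bar>)
     \<le> (LINT x|T2. (K / F / 2) * (norm (?A x))\<^sup>2 + (F / K / 2) * (norm (?B x))\<^sup>2)"
    unfolding eq
  proof (rule integral_mono)
    fix x
    have "\<bar>Re (wave \<delta> x * ?A x * ?B x)\<bar> \<le> norm (?A x) * norm (?B x)"
      using abs_Re_le_cmod[of "wave \<delta> x * ?A x * ?B x"] by (simp add: norm_mult)
    also have "\<dots> \<le> (K / F / 2) * (norm (?A x))\<^sup>2 + (F / K / 2) * (norm (?B x))\<^sup>2"
    proof -
      have "0 \<le> (K * norm (?A x) - F * norm (?B x))\<^sup>2 / (2 * F * K)"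
        using F by simp
      also have "\<dots> = (K / F / 2) * (norm (?A x))\<^sup>2 + (F / K / 2) * (norm (?B x))\<^sup>2 - norm (?A x) * norm (?B x)"
        using F by (simp add: field_simps power2_eq_square)
      finally show ?thesis by simp
    qed
    finally show "\<bar>Re (wave \<delta> x * ?A x * ?B x)\<bar> \<le> (K / F / 2) * (norm (?A x))\<^sup>2 + (F / K / 2) * (norm (?B x))\<^sup>2" .
  qed (intro integrable_continuous_T2 continuous_intros)+
  also have "\<dots> = (K / F / 2) * (LINT x|T2. (norm (?A x))\<^sup>2) + (F / K / 2) * (LINT x|T2. (norm (?B x))\<^sup>2)"
    using int by simp
  also have "\<dots> \<le> (K / F / 2) * (F\<^sup>2 * card P) + (F / K / 2) * (K\<^sup>2 * card P)"
    using A B F by (intro add_mono mult_left_mono) auto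
  also have "\<dots> = F * K * card P"
    using F by (simp add: field_simps power2_eq_square)
  finally show ?thesis .
qed

section \<open>Series in \<open>L\<^sup>p\<close> and uniqueness of weak derivatives\<close>

lemma integrable_vec_nth: "integrable M f \<Longrightarrow> integrable M (\<lambda>x. f x $ i)"
  for f :: "'a \<Rightarrow> real^'n"
  by (rule integrable_bounded_linear[OF bounded_linear_vec_nth])

lemma integral_vec_nth: "integrable M f \<Longrightarrow> (LINT x|M. f x $ i) = (LINT x|M. f x) $ i"
  for f :: "'a \<Rightarrow> real^'n"
  by (rule integral_bounded_linear[OF bounded_linear_vec_nth])

lemma continuous_bounded_on_cube:
  fixes G :: "real^2 \<Rightarrow> 'b::real_normed_vector"
  assumes "continuous_on UNIV G"
  obtains B where "\<And>x. x \<in> cbox 0 1 \<Longrightarrow> norm (G x) \<le> B"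
proof -
  have "bounded (G ` cbox 0 1)"
    by (intro compact_imp_bounded compact_continuous_image continuous_on_subset[OF assms]) auto
  then show thesis using that by (auto simp: bounded_iff)
qed

lemma integrable_continuous_scaleR:
  fixes k :: "real^2 \<Rightarrow> 'b::euclidean_space"
  assumes c: "continuous_on UNIV G" and k: "integrable T2 k"
  shows "integrable T2 (\<lambda>x. G x *\<^sub>R k x)"
proof -
  obtain B where B: "\<And>x. x \<in> cbox 0 1 \<Longrightarrow> norm (G x) \<le> B"
    using continuous_bounded_on_cube[OF c] by blast
  have [measurable]: "G \<in> borel_measurable T2" "k \<in> borel_measurable T2"
    using k integrable_continuous_T2[OF c] by auto
  show ?thesis
  proof (rule Bochner_Integration.integrable_bound[of _ "\<lambda>x. B *\<^sub>R norm (k x)"])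
    show "AE x in T2. norm (G x *\<^sub>R k x) \<le> norm (B *\<^sub>R norm (k x))"
    proof (rule AE_I2)
      fix x assume "x \<in> space T2"
      then have "norm (G x) \<le> B" "\<bar>B\<bar> = B" using B[of x] norm_ge_zero[of "G x"] by (auto simp del: norm_ge_zero)
      then show "norm (G x *\<^sub>R k x) \<le> norm (B *\<^sub>R norm (k x))"
        by (simp add: abs_mult mult_right_mono)
    qed
  qed (use k in auto)
qed

lemma AE_summable_of_integrals:
  fixes h :: "nat \<Rightarrow> 'a \<Rightarrow> real"
  assumes int: "\<And>k. integrable M (h k)" and nn: "\<And>k x. 0 \<le> h k x" and sm: "summable (\<lambda>k. LINT x|M. h k x)"
  shows "AE x in M. summable (\<lambda>k. h k x)"
proof -
  have [measurable]: "h k \<in> borel_measurable M" for k using int by auto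
  have "(\<integral>\<^sup>+ x. (\<Sum>k. ennreal (h k x)) \<partial>M) = (\<Sum>k. \<integral>\<^sup>+ x. ennreal (h k x) \<partial>M)"
    by (rule nn_integral_suminf) simp
  also have "\<dots> = (\<Sum>k. ennreal (LINT x|M. h k x))"
    by (intro arg_cong[where f = suminf] ext nn_integral_eq_integral int AE_I2 nn)
  also have "\<dots> < \<infinity>"
  proof -
    have "0 \<le> (LINT x|M. h k x)" for k by (rule Bochner_Integration.integral_nonneg) (rule nn)
    from ennreal_suminf_neq_top[OF sm this] show ?thesis
      unfolding infinity_ennreal_def less_top .
  qed
  finally have "AE x in M. (\<Sum>k. ennreal (h k x)) \<noteq> \<infinity>"
    by (intro nn_integral_PInf_AE) auto
  then show ?thesis
    by eventually_elim (use nn in \<open>auto intro: summable_suminf_not_top\<close>)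
qed

text \<open>Weighting by \<open>2^k\<close> makes a series in \<open>L\<^sup>p\<close> pointwise comparable with a single integrable function,
  which replaces Minkowski's inequality.\<close>

lemma Lp_series:
  fixes f :: "nat \<Rightarrow> 'a \<Rightarrow> 'b::euclidean_space" and p :: real
  assumes p: "0 < p" and meas [measurable]: "\<And>k. f k \<in> borel_measurable M"
    and int: "\<And>k. integrable M (\<lambda>x. norm (f k x) powr p)"
    and sm: "summable (\<lambda>k. 2 powr (k * p) * (LINT x|M. norm (f k x) powr p))"
  shows "AE x in M. summable (\<lambda>k. norm (f k x))"
    and "integrable M (\<lambda>x. norm (\<Sum>k. f k x) powr p)"
    and "(LINT x|M. norm (\<Sum>k. f k x) powr p) \<le> 2 powr p * (\<Sum>k. 2 powr (k * p) * (LINT x|M. norm (f k x) powr p))"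
proof -
  define h where "h k x = 2 powr (k * p) * norm (f k x) powr p" for k x
  have h_int: "integrable M (h k)" and h_nn: "0 \<le> h k x" for k x
    using int by (auto simp: h_def[abs_def])
  have h_eq: "(LINT x|M. h k x) = 2 powr (k * p) * (LINT x|M. norm (f k x) powr p)" for k
    by (simp add: h_def)
  have h_sm: "summable (\<lambda>k. LINT x|M. h k x)"
    using sm by (simp add: h_eq)
  have ae: "AE x in M. summable (\<lambda>k. h k x)"
    by (rule AE_summable_of_integrals[OF h_int h_nn h_sm])
  have H_int: "integrable M (\<lambda>x. \<Sum>k. h k x)" and H_eq: "(LINT x|M. (\<Sum>k. h k x)) = (\<Sum>k. LINT x|M. h k x)"
    using ae h_sm h_nn by (auto intro!: integrable_suminf integral_suminf h_int)
  have pt: "summable (\<lambda>k. norm (f k x)) \<and> norm (\<Sum>k. f k x) powr p \<le> 2 powr p * (\<Sum>k. h k x)"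
    if s: "summable (\<lambda>k. h k x)" for x
  proof -
    define H where "H = (\<Sum>k. h k x)"
    \<comment> \<open>One term of the weighted series already bounds \<open>norm (f k x)\<close> by
      \<open>2^-k * H powr (1/p)\<close>. These bounds form a geometric series with sum
      \<open>2 * H powr (1/p)\<close>, whose \<open>p\<close>-th power is
      \<open>2 powr p * H\<close>.\<close>
    have "h k x \<le> H" for k
      unfolding H_def using sum_le_suminf[OF s, of "{k}"] h_nn by simp
    then have "(2 powr k * norm (f k x)) powr p \<le> H" for k
      by (simp add: h_def powr_mult powr_powr)
    then have "((2 powr k * norm (f k x)) powr p) powr (1/p) \<le> H powr (1/p)" for k
      using p by (intro powr_mono2) auto
    then have "2 ^ k * norm (f k x) \<le> H powr (1/p)" for k
      using p by (simp add: powr_powr powr_realpow)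
    then have b: "norm (f k x) \<le> (1/2) ^ k * H powr (1/p)" for k
      by (simp add: field_simps)
    have g: "summable (\<lambda>k. (1/2::real) ^ k * H powr (1/p))"
      by (intro summable_mult2 summable_geometric) simp
    have sn: "summable (\<lambda>k. norm (f k x))"
      by (rule summable_comparison_test'[OF g]) (use b in simp)
    have "norm (\<Sum>k. f k x) \<le> (\<Sum>k. (1/2) ^ k * H powr (1/p))"
      by (rule order_trans[OF summable_norm[OF sn] suminf_le[OF b sn g]])
    also have "\<dots> = 2 * H powr (1/p)"
      using suminf_mult2[OF summable_geometric, of "1/2::real" "H powr (1/p)"] by (simp add: suminf_geometric)
    finally have "norm (\<Sum>k. f k x) powr p \<le> (2 * H powr (1/p)) powr p"
      using p by (intro powr_mono2) auto
    also have "\<dots> = 2 powr p * H"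
      using p suminf_nonneg[OF s h_nn] by (simp add: powr_mult powr_powr H_def)
    finally show ?thesis using sn by (simp add: H_def)
  qed
  show "AE x in M. summable (\<lambda>k. norm (f k x))"
    using ae by eventually_elim (use pt in auto)
  have ae2: "AE x in M. norm (\<Sum>k. f k x) powr p \<le> 2 powr p * (\<Sum>k. h k x)"
    using ae by eventually_elim (use pt in auto)
  show int': "integrable M (\<lambda>x. norm (\<Sum>k. f k x) powr p)"
    by (rule Bochner_Integration.integrable_bound[of _ "\<lambda>x. 2 powr p * (\<Sum>k. h k x)"])
       (use H_int ae2 h_nn in \<open>auto elim!: eventually_mono\<close>)
  have "(LINT x|M. norm (\<Sum>k. f k x) powr p) \<le> (LINT x|M. 2 powr p * (\<Sum>k. h k x))"
    by (rule integral_mono_AE) (use int' H_int ae2 in auto)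
  then show "(LINT x|M. norm (\<Sum>k. f k x) powr p) \<le> 2 powr p * (\<Sum>k. 2 powr (k * p) * (LINT x|M. norm (f k x) powr p))"
    by (simp add: H_eq h_eq)
qed

section \<open>Density of trigonometric polynomials and uniqueness of weak derivatives\<close>

inductive trig_fun :: "(real^2 \<Rightarrow> real) \<Rightarrow> bool" where
  wave: "trig_fun (\<lambda>x. Re (w * wave \<alpha> x))"
| add: "trig_fun f \<Longrightarrow> trig_fun g \<Longrightarrow> trig_fun (\<lambda>x. f x + g x)"
| mult: "trig_fun f \<Longrightarrow> trig_fun g \<Longrightarrow> trig_fun (\<lambda>x. f x * g x)"

text \<open>Closure under products makes the class large enough for polynomial approximation, and
  closure under partial derivatives makes its members smooth by induction on the order.\<close>

lemma trig_fun_C1: "trig_fun f \<Longrightarrow> C1 f \<and> trig_fun (partial j f)"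
proof (induction rule: trig_fun.induct)
  case (wave w \<alpha>)
  have "C1 (trig_poly {()} (\<lambda>_. w) (\<lambda>_. \<alpha>))" by (rule C1_trig_poly)
  moreover have "partial j (\<lambda>x. Re (w * wave \<alpha> x)) = (\<lambda>x. Re (2 * pi * \<i> * (freq \<alpha> \<bullet> axis j 1) * w * wave \<alpha> x))"
    by (rule ext, rule partial_eqI[OF has_derivative_wave])
  ultimately show ?case
    using trig_fun.wave by (simp add: trig_poly_def[abs_def] del: times_complex.sel)
next
  case (add f g)
  then have "partial j (\<lambda>x. f x + g x) = (\<lambda>x. partial j f x + partial j g x)"
    by (auto simp: partial_add C1_partial)
  then show ?case using add by (simp add: C1_add trig_fun.add)
next
  case (mult f g)
  then have "partial j (\<lambda>x. f x * g x) = (\<lambda>x. f x * partial j g x + partial j f x * g x)"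
    by (auto simp: partial_mult C1_partial)
  then show ?case using mult by (simp add: C1_mult trig_fun.add trig_fun.mult)
qed

lemma trig_fun_test_fun: "trig_fun f \<Longrightarrow> test_fun f"
proof -
  assume f: "trig_fun f"
  have "trig_fun (iter_partial js f)" for js
    by (induction js) (use f trig_fun_C1 in auto)
  then show "test_fun f"
    using f trig_fun_C1 by (auto simp: test_fun_def smooth_def C1_partial)
qed

text \<open>Realizes the torus as a compact subset of a Euclidean space, where opposite faces of the
  cube are glued. Polynomials of the embedding are periodic, so Stone-Weierstrass on the image
  produces test functions.\<close>

definition torus_embedding :: "real^2 \<Rightarrow> complex \<times> complex" where
  "torus_embedding x = (wave (axis 1 1) x, wave (axis 2 1) x)"

lemma freq_axis_inner: "freq (axis j 1) \<bullet> x = x $ j"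
  using exhaust_2[of j] by (auto simp: freq_def inner_vec_def axis_def UNIV_2)

lemma continuous_torus_embedding: "continuous_on S torus_embedding"
  unfolding torus_embedding_def by (intro continuous_intros)

lemma cis_inj:
  assumes "cis (2 * pi * a) = cis (2 * pi * b)" "0 \<le> a" "a \<le> 1" "0 < b" "b < 1"
  shows "a = b"
proof -
  have "sin (2*pi*a) = sin (2*pi*b) \<and> cos (2*pi*a) = cos (2*pi*b)"
    using assms(1) by (simp add: complex_eq_iff)
  then obtain n :: int where "2*pi*a = 2*pi*b + 2*pi*n"
    using sin_cos_eq_iff by blast
  then have "2*pi*(a - b - n) = 0" by (simp add: algebra_simps)
  then have "a - b = n" by simp
  then have "\<bar>real_of_int n\<bar> < 1" using assms by linarith
  then have "n = 0" by linarith
  then show ?thesis using \<open>a - b = n\<close> by simp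
qed

text \<open>Only points on opposite faces of the cube are identified, so it is enough that one of
  the two points is interior.\<close>

lemma torus_embedding_inj:
  assumes "torus_embedding x = torus_embedding y" "x \<in> cbox 0 1" "y \<in> box 0 1"
  shows "x = y"
proof -
  have "x $ j = y $ j" for j
    using assms exhaust_2[of j] cis_inj[of "x $ j" "y $ j"]
    by (auto simp: torus_embedding_def wave_def freq_axis_inner mem_box_cart)
  then show ?thesis by (simp add: vec_eq_iff)
qed

lemma trig_fun_polynomial:
  "real_polynomial_function g \<Longrightarrow> trig_fun (\<lambda>x. g (torus_embedding x))"
proof (induction rule: real_polynomial_function.induct)
  case (linear f)
  then interpret bounded_linear f .
  \<comment> \<open>A real-linear map on pairs of complex numbers is determined by its values at
    \<open>1\<close> and \<open>\<i>\<close> in each factor, and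
    \<open>Re (Complex a (- b) * z) = a * Re z + b * Im z\<close>.\<close>
  have "f (torus_embedding x) = Re (Complex (f (1, 0)) (- f (\<i>, 0)) * wave (axis 1 1) x)
      + Re (Complex (f (0, 1)) (- f (0, \<i>)) * wave (axis 2 1) x)" for x
  proof -
    let ?z = "wave (axis 1 1) x" and ?w = "wave (axis 2 1) x"
    have "torus_embedding x = Re ?z *\<^sub>R (1, 0) + Im ?z *\<^sub>R (\<i>, 0) + Re ?w *\<^sub>R (0, 1) + Im ?w *\<^sub>R (0, \<i>)"
      by (simp add: torus_embedding_def complex_eq_iff)
    then show ?thesis by (simp only: add scaleR) (simp add: algebra_simps)
  qed
  then show ?case using trig_fun.wave trig_fun.add by presburger
next
  case (const c)
  then show ?case using trig_fun.wave[of "of_real c" 0] by simp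
qed (auto intro: trig_fun.intros)

text \<open>A polynomial uniformly close to \<open>F\<close> on the compact image is, after
  composition with the embedding, a test function. Replacing \<open>F\<close> by it changes the
  integral by at most \<open>e\<close> times the L^1 norm of \<open>h\<close>.\<close>

lemma orthogonal_continuous:
  assumes h: "integrable T2 h" and orth: "\<And>\<phi>. test_fun \<phi> \<Longrightarrow> (LINT x|T2. \<phi> x * h x) = 0"
    and F: "continuous_on UNIV F"
  shows "(LINT x|T2. F (torus_embedding x) * h x) = (0::real)"
proof -
  define N where "N = (LINT x|T2. \<bar>h x\<bar>)"
  have N: "0 \<le> N" by (simp add: N_def)
  have int: "integrable T2 (\<lambda>x. G x * h x)" if G: "continuous_on UNIV G" for G
    using integrable_continuous_scaleR[OF G h] by simp
  have "\<bar>LINT x|T2. F (torus_embedding x) * h x\<bar> \<le> e * N" if e: "e > 0" for e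
  proof -
    obtain g where g: "real_polynomial_function g"
      and ge: "\<And>z. z \<in> torus_embedding ` cbox 0 1 \<Longrightarrow> \<bar>F z - g z\<bar> < e"
      by (rule Stone_Weierstrass_real_polynomial_function[of "torus_embedding ` cbox 0 1" F e])
         (use e F continuous_torus_embedding in \<open>auto intro: compact_continuous_image continuous_on_subset\<close>)
    have tg: "test_fun (\<lambda>x. g (torus_embedding x))"
      using trig_fun_polynomial[OF g] trig_fun_test_fun by blast
    have i1: "integrable T2 (\<lambda>x. F (torus_embedding x) * h x)"
      by (intro int continuous_on_compose2[OF F continuous_torus_embedding]) auto
    have i2: "integrable T2 (\<lambda>x. g (torus_embedding x) * h x)"
      by (intro int C1_continuous test_fun_C1 tg)
    have "(LINT x|T2. F (torus_embedding x) * h x) = (LINT x|T2. F (torus_embedding x) * h x - g (torus_embedding x) * h x)"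
      using i1 i2 orth[OF tg] by simp
    also have "\<bar>\<dots>\<bar> \<le> (LINT x|T2. \<bar>F (torus_embedding x) * h x - g (torus_embedding x) * h x\<bar>)"
      by (rule integral_abs_bound)
    also have "\<dots> \<le> (LINT x|T2. e * \<bar>h x\<bar>)"
    proof (rule integral_mono)
      fix x assume "x \<in> space T2"
      then have "\<bar>F (torus_embedding x) - g (torus_embedding x)\<bar> \<le> e"
        using ge[of "torus_embedding x"] by (simp add: less_imp_le)
      then show "\<bar>F (torus_embedding x) * h x - g (torus_embedding x) * h x\<bar> \<le> e * \<bar>h x\<bar>"
        by (simp add: abs_mult mult_right_mono flip: left_diff_distrib)
    qed (use i1 i2 h in auto)
    also have "\<dots> = e * N" by (simp add: N_def)
    finally show ?thesis .
  qed
  note bound = this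
  have small: "\<bar>LINT x|T2. F (torus_embedding x) * h x\<bar> \<le> 0 + e" if "e > 0" for e
  proof -
    \<comment> \<open>Dividing by \<open>N + 1\<close> rather than \<open>N\<close> covers the case
      of a vanishing L^1 norm.\<close>
    have "\<bar>LINT x|T2. F (torus_embedding x) * h x\<bar> \<le> (e / (N + 1)) * N"
      using bound[of "e / (N + 1)"] that N by simp
    also have "\<dots> \<le> 0 + e" using that N by (simp add: pos_divide_le_eq distrib_left)
    finally show ?thesis .
  qed
  have "\<bar>LINT x|T2. F (torus_embedding x) * h x\<bar> \<le> 0"
    by (rule field_le_epsilon[OF small])
  then show ?thesis by simp
qed

lemma indicator_measurable_T2:
  assumes "T \<in> sets lebesgue" "T \<subseteq> cbox 0 1"
  shows "(indicator T :: real^2 \<Rightarrow> real) \<in> borel_measurable T2"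
  by (rule borel_measurable_indicator) (use assms in \<open>simp add: sets_restrict_space_iff\<close>)

text \<open>The tent functions \<open>max 0 (1 - n * infdist z C)\<close> decrease to the indicator
  of the image \<open>C\<close> of \<open>T\<close>. As \<open>T\<close> lies in the open cube, a
  point of the closed cube is mapped into \<open>C\<close> only if it belongs to \<open>T\<close>,
  so dominated convergence applies.\<close>

lemma orthogonal_indicator:
  assumes h: "integrable T2 h" and orth: "\<And>\<phi>. test_fun \<phi> \<Longrightarrow> (LINT x|T2. \<phi> x * h x) = 0"
    and T: "closed T" "T \<subseteq> box 0 1"
  shows "(LINT x|T2. indicator T x * h x) = (0::real)"
proof (cases "T = {}")
  case False
  define C where "C = torus_embedding ` T"
  have "compact T"
    using T by (metis bounded_box bounded_subset compact_eq_bounded_closed)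
  then have C: "closed C" "C \<noteq> {}"
    using False by (auto simp: C_def intro!: compact_imp_closed compact_continuous_image continuous_torus_embedding)
  define F where "F n z = max 0 (1 - real n * infdist z C)" for n z
  have [measurable]: "h \<in> borel_measurable T2" using h by auto
  have Fc: "continuous_on S (F n)" for n S
    unfolding F_def by (intro continuous_intros)
  have mem: "torus_embedding x \<in> C \<longleftrightarrow> x \<in> T" if "x \<in> cbox 0 1" for x
    unfolding C_def using torus_embedding_inj[OF _ that] T by blast
  have lim: "(\<lambda>n. F n (torus_embedding x) * h x) \<longlonglongrightarrow> indicator T x * h x" if x: "x \<in> cbox 0 1" for x
  proof (cases "x \<in> T")
    case True
    then have "infdist (torus_embedding x) C = 0" using mem[OF x] by simp
    then show ?thesis using True by (simp add: F_def)
  next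
    case False
    then have d: "infdist (torus_embedding x) C > 0"
      using mem[OF x] C in_closed_iff_infdist_zero[OF C] infdist_nonneg[of "torus_embedding x" C] by fastforce
    obtain N :: nat where N: "1 / infdist (torus_embedding x) C < N" using reals_Archimedean2 by blast
    have "F n (torus_embedding x) = 0" if "n \<ge> N" for n
    proof -
      have "1 / infdist (torus_embedding x) C \<le> n" using N that by linarith
      then show ?thesis using d by (simp add: F_def field_simps)
    qed
    then have "eventually (\<lambda>n. F n (torus_embedding x) * h x = indicator T x * h x) sequentially"
      using False by (auto simp: eventually_sequentially)
    then show ?thesis by (rule tendsto_eventually)
  qed
  have [measurable]: "T \<in> sets lebesgue" using T by auto
  have [measurable]: "(\<lambda>x. F n (torus_embedding x)) \<in> borel_measurable T2" for n
    using integrable_continuous_T2[OF continuous_on_compose2[OF Fc continuous_torus_embedding, of UNIV UNIV n]] by auto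
  have ind [measurable]: "(indicator T :: real^2 \<Rightarrow> real) \<in> borel_measurable T2"
    using T box_subset_cbox by (intro indicator_measurable_T2) auto
  have "(\<lambda>n. LINT x|T2. F n (torus_embedding x) * h x) \<longlonglongrightarrow> (LINT x|T2. indicator T x * h x)"
  proof (rule integral_dominated_convergence[where w = "\<lambda>x. \<bar>h x\<bar>"])
    show "AE x in T2. (\<lambda>n. F n (torus_embedding x) * h x) \<longlonglongrightarrow> indicator T x * h x"
      by (rule AE_I2) (use lim in simp)
    have "\<bar>F n z\<bar> \<le> 1" for n z by (simp add: F_def infdist_nonneg)
    then show "AE x in T2. norm (F n (torus_embedding x) * h x) \<le> \<bar>h x\<bar>" for n
      by (simp add: abs_mult mult_left_le_one_le)
  qed (use h in auto)
  moreover have "(LINT x|T2. F n (torus_embedding x) * h x) = 0" for n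
    by (rule orthogonal_continuous[OF h orth Fc])
  ultimately show ?thesis by (simp add: LIMSEQ_const_iff)
qed simp

text \<open>By inner regularity the set where \<open>h > 0\<close> is exhausted by closed sets
  \<open>T\<close> up to arbitrarily small measure. The integral of \<open>h\<close> over
  \<open>T\<close> vanishes although \<open>h\<close> is positive there, hence \<open>T\<close> is a
  null set.\<close>

lemma orthogonal_imp_nonpos:
  fixes h :: "real^2 \<Rightarrow> real"
  assumes h: "integrable T2 h" and orth: "\<And>\<phi>. test_fun \<phi> \<Longrightarrow> (LINT x|T2. \<phi> x * h x) = 0"
  shows "{x \<in> box 0 1. h x > 0} \<in> null_sets lebesgue"
proof -
  define S where "S = {x \<in> box 0 1. h x > 0}"
  have [measurable]: "h \<in> borel_measurable T2" using h by auto
  have "{x \<in> space T2. h x > 0} \<in> sets T2" by measurable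
  then have "{x \<in> space T2. h x > 0} \<in> sets lebesgue"
    by (simp add: sets_restrict_space_iff)
  moreover have "S = {x \<in> space T2. h x > 0} \<inter> box 0 1"
    using box_subset_cbox by (auto simp: S_def)
  ultimately have S: "S \<in> sets lebesgue" by auto
  have "emeasure lebesgue S \<le> 0 + ennreal e" if e: "e > 0" for e :: real
  proof -
    obtain T where T: "closed T" "T \<subseteq> S" "S - T \<in> lmeasurable" "emeasure lebesgue (S - T) < ennreal e"
      using sets_lebesgue_inner_closed[OF S e] .
    have Ts: "T \<in> sets lebesgue" "T \<subseteq> cbox 0 1" using T box_subset_cbox by (auto simp: S_def)
    have ind [measurable]: "(indicator T :: real^2 \<Rightarrow> real) \<in> borel_measurable T2"
      by (rule indicator_measurable_T2[OF Ts])
    have "(LINT x|T2. indicator T x * h x) = 0"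
      by (rule orthogonal_indicator[OF h orth]) (use T in \<open>auto simp: S_def\<close>)
    moreover have "integrable T2 (\<lambda>x. indicator T x * h x)"
    proof (rule Bochner_Integration.integrable_bound[OF h])
      show "(\<lambda>x. indicator T x * h x) \<in> borel_measurable T2" by measurable
    qed (auto simp: indicator_def)
    moreover have "AE x in T2. 0 \<le> indicator T x * h x"
      by (rule AE_I2) (use T(2) in \<open>auto simp: S_def indicator_def intro: less_imp_le\<close>)
    ultimately have "AE x in T2. indicator T x * h x = 0"
      using integral_nonneg_eq_0_iff_AE by blast
    then have "AE x in T2. x \<notin> T"
      by (rule eventually_mono) (use T in \<open>auto simp: S_def indicator_def split: if_splits\<close>)
    then have "AE x in lebesgue. x \<in> cbox 0 1 \<longrightarrow> x \<notin> T"
      by (subst (asm) AE_restrict_space_iff) auto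
    then have "AE x in lebesgue. x \<notin> T"
      by (rule eventually_mono) (use Ts in auto)
    then have "T \<in> null_sets lebesgue"
      using AE_iff_null_sets[OF Ts(1)] by simp
    then have "emeasure lebesgue T = 0" by auto
    moreover have "emeasure lebesgue S \<le> emeasure lebesgue (S - T) + emeasure lebesgue T"
      using emeasure_subadditive[of "S - T" lebesgue T] T(2,3) Ts by (simp add: Un_absorb2 fmeasurableD)
    ultimately have "emeasure lebesgue S \<le> emeasure lebesgue (S - T)" by (simp only: add_0_right)
    also have "\<dots> \<le> 0 + ennreal e" unfolding add_0 by (rule less_imp_le[OF T(4)])
    finally show ?thesis .
  qed
  then have "emeasure lebesgue S \<le> 0"
    by (rule ennreal_le_epsilon)
  then have "emeasure lebesgue S = 0" by simp
  then show ?thesis using S by (auto simp: S_def null_sets_def)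
qed

lemma orthogonal_imp_zero:
  fixes h :: "real^2 \<Rightarrow> real"
  assumes h: "integrable T2 h" and orth: "\<And>\<phi>. test_fun \<phi> \<Longrightarrow> (LINT x|T2. \<phi> x * h x) = 0"
  shows "AE x in T2. h x = 0"
proof -
  have "{x \<in> box 0 1. h x > 0} \<in> null_sets lebesgue"
    by (rule orthogonal_imp_nonpos[OF h orth])
  moreover have "{x \<in> box 0 1. - h x > 0} \<in> null_sets lebesgue"
    by (rule orthogonal_imp_nonpos) (use h orth in auto)
  moreover have "cbox 0 1 - box 0 (1::real^2) \<in> null_sets lebesgue"
    using negligible_frontier_interval negligible_iff_null_sets by blast
  ultimately have "AE x in lebesgue. x \<notin> {x \<in> box 0 1. h x > 0} \<and> x \<notin> {x \<in> box 0 1. - h x > 0} \<and> x \<notin> cbox 0 1 - box 0 (1::real^2)"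
    using AE_not_in by (auto simp only: AE_conj_iff)
  then have "AE x in lebesgue. x \<in> cbox 0 1 \<longrightarrow> h x = 0"
    by (rule eventually_mono) auto
  then show ?thesis by (subst AE_restrict_space_iff) auto
qed

text \<open>The advection term is defined through \<open>weak_partial\<close>, a choice among all
  weak derivatives. Uniqueness up to null sets allows it to be computed from the explicit series for
  the derivative.\<close>

lemma has_weak_partial_unique:
  fixes f :: "real^2 \<Rightarrow> real^2"
  assumes g: "has_weak_partial j f g" and g': "has_weak_partial j f g'"
  shows "AE x in T2. g x = g' x"
proof -
  have c: "AE x in T2. g x $ i = g' x $ i" for i
  proof -
    have int: "integrable T2 (\<lambda>x. g x $ i)" "integrable T2 (\<lambda>x. g' x $ i)"
      using g g' by (auto simp: has_weak_partial_def intro: integrable_vec_nth)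
    have "AE x in T2. g x $ i - g' x $ i = 0"
    proof (rule orthogonal_imp_zero)
      fix \<phi> assume \<phi>: "test_fun \<phi>"
      have iv: "integrable T2 (\<lambda>x. \<phi> x *\<^sub>R k x)" if "integrable T2 k" for k :: "real^2 \<Rightarrow> real^2"
        using integrable_continuous_scaleR[OF C1_continuous[OF test_fun_C1[OF \<phi>]] that] .
      have i: "integrable T2 (\<lambda>x. \<phi> x *\<^sub>R g x)" "integrable T2 (\<lambda>x. \<phi> x *\<^sub>R g' x)"
        using g g' by (auto simp: has_weak_partial_def intro: iv)
      have "(LINT x|T2. \<phi> x *\<^sub>R g x) = (LINT x|T2. \<phi> x *\<^sub>R g' x)"
        using g g' \<phi> by (auto simp: has_weak_partial_def)
      then have "(LINT x|T2. (\<phi> x *\<^sub>R g x) $ i) = (LINT x|T2. (\<phi> x *\<^sub>R g' x) $ i)"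
        using integral_vec_nth[OF i(1)] integral_vec_nth[OF i(2)] by metis
      then show "(LINT x|T2. \<phi> x * (g x $ i - g' x $ i)) = 0"
        using i[THEN integrable_vec_nth, of i] by (simp add: right_diff_distrib)
    qed (use int in auto)
    then show ?thesis by simp
  qed
  show ?thesis
    using c[of 1] c[of 2] by eventually_elim (simp add: vec_eq_iff forall_2)
qed

section \<open>Fourier multipliers\<close>

text \<open>The symbols for which \<^const>\<open>fourier_multiplier\<close> is a finite sum and maps real functions to
  real functions.\<close>

definition finite_symbol :: "(real^2 \<Rightarrow> real) \<Rightarrow> bool" where
  "finite_symbol m \<longleftrightarrow> (\<forall>\<xi>. m (- \<xi>) = m \<xi>) \<and> finite {\<alpha>. m (freq \<alpha>) \<noteq> 0}"

lemma fourier_coeff_wave: "fourier_coeff f \<alpha> = (LINT x|T2. wave (- \<alpha>) x * complex_of_real (f x))"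
  by (simp add: fourier_coeff_def wave_def freq_minus)

lemma integrable_wave_mult:
  fixes f :: "real^2 \<Rightarrow> real"
  assumes "integrable T2 f"
  shows "integrable T2 (\<lambda>x. wave \<alpha> x * complex_of_real (f x))"
proof -
  have [measurable]: "f \<in> borel_measurable T2" "wave \<alpha> \<in> borel_measurable T2"
    using assms integrable_wave by auto
  show ?thesis
  proof (rule Bochner_Integration.integrable_bound[OF assms])
    show "(\<lambda>x. wave \<alpha> x * complex_of_real (f x)) \<in> borel_measurable T2" by measurable
  qed (auto simp: norm_mult)
qed

lemma fourier_coeff_minus:
  assumes "integrable T2 f" shows "fourier_coeff f (- \<alpha>) = cnj (fourier_coeff f \<alpha>)"
proof -
  have "cnj (fourier_coeff f \<alpha>) = (LINT x|T2. cnj (wave (- \<alpha>) x * complex_of_real (f x)))"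
    unfolding fourier_coeff_wave
    by (rule integral_bounded_linear[OF bounded_linear_cnj, symmetric]) (rule integrable_wave_mult[OF assms])
  then show ?thesis by (simp add: fourier_coeff_wave wave_minus)
qed

text \<open>The real part is half the sum of the wave and its conjugate, which has the opposite
  frequency. For \<open>\<beta> = 0\<close> both cases apply and add up to
  \<open>Re w\<close>.\<close>

lemma fourier_coeff_Re_wave:
  "fourier_coeff (\<lambda>x. Re (w * wave \<beta> x)) \<alpha> = (if \<alpha> = \<beta> then w / 2 else 0) + (if \<alpha> = - \<beta> then cnj w / 2 else 0)"
proof -
  have eq: "wave (- \<alpha>) x * complex_of_real (Re (w * wave \<beta> x)) = w / 2 * wave (\<beta> - \<alpha>) x + cnj w / 2 * wave (- \<beta> - \<alpha>) x" for x
  proof -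
    have "complex_of_real (Re (w * wave \<beta> x)) = (w * wave \<beta> x + cnj (w * wave \<beta> x)) / 2"
      by (subst complex_add_cnj) simp
    then show ?thesis
      by (simp add: wave_add[of \<beta> "- \<alpha>", simplified] wave_add[of "- \<beta>" "- \<alpha>", simplified] wave_minus algebra_simps add_divide_distrib)
  qed
  have "fourier_coeff (\<lambda>x. Re (w * wave \<beta> x)) \<alpha> = w / 2 * (LINT x|T2. wave (\<beta> - \<alpha>) x) + cnj w / 2 * (LINT x|T2. wave (- \<beta> - \<alpha>) x)"
    unfolding fourier_coeff_wave eq by (subst Bochner_Integration.integral_add) (auto simp: integrable_wave)
  moreover have "\<beta> - \<alpha> = 0 \<longleftrightarrow> \<alpha> = \<beta>" "- \<beta> - \<alpha> = 0 \<longleftrightarrow> \<alpha> = - \<beta>"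
    by (metis right_minus_eq)+
  ultimately show ?thesis by (simp only: integral_wave) (simp split: if_split)
qed

lemma fourier_coeff_sum:
  assumes "\<And>i. i \<in> I \<Longrightarrow> integrable T2 (f i)"
  shows "fourier_coeff (\<lambda>x. \<Sum>i\<in>I. f i x) \<alpha> = (\<Sum>i\<in>I. fourier_coeff (f i) \<alpha>)"
  unfolding fourier_coeff_wave of_real_sum sum_distrib_left
  by (rule Bochner_Integration.integral_sum) (rule integrable_wave_mult[OF assms])

text \<open>Waves have modulus one, so absolute convergence in L^1 justifies integrating term by
  term.\<close>

lemma fourier_coeff_sums:
  assumes int: "\<And>k. integrable T2 (f k)" and ae: "AE x in T2. summable (\<lambda>k. \<bar>f k x\<bar>)"
    and sm: "summable (\<lambda>k. LINT x|T2. \<bar>f k x\<bar>)"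
  shows "(\<lambda>k. fourier_coeff (f k) \<alpha>) sums fourier_coeff (\<lambda>x. \<Sum>k. f k x) \<alpha>"
proof -
  have "(\<lambda>k. LINT x|T2. wave (- \<alpha>) x * complex_of_real (f k x)) sums (LINT x|T2. (\<Sum>k. wave (- \<alpha>) x * complex_of_real (f k x)))"
    by (rule sums_integral) (use int ae sm in \<open>auto simp: norm_mult integrable_wave_mult\<close>)
  moreover have "(LINT x|T2. (\<Sum>k. wave (- \<alpha>) x * complex_of_real (f k x))) = (LINT x|T2. wave (- \<alpha>) x * complex_of_real (\<Sum>k. f k x))"
  proof (rule integral_cong_AE)
    have [measurable]: "f k \<in> borel_measurable T2" "wave \<beta> \<in> borel_measurable T2" for k \<beta>
      using int integrable_wave by auto
    show "(\<lambda>x. \<Sum>k. wave (- \<alpha>) x * complex_of_real (f k x)) \<in> borel_measurable T2" by measurable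
    show "(\<lambda>x. wave (- \<alpha>) x * complex_of_real (\<Sum>k. f k x)) \<in> borel_measurable T2" by measurable
    show "AE x in T2. (\<Sum>k. wave (- \<alpha>) x * complex_of_real (f k x)) = wave (- \<alpha>) x * complex_of_real (\<Sum>k. f k x)"
      using ae
    proof eventually_elim
      case (elim x)
      then have "summable (\<lambda>k. f k x)" by (rule summable_rabs_cancel)
      then show ?case
        by (simp add: suminf_mult suminf_of_real summable_of_real)
    qed
  qed
  ultimately show ?thesis by (simp add: fourier_coeff_wave)
qed

lemma fourier_multiplier_finite:
  assumes "finite_symbol m"
  shows "fourier_multiplier m f x = (\<Sum>\<alpha> | m (freq \<alpha>) \<noteq> 0. Re (of_real (m (freq \<alpha>)) * fourier_coeff f \<alpha> * wave \<alpha> x))"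
proof -
  have "(\<Sum>\<^sub>\<infinity>\<alpha>. complex_of_real (m (freq \<alpha>)) * fourier_coeff f \<alpha> * cis (2 * pi * (freq \<alpha> \<bullet> x)))
      = (\<Sum>\<^sub>\<infinity>\<alpha>\<in>{\<alpha>. m (freq \<alpha>) \<noteq> 0}. complex_of_real (m (freq \<alpha>)) * fourier_coeff f \<alpha> * wave \<alpha> x)"
    by (rule infsum_cong_neutral) (auto simp: wave_def)
  also have "\<dots> = (\<Sum>\<alpha> | m (freq \<alpha>) \<noteq> 0. complex_of_real (m (freq \<alpha>)) * fourier_coeff f \<alpha> * wave \<alpha> x)"
    by (rule infsum_finite) (use assms in \<open>simp add: finite_symbol_def\<close>)
  finally show ?thesis by (simp add: fourier_multiplier_def del: times_complex.sel)
qed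

lemma fourier_multiplier_sum:
  assumes "finite_symbol m" "\<And>i. i \<in> I \<Longrightarrow> integrable T2 (f i)"
  shows "fourier_multiplier m (\<lambda>x. \<Sum>i\<in>I. f i x) x = (\<Sum>i\<in>I. fourier_multiplier m (f i) x)"
  unfolding fourier_multiplier_finite[OF assms(1)]
  by (subst sum.swap) (simp add: fourier_coeff_sum assms sum_distrib_left sum_distrib_right flip: Re_sum del: times_complex.sel)

lemma fourier_multiplier_sums:
  assumes "finite_symbol m" "\<And>k. integrable T2 (f k)" "AE x in T2. summable (\<lambda>k. \<bar>f k x\<bar>)"
    "summable (\<lambda>k. LINT x|T2. \<bar>f k x\<bar>)"
  shows "(\<lambda>k. fourier_multiplier m (f k) x) sums fourier_multiplier m (\<lambda>x. \<Sum>k. f k x) x"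
  unfolding fourier_multiplier_finite[OF assms(1)]
  by (intro sums_sum bounded_linear.sums[OF bounded_linear_Re] sums_mult2 sums_mult fourier_coeff_sums assms(2-))

text \<open>The wave and its conjugate are multiplied by \<open>m\<close> at opposite frequencies;
  evenness of the symbol makes these two factors equal.\<close>

lemma fourier_multiplier_Re_wave:
  assumes m: "finite_symbol m"
  shows "fourier_multiplier m (\<lambda>x. Re (w * wave \<beta> x)) x = m (freq \<beta>) * Re (w * wave \<beta> x)"
proof -
  let ?A = "{\<alpha>. m (freq \<alpha>) \<noteq> 0}"
  have fin: "finite ?A" and ev: "m (freq (- \<beta>)) = m (freq \<beta>)"
    using m by (auto simp: finite_symbol_def freq_minus)
  have distr: "c * ((if P then a else 0) + (if Q then b else 0)) * d = (if P then c * a * d else 0) + (if Q then c * b * d else 0)"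
    for a b c d :: complex and P Q
    by (cases P; cases Q) (simp_all add: distrib_left distrib_right)
  have "fourier_multiplier m (\<lambda>x. Re (w * wave \<beta> x)) x
     = Re (\<Sum>\<alpha>\<in>?A. (if \<alpha> = \<beta> then of_real (m (freq \<alpha>)) * (w / 2) * wave \<alpha> x else 0)
          + (if \<alpha> = - \<beta> then of_real (m (freq \<alpha>)) * (cnj w / 2) * wave \<alpha> x else 0))"
    unfolding fourier_multiplier_finite[OF m] fourier_coeff_Re_wave Re_sum[symmetric]
    by (intro arg_cong[where f = Re] sum.cong refl distr)
  also have "\<dots> = Re (of_real (m (freq \<beta>)) * (w / 2 * wave \<beta> x + cnj w / 2 * wave (- \<beta>) x))"
    unfolding sum.distrib sum.delta[OF fin] using ev by (auto simp: distrib_left mult.assoc)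
  also have "\<dots> = m (freq \<beta>) * Re (w * wave \<beta> x)"
    by (simp add: wave_minus field_simps)
  finally show ?thesis .
qed

lemma fourier_multiplier_trig_poly:
  assumes m: "finite_symbol m"
  shows "fourier_multiplier m (trig_poly I w \<alpha>) = trig_poly I (\<lambda>i. of_real (m (freq (\<alpha> i))) * w i) \<alpha>"
proof
  fix x
  have "fourier_multiplier m (trig_poly I w \<alpha>) x = (\<Sum>i\<in>I. fourier_multiplier m (\<lambda>x. Re (w i * wave (\<alpha> i) x)) x)"
    unfolding trig_poly_def[abs_def]
    by (rule fourier_multiplier_sum[OF m]) (intro integrable_continuous_T2 continuous_intros)
  also have "\<dots> = (\<Sum>i\<in>I. m (freq (\<alpha> i)) * Re (w i * wave (\<alpha> i) x))"
    by (simp only: fourier_multiplier_Re_wave[OF m])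
  also have "\<dots> = trig_poly I (\<lambda>i. of_real (m (freq (\<alpha> i))) * w i) \<alpha> x"
    unfolding trig_poly_def by (simp add: mult.assoc algebra_simps)
  finally show "fourier_multiplier m (trig_poly I w \<alpha>) x = trig_poly I (\<lambda>i. of_real (m (freq (\<alpha> i))) * w i) \<alpha> x" .
qed

lemma integral_Re_wave_Re_wave:
  "(LINT x|T2. Re (w * wave \<beta> x) * Re (z * wave \<alpha> x)) = (if \<alpha> = - \<beta> then Re (w * z) / 2 else 0) + (if \<alpha> = \<beta> then Re (w * cnj z) / 2 else 0)"
proof -
  have eq: "Re (w * wave \<beta> x) * Re (z * wave \<alpha> x) = Re (w * z * wave \<beta> x * cnj (wave (- \<alpha>) x)) / 2 + Re (w * cnj z * wave \<beta> x * cnj (wave \<alpha> x)) / 2" for x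
  proof -
    have "Re p * Re q = Re (p * q) / 2 + Re (p * cnj q) / 2" for p q :: complex
      by (simp add: field_simps)
    from this[of "w * wave \<beta> x" "z * wave \<alpha> x"] show ?thesis
      by (simp only: wave_minus complex_cnj_cnj complex_cnj_mult mult_ac)
  qed
  have int: "integrable T2 (\<lambda>x. Re (v * wave \<beta> x * cnj (wave \<gamma> x)))" for v \<beta> \<gamma>
    by (intro integrable_continuous_T2 continuous_intros)
  have "\<beta> = - \<alpha> \<longleftrightarrow> \<alpha> = - \<beta>" by auto
  then show ?thesis
    unfolding eq using int by (subst Bochner_Integration.integral_add) (auto simp: integral_Re_wave_prod simp del: times_complex.sel)
qed

text \<open>\<open>F\<close> is merely integrable, as befits the advection term, so
  square-integrability is avoided: one side is a finite sum of waves, and for a single wave the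
  claim picks out the Fourier coefficients of \<open>F\<close> at \<open>\<beta>\<close> and
  \<open>- \<beta>\<close>.\<close>

lemma fourier_multiplier_self_adjoint:
  assumes m: "finite_symbol m" and F: "integrable T2 F"
  shows "(LINT x|T2. trig_poly I w \<alpha> x * fourier_multiplier m F x) = (LINT x|T2. fourier_multiplier m (trig_poly I w \<alpha>) x * F x)"
proof -
  let ?A = "{\<alpha>. m (freq \<alpha>) \<noteq> 0}"
  have fin: "finite ?A" using m by (auto simp: finite_symbol_def)
  have iF: "integrable T2 (\<lambda>x. Re (v * wave \<beta> x) * F x)" for v \<beta>
  proof -
    have "integrable T2 (\<lambda>x. Re (v * wave \<beta> x) *\<^sub>R F x)"
      by (intro integrable_continuous_scaleR F continuous_intros)
    then show ?thesis by simp
  qed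
  have 1: "(LINT x|T2. Re (v * wave \<beta> x) * fourier_multiplier m F x) = (LINT x|T2. m (freq \<beta>) * Re (v * wave \<beta> x) * F x)" for v \<beta>
  proof -
    have ev: "m (freq (- \<beta>)) = m (freq \<beta>)" using m by (auto simp: finite_symbol_def freq_minus)
    define c where "c \<gamma> = of_real (m (freq \<gamma>)) * fourier_coeff F \<gamma>" for \<gamma>
    have "(LINT x|T2. Re (v * wave \<beta> x) * fourier_multiplier m F x)
        = (\<Sum>\<gamma>\<in>?A. LINT x|T2. Re (v * wave \<beta> x) * Re (c \<gamma> * wave \<gamma> x))"
      unfolding fourier_multiplier_finite[OF m] c_def sum_distrib_left
      by (rule Bochner_Integration.integral_sum) (intro integrable_continuous_T2 continuous_intros)
    also have "\<dots> = (\<Sum>\<gamma>\<in>?A. (if \<gamma> = - \<beta> then Re (v * c \<gamma>) / 2 else 0) + (if \<gamma> = \<beta> then Re (v * cnj (c \<gamma>)) / 2 else 0))"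
      unfolding integral_Re_wave_Re_wave ..
    also have "\<dots> = Re (v * c (- \<beta>)) / 2 + Re (v * cnj (c \<beta>)) / 2"
      unfolding sum.distrib sum.delta[OF fin] using ev by (auto simp: c_def)
    also have "\<dots> = m (freq \<beta>) * Re (v * fourier_coeff F (- \<beta>))"
      by (simp add: c_def ev fourier_coeff_minus[OF F] field_simps)
    also have "fourier_coeff F (- \<beta>) = (LINT x|T2. wave \<beta> x * complex_of_real (F x))"
      by (simp add: fourier_coeff_wave)
    also have "m (freq \<beta>) * Re (v * (LINT x|T2. wave \<beta> x * complex_of_real (F x)))
        = m (freq \<beta>) * (LINT x|T2. Re (v * (wave \<beta> x * complex_of_real (F x))))"
      by (subst integral_Re) (use integrable_wave_mult[OF F] in \<open>auto simp del: times_complex.sel\<close>)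
    also have "\<dots> = (LINT x|T2. m (freq \<beta>) * Re (v * wave \<beta> x) * F x)"
      by (simp add: algebra_simps flip: Bochner_Integration.integral_mult_right_zero)
    finally show ?thesis .
  qed
  have c2: "continuous_on UNIV (\<lambda>x. fourier_multiplier m F x)"
    unfolding fourier_multiplier_finite[OF m] by (intro continuous_intros)
  have "(LINT x|T2. trig_poly I w \<alpha> x * fourier_multiplier m F x) = (\<Sum>i\<in>I. LINT x|T2. Re (w i * wave (\<alpha> i) x) * fourier_multiplier m F x)"
    unfolding trig_poly_def sum_distrib_right
    by (rule Bochner_Integration.integral_sum) (intro integrable_continuous_T2 continuous_intros c2)
  also have "\<dots> = (\<Sum>i\<in>I. LINT x|T2. m (freq (\<alpha> i)) * Re (w i * wave (\<alpha> i) x) * F x)"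
    by (simp only: 1)
  also have "\<dots> = (LINT x|T2. (\<Sum>i\<in>I. m (freq (\<alpha> i)) * Re (w i * wave (\<alpha> i) x) * F x))"
    by (rule Bochner_Integration.integral_sum[symmetric]) (use iF in \<open>simp add: mult.assoc del: times_complex.sel\<close>)
  also have "\<dots> = (LINT x|T2. fourier_multiplier m (trig_poly I w \<alpha>) x * F x)"
    unfolding fourier_multiplier_trig_poly[OF m] trig_poly_def sum_distrib_right by (simp add: mult.assoc algebra_simps)
  finally show ?thesis .
qed

section \<open>A single block\<close>

text \<open>A block at scale \<open>m = t\<^sup>3\<close> is the rotated gradient of a stream function whose spectrum consists
  of three clusters (and their reflections). The third center is the sum of the other two, which
  creates resonant triads; cluster 0 lies at low frequencies. A mode is a cluster together with two
  grid points added to its center, so that each cluster is a modulated product of two trigonometric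
  polynomials.\<close>

type_synonym mode = "nat \<times> (int \<times> int) \<times> (int \<times> int)"

definition grid :: "nat \<Rightarrow> (int \<times> int) set" where
  "grid m = {- 5 * int m..5 * int m} \<times> {- 5 * int m..5 * int m}"

definition vec2 :: "int \<times> int \<Rightarrow> int^2" where
  "vec2 p = (\<chi> i. if i = 1 then fst p else snd p)"

text \<open>The modes of a cluster deviate from its center by at most \<open>10 * m\<close> per
  coordinate. The spacings \<open>256 * m\<close> and \<open>2048 * m\<close> are large against
  this, so the only resonances involving cluster 0 come from the additive relation between the three
  centers.\<close>

definition center :: "nat \<Rightarrow> nat \<Rightarrow> int \<times> int" where
  "center m s = (if s = 0 then (256 * int m, 0) else if s = 1 then (256 * int m, - 2048 * int m)
     else (512 * int m, - 2048 * int m))"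

definition block_freq :: "nat \<Rightarrow> mode \<Rightarrow> int^2" where
  "block_freq m i = vec2 (center m (fst i)) + vec2 (fst (snd i)) + vec2 (snd (snd i))"

definition block_index :: "nat \<Rightarrow> mode set" where
  "block_index m = {0, 1, 2} \<times> grid m \<times> grid m"

text \<open>A rotation of the frequency by a right angle. It is orthogonal to
  \<open>\<alpha>\<close>, which makes the field divergence-free, and it preserves inner
  products.\<close>

definition perp :: "int^2 \<Rightarrow> 2 \<Rightarrow> int" where
  "perp \<alpha> l = (if l = 1 then \<alpha> $ 2 else - (\<alpha> $ 1))"

text \<open>The factor \<open>- \<i>\<close> turns the real part into a sine: the field is the
  rotated gradient of a sum of cosines with coefficients \<open>\<sigma> i / t^14\<close>. Typical
  frequencies occur of order \<open>m^2 = t^6\<close> times and have size of order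
  \<open>t^3\<close>, so the merged coefficients have size about \<open>t^-5 = m^(-5/3)\<close>. The
  weight \<open>\<sigma>\<close> records the effect of a Fourier multiplier.\<close>

definition block_field :: "nat \<Rightarrow> (mode \<Rightarrow> real) \<Rightarrow> real^2 \<Rightarrow> real^2" where
  "block_field t \<sigma> x = (\<chi> l. trig_poly (block_index (t^3))
     (\<lambda>i. of_real (\<sigma> i) * (- \<i> * of_real (2 * pi / t^14 * perp (block_freq (t^3) i) l))) (block_freq (t^3)) x)"

definition block_grad :: "nat \<Rightarrow> 2 \<Rightarrow> real^2 \<Rightarrow> real^2" where
  "block_grad t j x = (\<chi> l. trig_poly (block_index (t^3))
     (\<lambda>i. of_real ((2 * pi)^2 / t^14 * (block_freq (t^3) i $ j * perp (block_freq (t^3) i) l))) (block_freq (t^3)) x)"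

lemma vec2_nth [simp]: "vec2 p $ 1 = fst p" "vec2 p $ 2 = snd p"
  by (simp_all add: vec2_def)

lemma inj_vec2: "inj vec2"
  by (auto simp: inj_def vec_eq_iff vec2_def forall_2)

lemma finite_grid [simp]: "finite (grid m)"
  by (simp add: grid_def)

lemma finite_block_index [simp]: "finite (block_index m)"
  by (simp add: block_index_def)

lemma card_grid: "real (card (grid m)) \<le> 121 * (real m)^2" if "m \<ge> 1"
proof -
  have "card (grid m) = (10 * m + 1) * (10 * m + 1)"
    by (simp add: grid_def card_cartesian_product nat_add_distrib nat_mult_distrib)
  also have "real \<dots> \<le> (11 * real m) * (11 * real m)"
    unfolding of_nat_mult by (rule mult_mono) (use that in auto)
  finally show ?thesis by (simp add: power2_eq_square)
qed

lemma card_block_index: "real (card (block_index m)) \<le> 43923 * (real m)^4" if "m \<ge> 1"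
proof -
  have "real (card (block_index m)) = 3 * (real (card (grid m)) * real (card (grid m)))"
    by (simp add: block_index_def card_cartesian_product)
  also have "\<dots> \<le> 3 * ((121 * (real m)^2) * (121 * (real m)^2))"
    by (intro mult_left_mono mult_mono card_grid that) auto
  finally show ?thesis by (simp add: power_numeral_reduce)
qed

text \<open>Given the frequency, a mode is determined by its cluster and its first grid point, since
  the second grid point is then the remainder.\<close>

lemma block_multiplicity:
  assumes "m \<ge> 1"
  shows "card {j \<in> block_index m. block_freq m i = block_freq m j} \<le> 363 * m^2"
proof -
  let ?S = "{j \<in> block_index m. block_freq m i = block_freq m j}"
  have "inj_on (\<lambda>j. (fst j, fst (snd j))) ?S"
    by (rule inj_onI) (auto simp: block_freq_def dest: injD[OF inj_vec2])
  moreover have "(\<lambda>j. (fst j, fst (snd j))) ` ?S \<subseteq> {0, 1, 2} \<times> grid m"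
    by (auto simp: block_index_def)
  ultimately have "card ?S \<le> card ({0, 1, 2::nat} \<times> grid m)"
    by (intro card_inj_on_le) auto
  also have "\<dots> = 3 * card (grid m)"
    by (simp add: card_cartesian_product)
  finally have "real (card ?S) \<le> 3 * real (card (grid m))" by linarith
  then have "real (card ?S) \<le> real (363 * m^2)" using card_grid[OF assms] by simp
  then show ?thesis by (simp only: of_nat_le_iff)
qed

lemma grid_bound: "p \<in> grid m \<Longrightarrow> \<bar>vec2 p $ j\<bar> \<le> 5 * int m"
  using exhaust_2[of j] by (auto simp: grid_def)

lemma center_bound: "\<bar>vec2 (center m s) $ j\<bar> \<le> 2048 * int m"
  using exhaust_2[of j] by (auto simp: center_def)

lemma block_freq_near:
  assumes "i \<in> block_index m"
  shows "\<bar>block_freq m i $ 1 - fst (center m (fst i))\<bar> \<le> 10 * int m" "\<bar>block_freq m i $ 2 - snd (center m (fst i))\<bar> \<le> 10 * int m"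
proof -
  have "\<bar>vec2 (fst (snd i)) $ j\<bar> \<le> 5 * int m" "\<bar>vec2 (snd (snd i)) $ j\<bar> \<le> 5 * int m" for j
    using assms by (auto simp: block_index_def intro!: grid_bound)
  from this[of 1] this[of 2] show "\<bar>block_freq m i $ 1 - fst (center m (fst i))\<bar> \<le> 10 * int m" "\<bar>block_freq m i $ 2 - snd (center m (fst i))\<bar> \<le> 10 * int m"
    by (auto simp: block_freq_def)
qed

lemma block_freq_bound:
  assumes "i \<in> block_index m"
  shows "\<bar>block_freq m i $ j\<bar> \<le> 2100 * int m"
  using block_freq_near[OF assms] center_bound[of m "fst i" 1] center_bound[of m "fst i" 2] exhaust_2[of j]
  by auto

lemma perp_bound:
  assumes "i \<in> block_index m"
  shows "\<bar>perp (block_freq m i) l\<bar> \<le> 2100 * int m"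
  using block_freq_bound[OF assms] by (auto simp: perp_def)

lemma of_int_bound: "\<bar>k\<bar> \<le> c * int m \<Longrightarrow> \<bar>real_of_int k\<bar> \<le> real_of_int c * real m"
  by (metis of_int_abs of_int_le_iff of_int_mult of_int_of_nat_eq)

lemma field_weight_bound:
  assumes "i \<in> block_index (t^3)" "\<bar>\<sigma> i\<bar> \<le> B" "t \<ge> 1"
  shows "norm (of_real (\<sigma> i) * (- \<i> * of_real (2 * pi / t^14 * perp (block_freq (t^3) i) l))) \<le> (2 * pi * 2100) * B / t^11"
proof -
  have "\<bar>real_of_int (perp (block_freq (t^3) i) l)\<bar> \<le> 2100 * real t^3"
    using of_int_bound[OF perp_bound[OF assms(1), of l]] by simp
  then have "\<bar>\<sigma> i\<bar> * (2 * pi / t^14 * \<bar>real_of_int (perp (block_freq (t^3) i) l)\<bar>) \<le> B * (2 * pi / t^14 * (2100 * real t^3))"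
    using assms by (intro mult_mono mult_left_mono) auto
  also have "\<dots> = (2 * pi * 2100) * B / t^11"
    using assms(3) by (simp add: field_simps flip: power_add)
  finally show ?thesis by (simp only: norm_mult norm_minus_cancel norm_ii norm_of_real mult_1) (simp add: abs_mult)
qed

lemma grad_weight_bound:
  assumes "i \<in> block_index (t^3)" "t \<ge> 1"
  shows "norm (complex_of_real ((2 * pi)^2 / t^14 * (block_freq (t^3) i $ j * perp (block_freq (t^3) i) l))) \<le> (2 * pi * 2100)^2 / t^8"
proof -
  have "\<bar>real_of_int (perp (block_freq (t^3) i) l)\<bar> \<le> 2100 * real t^3" "\<bar>real_of_int (block_freq (t^3) i $ j)\<bar> \<le> 2100 * real t^3"
    using of_int_bound[OF perp_bound[OF assms(1), of l]] of_int_bound[OF block_freq_bound[OF assms(1), of j]] by simp_all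
  then have "(2 * pi)^2 / t^14 * (\<bar>real_of_int (block_freq (t^3) i $ j)\<bar> * \<bar>real_of_int (perp (block_freq (t^3) i) l)\<bar>) \<le> (2 * pi)^2 / t^14 * ((2100 * real t^3) * (2100 * real t^3))"
    by (intro mult_mono mult_left_mono) auto
  also have "\<dots> = (2 * pi * 2100)^2 / t^8"
    using assms(2) by (simp add: field_simps power2_eq_square flip: power_add)
  finally show ?thesis by (simp only: norm_of_real abs_mult of_int_mult) (simp add: abs_mult)
qed

text \<open>About \<open>m^4 = t^12\<close> modes of size \<open>t^-11\<close> add up to
  \<open>t\<close>.\<close>

lemma field_sup:
  assumes "\<And>i. i \<in> block_index (t^3) \<Longrightarrow> \<bar>\<sigma> i\<bar> \<le> B" "t \<ge> 1" "0 \<le> B"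
  shows "\<bar>block_field t \<sigma> x $ l\<bar> \<le> (2 * pi * 2100) * 43923 * B * t"
proof -
  have "\<bar>block_field t \<sigma> x $ l\<bar> \<le> (2 * pi * 2100) * B / t^11 * card (block_index (t^3))"
    unfolding block_field_def vec_lambda_beta by (rule trig_poly_bound) (rule field_weight_bound[OF _ assms(1,2)])
  also have "\<dots> \<le> (2 * pi * 2100) * B / t^11 * (43923 * real (t^3)^4)"
    by (intro mult_left_mono card_block_index) (use assms in auto)
  also have "\<dots> = (2 * pi * 2100) * 43923 * B * t"
    using assms(2) by (simp add: field_simps flip: power_mult power_Suc)
  finally show ?thesis .
qed

text \<open>Parseval gives \<open>t^-22 * t^12 * t^6 = t^-4\<close>, the value expected of a field
  of size \<open>t\<close> on a set of area \<open>t^-6\<close>. The same count with the larger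
  weights \<open>t^-8\<close> gives \<open>t^2\<close> for the gradient.\<close>

lemma field_L2:
  assumes "\<And>i. i \<in> block_index (t^3) \<Longrightarrow> \<bar>\<sigma> i\<bar> \<le> B" "t \<ge> 1" "0 \<le> B"
  shows "(LINT x|T2. (block_field t \<sigma> x $ l)^2) \<le> (2 * pi * 2100)^2 * 43923 * 363 * B^2 / t^4"
proof -
  have "(LINT x|T2. (block_field t \<sigma> x $ l)^2) \<le> ((2 * pi * 2100) * B / t^11)^2 * card (block_index (t^3)) * real (363 * (t^3)^2)"
    unfolding block_field_def vec_lambda_beta
    by (rule parseval_trig_poly[OF finite_block_index field_weight_bound[OF _ assms(1,2)] block_multiplicity])
       (use assms in auto)
  also have "\<dots> \<le> ((2 * pi * 2100) * B / t^11)^2 * (43923 * real (t^3)^4) * real (363 * (t^3)^2)"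
    by (intro mult_right_mono mult_left_mono card_block_index) (use assms in auto)
  also have "\<dots> = (2 * pi * 2100)^2 * 43923 * 363 * B^2 / t^4"
    using assms(2) by (simp add: power_mult_distrib power_divide field_simps flip: power_mult power_add)
  finally show ?thesis .
qed

lemma grad_sup:
  assumes "t \<ge> 1"
  shows "\<bar>block_grad t j x $ l\<bar> \<le> (2 * pi * 2100)^2 * 43923 * t^4"
proof -
  have "\<bar>block_grad t j x $ l\<bar> \<le> (2 * pi * 2100)^2 / t^8 * card (block_index (t^3))"
    unfolding block_grad_def vec_lambda_beta by (rule trig_poly_bound) (rule grad_weight_bound[OF _ assms])
  also have "\<dots> \<le> (2 * pi * 2100)^2 / t^8 * (43923 * real (t^3)^4)"
    by (intro mult_left_mono card_block_index) (use assms in auto)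
  also have "\<dots> = (2 * pi * 2100)^2 * 43923 * t^4"
    using assms by (simp add: field_simps flip: power_mult power_add)
  finally show ?thesis .
qed

lemma grad_L2:
  assumes "t \<ge> 1"
  shows "(LINT x|T2. (block_grad t j x $ l)^2) \<le> (2 * pi * 2100)^4 * 43923 * 363 * t^2"
proof -
  have "(LINT x|T2. (block_grad t j x $ l)^2) \<le> ((2 * pi * 2100)^2 / t^8)^2 * card (block_index (t^3)) * real (363 * (t^3)^2)"
    unfolding block_grad_def vec_lambda_beta
    by (rule parseval_trig_poly[OF finite_block_index grad_weight_bound[OF _ assms] block_multiplicity])
       (use assms in auto)
  also have "\<dots> \<le> ((2 * pi * 2100)^2 / t^8)^2 * (43923 * real (t^3)^4) * real (363 * (t^3)^2)"
    by (intro mult_right_mono mult_left_mono card_block_index) (use assms in auto)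
  also have "\<dots> = (2 * pi * 2100)^4 * 43923 * 363 * t^2"
    using assms by (simp add: power_divide field_simps flip: power_mult power_add)
  finally show ?thesis .
qed

text \<open>Parseval alone would only give a bound of order \<open>t\<close>. The weight of a mode
  is quadratic in its frequency, hence with \<open>A\<close> for center plus first grid point and
  \<open>V\<close> for the second it splits into four products of a function of the first grid point
  and one of the second. Each product is a modulated product of two trigonometric polynomials, for
  which Cauchy-Schwarz captures the concentration.\<close>

lemma grad_L1:
  assumes t: "t \<ge> 1"
  shows "(LINT x|T2. \<bar>block_grad t j x $ l\<bar>) \<le> (2 * pi * 2100)^2 * 1452 / t^2"
proof -
  define m where "m = t^3"
  define M where "M = 2100 * real m"
  \<comment> \<open>\<open>\<epsilon>\<close> and \<open>k\<close> express
    \<open>perp \<alpha> l\<close> as \<open>\<epsilon> * \<alpha> $ k\<close>.\<close>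
  define \<epsilon> :: real where "\<epsilon> = (if l = 1 then 1 else - 1)"
  define k :: 2 where "k = (if l = 1 then 2 else 1)"
  define A where "A s \<mu> j' = real_of_int ((vec2 (center m s) + vec2 \<mu>) $ j')" for s \<mu> and j' :: 2
  define V where "V \<nu> j' = real_of_int (vec2 \<nu> $ j')" for \<nu> and j' :: 2
  define S where "S s f g x = (\<Sum>\<mu>\<in>grid m. \<Sum>\<nu>\<in>grid m. Re (of_real (f \<mu> * g \<nu>) * wave (vec2 (center m s) + vec2 \<mu> + vec2 \<nu>) x))"
    for s and f g :: "int \<times> int \<Rightarrow> real" and x
  have m: "m \<ge> 1" using t by (simp add: m_def)
  have M: "0 < M" "1 \<le> M" using m by (auto simp: M_def)
  have Ab: "\<bar>A s \<mu> j'\<bar> \<le> M" if "\<mu> \<in> grid m" for s \<mu> j'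
  proof -
    have "\<bar>(vec2 (center m s) + vec2 \<mu>) $ j'\<bar> \<le> 2100 * int m"
      using grid_bound[OF that, of j'] center_bound[of m s j'] by simp
    from of_int_bound[OF this] show ?thesis by (simp add: A_def M_def)
  qed
  have Vb: "\<bar>V \<nu> j'\<bar> \<le> M" if "\<nu> \<in> grid m" for \<nu> j'
  proof -
    have "\<bar>vec2 \<nu> $ j'\<bar> \<le> 2100 * int m" using grid_bound[OF that, of j'] by simp
    from of_int_bound[OF this] show ?thesis by (simp add: V_def M_def)
  qed
  have S_int: "integrable T2 (S s f g)" for s f g
    unfolding S_def[abs_def] by (intro integrable_continuous_T2 continuous_intros)
  have S_L1: "(LINT x|T2. \<bar>S s f g x\<bar>) \<le> F * G * card (grid m)"
    if "0 < F" "0 < G" "\<And>\<mu>. \<mu> \<in> grid m \<Longrightarrow> \<bar>f \<mu>\<bar> \<le> F" "\<And>\<mu>. \<mu> \<in> grid m \<Longrightarrow> \<bar>g \<mu>\<bar> \<le> G" for s f g F G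
    unfolding S_def by (rule integral_abs_product_trig_poly) (use that inj_vec2 in \<open>auto intro: inj_on_subset\<close>)
  define Q where "Q s x = \<bar>S s (\<lambda>\<mu>. A s \<mu> j * A s \<mu> k) (\<lambda>\<nu>. 1) x\<bar> + \<bar>S s (\<lambda>\<mu>. A s \<mu> j) (\<lambda>\<nu>. V \<nu> k) x\<bar>
        + \<bar>S s (\<lambda>\<mu>. A s \<mu> k) (\<lambda>\<nu>. V \<nu> j) x\<bar> + \<bar>S s (\<lambda>\<mu>. 1) (\<lambda>\<nu>. V \<nu> j * V \<nu> k) x\<bar>" for s x
  have Q_int: "integrable T2 (Q s)" for s
    unfolding Q_def[abs_def] by (intro Bochner_Integration.integrable_add integrable_abs S_int)
  have MM: "\<bar>a * b\<bar> \<le> M * M" if "\<bar>a\<bar> \<le> M" "\<bar>b\<bar> \<le> M" for a b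
    unfolding abs_mult by (rule mult_mono) (use that M in auto)
  have Q_L1: "(LINT x|T2. Q s x) \<le> 4 * (M * M * card (grid m))" for s
  proof -
    have "(LINT x|T2. \<bar>S s (\<lambda>\<mu>. A s \<mu> j * A s \<mu> k) (\<lambda>\<nu>. 1) x\<bar>) \<le> M * M * 1 * card (grid m)"
      by (rule S_L1) (use M Ab MM in auto)
    moreover have "(LINT x|T2. \<bar>S s (\<lambda>\<mu>. A s \<mu> j) (\<lambda>\<nu>. V \<nu> k) x\<bar>) \<le> M * M * card (grid m)"
      by (rule S_L1) (use M Ab Vb in auto)
    moreover have "(LINT x|T2. \<bar>S s (\<lambda>\<mu>. A s \<mu> k) (\<lambda>\<nu>. V \<nu> j) x\<bar>) \<le> M * M * card (grid m)"
      by (rule S_L1) (use M Ab Vb in auto)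
    moreover have "(LINT x|T2. \<bar>S s (\<lambda>\<mu>. 1) (\<lambda>\<nu>. V \<nu> j * V \<nu> k) x\<bar>) \<le> 1 * (M * M) * card (grid m)"
      by (rule S_L1) (use M Vb MM in auto)
    ultimately show ?thesis
      unfolding Q_def by (subst Bochner_Integration.integral_add, (intro Bochner_Integration.integrable_add integrable_abs S_int)+)+ linarith
  qed
  have dec: "block_grad t j x $ l = (2 * pi)^2 / t^14 * \<epsilon> * (\<Sum>s\<in>{0,1,2}. S s (\<lambda>\<mu>. A s \<mu> j * A s \<mu> k) (\<lambda>\<nu>. 1) x
      + S s (\<lambda>\<mu>. A s \<mu> j) (\<lambda>\<nu>. V \<nu> k) x + S s (\<lambda>\<mu>. A s \<mu> k) (\<lambda>\<nu>. V \<nu> j) x + S s (\<lambda>\<mu>. 1) (\<lambda>\<nu>. V \<nu> j * V \<nu> k) x)" for x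
  proof -
    have w: "real_of_int (block_freq m (s, \<mu>, \<nu>) $ j * perp (block_freq m (s, \<mu>, \<nu>)) l)
        = \<epsilon> * (A s \<mu> j * A s \<mu> k * 1 + A s \<mu> j * V \<nu> k + A s \<mu> k * V \<nu> j + 1 * (V \<nu> j * V \<nu> k))" for s \<mu> \<nu>
      by (auto simp: block_freq_def perp_def \<epsilon>_def k_def A_def V_def algebra_simps)
    have "block_grad t j x $ l = (\<Sum>s\<in>{0,1,2}. \<Sum>\<mu>\<in>grid m. \<Sum>\<nu>\<in>grid m.
        Re (of_real ((2 * pi)^2 / t^14 * (block_freq m (s, \<mu>, \<nu>) $ j * perp (block_freq m (s, \<mu>, \<nu>)) l)) * wave (block_freq m (s, \<mu>, \<nu>)) x))"
      unfolding block_grad_def vec_lambda_beta trig_poly_def block_index_def m_def[symmetric]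
      by (simp only: sum.cartesian_product')
    also have "\<dots> = (\<Sum>s\<in>{0,1,2}. \<Sum>\<mu>\<in>grid m. \<Sum>\<nu>\<in>grid m. (2 * pi)^2 / t^14 * \<epsilon> *
        (Re (of_real (A s \<mu> j * A s \<mu> k * 1) * wave (vec2 (center m s) + vec2 \<mu> + vec2 \<nu>) x)
        + Re (of_real (A s \<mu> j * V \<nu> k) * wave (vec2 (center m s) + vec2 \<mu> + vec2 \<nu>) x)
        + Re (of_real (A s \<mu> k * V \<nu> j) * wave (vec2 (center m s) + vec2 \<mu> + vec2 \<nu>) x)
        + Re (of_real (1 * (V \<nu> j * V \<nu> k)) * wave (vec2 (center m s) + vec2 \<mu> + vec2 \<nu>) x)))"
      unfolding w by (intro sum.cong refl) (simp add: block_freq_def algebra_simps)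
    finally show ?thesis
      unfolding S_def by (simp only: sum.distrib sum_distrib_left distrib_left)
  qed
  have pt: "\<bar>block_grad t j x $ l\<bar> \<le> (2 * pi)^2 / t^14 * (Q 0 x + Q 1 x + Q 2 x)" for x
  proof -
    have "\<bar>\<epsilon>\<bar> = 1" by (simp add: \<epsilon>_def)
    then have "\<bar>block_grad t j x $ l\<bar> = (2 * pi)^2 / t^14 * \<bar>\<Sum>s\<in>{0,1,2}. S s (\<lambda>\<mu>. A s \<mu> j * A s \<mu> k) (\<lambda>\<nu>. 1) x
      + S s (\<lambda>\<mu>. A s \<mu> j) (\<lambda>\<nu>. V \<nu> k) x + S s (\<lambda>\<mu>. A s \<mu> k) (\<lambda>\<nu>. V \<nu> j) x + S s (\<lambda>\<mu>. 1) (\<lambda>\<nu>. V \<nu> j * V \<nu> k) x\<bar>"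
      unfolding dec by (simp add: abs_mult)
    also have "\<dots> \<le> (2 * pi)^2 / t^14 * (\<Sum>s\<in>{0,1,2}. Q s x)"
      by (intro mult_left_mono order_trans[OF sum_abs] sum_mono) (auto simp: Q_def)
    finally show ?thesis by (simp add: add.assoc)
  qed
  have "(LINT x|T2. \<bar>block_grad t j x $ l\<bar>) \<le> (LINT x|T2. (2 * pi)^2 / t^14 * (Q 0 x + Q 1 x + Q 2 x))"
  proof (rule integral_mono)
    show "integrable T2 (\<lambda>x. \<bar>block_grad t j x $ l\<bar>)"
      unfolding block_grad_def vec_lambda_beta by (intro integrable_continuous_T2 continuous_intros)
  qed (use Q_int pt in auto)
  also have "\<dots> = (2 * pi)^2 / t^14 * ((LINT x|T2. Q 0 x) + (LINT x|T2. Q 1 x) + (LINT x|T2. Q 2 x))"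
    using Q_int by simp
  also have "\<dots> \<le> (2 * pi)^2 / t^14 * (12 * (M * M * card (grid m)))"
    using Q_L1[of 0] Q_L1[of 1] Q_L1[of 2] by (intro mult_left_mono) auto
  also have "\<dots> \<le> (2 * pi)^2 / t^14 * (12 * (M * M * (121 * real m^2)))"
    using card_grid[OF m] M by (intro mult_left_mono) auto
  also have "\<dots> = (2 * pi * 2100)^2 * 1452 / t^2"
    using t by (simp add: M_def m_def power2_eq_square field_simps flip: power_add power_mult)
      (simp flip: power_Suc)
  finally show ?thesis .
qed

section \<open>The flux of a block\<close>

text \<open>The product-to-sum formulas give four cosines, and a cosine has nonzero mean only if its
  frequency vanishes.\<close>

lemma integral_triple_product:
  "(LINT x|T2. Im (wave \<gamma> x) * Im (wave \<alpha> x) * Re (wave \<beta> x))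
    = (of_bool (\<gamma> - \<alpha> + \<beta> = 0) + of_bool (\<gamma> - \<alpha> - \<beta> = 0) - of_bool (\<gamma> + \<alpha> + \<beta> = 0) - of_bool (\<gamma> + \<alpha> - \<beta> = 0)) / 4"
proof -
  have Re_add: "Re (wave (\<gamma> + \<beta>) x) = Re (wave \<gamma> x) * Re (wave \<beta> x) - Im (wave \<gamma> x) * Im (wave \<beta> x)"
   and Re_diff: "Re (wave (\<gamma> - \<beta>) x) = Re (wave \<gamma> x) * Re (wave \<beta> x) + Im (wave \<gamma> x) * Im (wave \<beta> x)" for \<gamma> \<beta> x
    using wave_add[of \<gamma> "- \<beta>" x] by (simp_all add: wave_add wave_minus)
  have eq: "Im (wave \<gamma> x) * Im (wave \<alpha> x) * Re (wave \<beta> x)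
    = (Re (wave (\<gamma> - \<alpha> + \<beta>) x) + Re (wave (\<gamma> - \<alpha> - \<beta>) x) - Re (wave (\<gamma> + \<alpha> + \<beta>) x) - Re (wave (\<gamma> + \<alpha> - \<beta>) x)) / 4" for x
    by (simp add: Re_add[of _ \<beta>] Re_diff[of _ \<beta>]) (simp add: Re_add Re_diff algebra_simps)
  have int: "integrable T2 (\<lambda>x. Re (wave \<delta> x))" for \<delta>
    by (intro integrable_continuous_T2 continuous_intros)
  show ?thesis
    unfolding eq by (simp add: int integral_cos of_bool_def)
qed

text \<open>Here \<open>\<gamma>\<close> is the frequency that the low-pass filter retains.\<close>

definition triad :: "int^2 \<Rightarrow> int^2 \<Rightarrow> int^2 \<Rightarrow> int" where
  "triad \<gamma> \<alpha> \<beta> = (\<gamma> $ 1 * \<beta> $ 1 + \<gamma> $ 2 * \<beta> $ 2) * (\<alpha> $ 2 * \<beta> $ 1 - \<alpha> $ 1 * \<beta> $ 2)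
    * (of_bool (\<gamma> - \<alpha> + \<beta> = 0) + of_bool (\<gamma> - \<alpha> - \<beta> = 0) - of_bool (\<gamma> + \<alpha> + \<beta> = 0) - of_bool (\<gamma> + \<alpha> - \<beta> = 0))"

text \<open>\<open>\<gamma>\<close> is nearly horizontal, so \<open>\<gamma>1 * \<beta>1\<close>
  dominates the inner product and \<open>- \<gamma>1 * \<beta>2\<close> the determinant:
  \<open>246 * 246\<close> exceeds \<open>10 * 2058\<close> and \<open>246 * 2038\<close> exceeds
  \<open>10 * 522\<close>. The range of \<open>\<beta>1\<close> covers both high clusters.\<close>

lemma triad_geometry:
  fixes m \<gamma>1 \<gamma>2 \<beta>1 \<beta>2 :: int
  assumes "m \<ge> 1" "\<bar>\<gamma>1 - 256 * m\<bar> \<le> 10 * m" "\<bar>\<gamma>2\<bar> \<le> 10 * m"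
    and "\<beta>1 \<ge> 246 * m" "\<beta>1 \<le> 522 * m" "\<bar>\<beta>2 + 2048 * m\<bar> \<le> 10 * m"
  shows "m^2 \<le> \<gamma>1 * \<beta>1 + \<gamma>2 * \<beta>2" "m^2 \<le> \<gamma>2 * \<beta>1 - \<gamma>1 * \<beta>2"
proof -
  have g1: "246 * m * (246 * m) \<le> \<gamma>1 * \<beta>1"
    by (rule mult_mono) (use assms in auto)
  have "\<bar>\<gamma>2 * \<beta>2\<bar> \<le> 10 * m * (2058 * m)"
    unfolding abs_mult by (rule mult_mono) (use assms in auto)
  then have g2: "- (10 * m * (2058 * m)) \<le> \<gamma>2 * \<beta>2" by linarith
  have g3: "246 * m * (2038 * m) \<le> \<gamma>1 * (- \<beta>2)"
    by (rule mult_mono) (use assms in auto)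
  have "\<bar>\<gamma>2 * \<beta>1\<bar> \<le> 10 * m * (522 * m)"
    unfolding abs_mult by (rule mult_mono) (use assms in auto)
  then have g4: "- (10 * m * (522 * m)) \<le> \<gamma>2 * \<beta>1" by linarith
  have "246 * m * (246 * m) = 60516 * m^2" "10 * m * (2058 * m) = 20580 * m^2"
    "246 * m * (2038 * m) = 501348 * m^2" "10 * m * (522 * m) = 5220 * m^2" "0 \<le> m^2"
    by (simp_all add: power2_eq_square)
  then show "m^2 \<le> \<gamma>1 * \<beta>1 + \<gamma>2 * \<beta>2" "m^2 \<le> \<gamma>2 * \<beta>1 - \<gamma>1 * \<beta>2"
    using g1 g2 g3 g4 by linarith+
qed

lemma vec2_eq_0_iff: "(\<alpha>::int^2) = 0 \<longleftrightarrow> \<alpha> $ 1 = 0 \<and> \<alpha> $ 2 = 0"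
  by (simp add: vec_eq_iff forall_2)

text \<open>A retained mode of cluster 0 resonates only with one mode from each high cluster.
  Exchanging the roles of advecting mode \<open>a\<close> and differentiated mode \<open>b\<close>
  flips both the sign of the resonance indicator and that of the determinant, so the two kinds of
  triads contribute with the same sign.\<close>

lemma triad_cluster:
  assumes m: "m \<ge> 1" and i: "i \<in> block_index m" "fst i = 0" and a: "a \<in> block_index m" and b: "b \<in> block_index m"
  shows "0 \<le> triad (block_freq m i) (block_freq m a) (block_freq m b)"
    and "fst a = 2 \<Longrightarrow> fst b = 1 \<Longrightarrow> block_freq m i - block_freq m a + block_freq m b = 0 \<Longrightarrow>
      int m ^ 4 \<le> triad (block_freq m i) (block_freq m a) (block_freq m b)"
proof -
  define \<gamma> \<alpha> \<beta> where "\<gamma> = block_freq m i" and "\<alpha> = block_freq m a" and "\<beta> = block_freq m b"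
  define M where "M = int m"
  have M: "M \<ge> 1" using m by (simp add: M_def)
  have \<gamma>: "\<bar>\<gamma> $ 1 - 256 * M\<bar> \<le> 10 * M" "\<bar>\<gamma> $ 2\<bar> \<le> 10 * M"
    using block_freq_near[OF i(1)] i(2) by (auto simp: center_def \<gamma>_def M_def)
  have \<alpha>: "\<bar>\<alpha> $ 1 - fst (center m (fst a))\<bar> \<le> 10 * M" "\<bar>\<alpha> $ 2 - snd (center m (fst a))\<bar> \<le> 10 * M"
    using block_freq_near[OF a] by (auto simp: \<alpha>_def M_def)
  have \<beta>: "\<bar>\<beta> $ 1 - fst (center m (fst b))\<bar> \<le> 10 * M" "\<bar>\<beta> $ 2 - snd (center m (fst b))\<bar> \<le> 10 * M"
    using block_freq_near[OF b] by (auto simp: \<beta>_def M_def)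
  have cen: "center m 0 = (256 * M, 0)" "center m 1 = (256 * M, - (2048 * M))" "center m 2 = (512 * M, - (2048 * M))"
    by (simp_all add: center_def M_def)
  have "fst a \<in> {0, 1, 2}" "fst b \<in> {0, 1, 2}"
    using a b by (auto simp: block_index_def)
  then have s: "fst a = 0 \<or> fst a = 1 \<or> fst a = 2" "fst b = 0 \<or> fst b = 1 \<or> fst b = 2"
    by (simp_all only: insert_iff empty_iff simp_thms)
  have lin: "\<gamma> $ 1 \<le> 266 * M" "246 * M \<le> \<gamma> $ 1" "\<gamma> $ 2 \<le> 10 * M" "- (10 * M) \<le> \<gamma> $ 2"
    "\<alpha> $ 1 \<le> fst (center m (fst a)) + 10 * M" "fst (center m (fst a)) - 10 * M \<le> \<alpha> $ 1"
    "\<alpha> $ 2 \<le> snd (center m (fst a)) + 10 * M" "snd (center m (fst a)) - 10 * M \<le> \<alpha> $ 2"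
    "\<beta> $ 1 \<le> fst (center m (fst b)) + 10 * M" "fst (center m (fst b)) - 10 * M \<le> \<beta> $ 1"
    "\<beta> $ 2 \<le> snd (center m (fst b)) + 10 * M" "snd (center m (fst b)) - 10 * M \<le> \<beta> $ 2"
    using \<gamma> \<alpha> \<beta> by linarith+
  \<comment> \<open>For each pair of clusters, every excluded combination of centers has a
    coordinate of modulus at least \<open>256 * M\<close>, whereas the three deviations sum to at
    most \<open>30 * M\<close>.\<close>
  have "\<not> (\<gamma> $ 1 - \<alpha> $ 1 - \<beta> $ 1 = 0 \<and> \<gamma> $ 2 - \<alpha> $ 2 - \<beta> $ 2 = 0)
      \<and> \<not> (\<gamma> $ 1 + \<alpha> $ 1 + \<beta> $ 1 = 0 \<and> \<gamma> $ 2 + \<alpha> $ 2 + \<beta> $ 2 = 0)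
      \<and> (\<gamma> $ 1 - \<alpha> $ 1 + \<beta> $ 1 = 0 \<and> \<gamma> $ 2 - \<alpha> $ 2 + \<beta> $ 2 = 0 \<longrightarrow> fst a = 2 \<and> fst b = 1)
      \<and> (\<gamma> $ 1 + \<alpha> $ 1 - \<beta> $ 1 = 0 \<and> \<gamma> $ 2 + \<alpha> $ 2 - \<beta> $ 2 = 0 \<longrightarrow> fst a = 1 \<and> fst b = 2)"
    by (rule disjE[OF s(1)]; (erule disjE)?; rule disjE[OF s(2)]; (erule disjE)?;
        insert lin M; simp only: cen fst_conv snd_conv; intro conjI impI notI;
        (elim conjE)?; (linarith | simp only:))
  then have no: "\<not> (\<gamma> - \<alpha> - \<beta> = 0)" "\<not> (\<gamma> + \<alpha> + \<beta> = 0)"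
    and no1: "\<gamma> - \<alpha> + \<beta> = 0 \<Longrightarrow> fst a = 2 \<and> fst b = 1" and no2: "\<gamma> + \<alpha> - \<beta> = 0 \<Longrightarrow> fst a = 1 \<and> fst b = 2"
    by (auto simp: vec2_eq_0_iff)
  have main: "M^4 \<le> triad \<gamma> \<alpha> \<beta>" if "fst a = 2" "fst b = 1" "\<gamma> - \<alpha> + \<beta> = 0"
  proof -
    have e: "\<alpha> $ 1 = \<gamma> $ 1 + \<beta> $ 1" "\<alpha> $ 2 = \<gamma> $ 2 + \<beta> $ 2"
      using that(3) by (auto simp: vec2_eq_0_iff)
    have n: "\<gamma> + \<alpha> - \<beta> \<noteq> 0" using no2 that by auto
    have "M^2 \<le> \<gamma> $ 1 * \<beta> $ 1 + \<gamma> $ 2 * \<beta> $ 2" "M^2 \<le> \<gamma> $ 2 * \<beta> $ 1 - \<gamma> $ 1 * \<beta> $ 2"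
      using triad_geometry[OF M \<gamma>, of "\<beta> $ 1" "\<beta> $ 2"] \<beta> that(2) by (auto simp: center_def M_def)
    then have "M^2 * M^2 \<le> (\<gamma> $ 1 * \<beta> $ 1 + \<gamma> $ 2 * \<beta> $ 2) * (\<gamma> $ 2 * \<beta> $ 1 - \<gamma> $ 1 * \<beta> $ 2)"
      by (intro mult_mono) (auto intro: order_trans[OF zero_le_power2])
    moreover have "\<alpha> $ 2 * \<beta> $ 1 - \<alpha> $ 1 * \<beta> $ 2 = \<gamma> $ 2 * \<beta> $ 1 - \<gamma> $ 1 * \<beta> $ 2"
      by (simp add: e algebra_simps)
    ultimately show ?thesis using no n that by (simp add: triad_def flip: power_add)
  qed
  then show "fst a = 2 \<Longrightarrow> fst b = 1 \<Longrightarrow> block_freq m i - block_freq m a + block_freq m b = 0 \<Longrightarrow>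
      int m ^ 4 \<le> triad (block_freq m i) (block_freq m a) (block_freq m b)"
    by (simp add: \<gamma>_def \<alpha>_def \<beta>_def M_def)
  show "0 \<le> triad (block_freq m i) (block_freq m a) (block_freq m b)"
  proof (cases "\<gamma> - \<alpha> + \<beta> = 0")
    case True
    have "0 \<le> M^4" using M by simp
    also have "\<dots> \<le> triad \<gamma> \<alpha> \<beta>" using main no1[OF True] True by blast
    finally show ?thesis by (simp only: \<gamma>_def \<alpha>_def \<beta>_def)
  next
    case F: False
    show ?thesis
    proof (cases "\<gamma> + \<alpha> - \<beta> = 0")
      case True
      have s: "fst a = 1" "fst b = 2" using no2[OF True] by auto
      have e: "\<beta> $ 1 = \<gamma> $ 1 + \<alpha> $ 1" "\<beta> $ 2 = \<gamma> $ 2 + \<alpha> $ 2"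
        using True by (auto simp: vec2_eq_0_iff)
      have "M^2 \<le> \<gamma> $ 1 * \<beta> $ 1 + \<gamma> $ 2 * \<beta> $ 2"
        using triad_geometry(1)[OF M \<gamma>, of "\<beta> $ 1" "\<beta> $ 2"] \<beta> s by (auto simp: center_def M_def)
      moreover have "M^2 \<le> \<gamma> $ 2 * \<alpha> $ 1 - \<gamma> $ 1 * \<alpha> $ 2"
        using triad_geometry(2)[OF M \<gamma>, of "\<alpha> $ 1" "\<alpha> $ 2"] \<alpha> s by (auto simp: center_def M_def)
      moreover have "\<alpha> $ 2 * \<beta> $ 1 - \<alpha> $ 1 * \<beta> $ 2 = - (\<gamma> $ 2 * \<alpha> $ 1 - \<gamma> $ 1 * \<alpha> $ 2)"
        by (simp add: e algebra_simps)
      moreover have "0 \<le> M^2" by simp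
      ultimately have "(\<gamma> $ 1 * \<beta> $ 1 + \<gamma> $ 2 * \<beta> $ 2) * (\<alpha> $ 2 * \<beta> $ 1 - \<alpha> $ 1 * \<beta> $ 2) \<le> 0"
        by (intro mult_nonneg_nonpos) linarith+
      then show ?thesis using no F True unfolding triad_def \<gamma>_def[symmetric] \<alpha>_def[symmetric] \<beta>_def[symmetric] by simp
    next
      case False
      then show ?thesis using no F unfolding triad_def \<gamma>_def[symmetric] \<alpha>_def[symmetric] \<beta>_def[symmetric] by simp
    qed
  qed
qed

text \<open>On the modes of a block these are the values of every admissible cut-off at frequency
  \<open>1024 * m\<close>.\<close>

definition low :: "mode \<Rightarrow> real" where
  "low i = of_bool (fst i = 0)"

lemma block_flux_eq:
  "(LINT x|T2. (\<Sum>l\<in>UNIV. block_field t low x $ l * (\<Sum>j\<in>UNIV. block_field t (\<lambda>_. 1) x $ j * block_grad t j x $ l)))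
   = (2 * pi)^4 / (t^14)^3 / 4 * (\<Sum>(i, a, b)\<in>block_index (t^3) \<times> block_index (t^3) \<times> block_index (t^3).
       low i * triad (block_freq (t^3) i) (block_freq (t^3) a) (block_freq (t^3) b))"
proof -
  define I where "I = block_index (t^3)"
  define \<alpha> where "\<alpha> = block_freq (t^3)"
  define \<kappa> :: real where "\<kappa> = 1 / t^14"
  have f: "block_field t \<sigma> x $ l = (\<Sum>i\<in>I. \<sigma> i * (2 * pi * \<kappa>) * perp (\<alpha> i) l * Im (wave (\<alpha> i) x))" for \<sigma> x l
    by (simp add: block_field_def trig_poly_def I_def \<alpha>_def \<kappa>_def mult_ac)
  have g: "block_grad t j x $ l = (\<Sum>i\<in>I. (2 * pi)^2 * \<kappa> * (\<alpha> i $ j) * perp (\<alpha> i) l * Re (wave (\<alpha> i) x))" for j x l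
    by (simp add: block_grad_def trig_poly_def I_def \<alpha>_def \<kappa>_def mult_ac)
  have prod3: "(\<Sum>i\<in>I. p i) * ((\<Sum>a\<in>I. q a) * (\<Sum>b\<in>I. r b)) = (\<Sum>i\<in>I. \<Sum>a\<in>I. \<Sum>b\<in>I. p i * (q a * r b))"
    for p q r :: "mode \<Rightarrow> real"
    unfolding sum_product by (simp add: sum_distrib_left)
  \<comment> \<open>Summing over \<open>l\<close> gives the inner product of
    \<open>perp (\<alpha> i)\<close> and \<open>perp (\<alpha> b)\<close>, equal to that of
    \<open>\<alpha> i\<close> and \<open>\<alpha> b\<close>; summing over \<open>j\<close> gives the
    inner product of \<open>perp (\<alpha> a)\<close> with \<open>\<alpha> b\<close>, a
    determinant.\<close>
  define T where "T i a b = (\<alpha> i $ 1 * \<alpha> b $ 1 + \<alpha> i $ 2 * \<alpha> b $ 2) * (\<alpha> a $ 2 * \<alpha> b $ 1 - \<alpha> a $ 1 * \<alpha> b $ 2)" for i a b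
  have eq: "(\<Sum>l\<in>UNIV. block_field t low x $ l * (\<Sum>j\<in>UNIV. block_field t (\<lambda>_. 1) x $ j * block_grad t j x $ l))
      = (\<Sum>(i, a, b)\<in>I \<times> I \<times> I. (2 * pi)^4 * \<kappa>^3 * low i * T i a b * (Im (wave (\<alpha> i) x) * Im (wave (\<alpha> a) x) * Re (wave (\<alpha> b) x)))" for x
  proof -
    have "(\<Sum>l\<in>UNIV. block_field t low x $ l * (\<Sum>j\<in>UNIV. block_field t (\<lambda>_. 1) x $ j * block_grad t j x $ l))
      = (\<Sum>l\<in>UNIV. \<Sum>j\<in>UNIV. \<Sum>i\<in>I. \<Sum>a\<in>I. \<Sum>b\<in>I. (low i * (2 * pi * \<kappa>) * perp (\<alpha> i) l * Im (wave (\<alpha> i) x)) *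
          ((2 * pi * \<kappa>) * perp (\<alpha> a) j * Im (wave (\<alpha> a) x) * ((2 * pi)^2 * \<kappa> * (\<alpha> b $ j) * perp (\<alpha> b) l * Re (wave (\<alpha> b) x))))"
      unfolding f g mult_1 sum_distrib_left[of _ _ "UNIV :: 2 set"] prod3 ..
    also have "\<dots> = (\<Sum>i\<in>I. \<Sum>a\<in>I. \<Sum>b\<in>I. \<Sum>l\<in>UNIV. \<Sum>j\<in>UNIV. (low i * (2 * pi * \<kappa>) * perp (\<alpha> i) l * Im (wave (\<alpha> i) x)) *
          ((2 * pi * \<kappa>) * perp (\<alpha> a) j * Im (wave (\<alpha> a) x) * ((2 * pi)^2 * \<kappa> * (\<alpha> b $ j) * perp (\<alpha> b) l * Re (wave (\<alpha> b) x))))"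
      by (simp only: sum_2 sum.distrib)
    also have "\<dots> = (\<Sum>i\<in>I. \<Sum>a\<in>I. \<Sum>b\<in>I. (2 * pi)^4 * \<kappa>^3 * low i * T i a b * (Im (wave (\<alpha> i) x) * Im (wave (\<alpha> a) x) * Re (wave (\<alpha> b) x)))"
      by (intro sum.cong refl) (simp add: sum_2 perp_def T_def algebra_simps power_numeral_reduce)
    finally show ?thesis by (simp only: sum.cartesian_product)
  qed
  have int: "integrable T2 (\<lambda>x. c * (Im (wave \<gamma> x) * Im (wave \<beta> x) * Re (wave \<delta> x)))" for c \<gamma> \<beta> \<delta>
    by (intro integrable_continuous_T2 continuous_intros)
  have "(LINT x|T2. (\<Sum>l\<in>UNIV. block_field t low x $ l * (\<Sum>j\<in>UNIV. block_field t (\<lambda>_. 1) x $ j * block_grad t j x $ l)))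
     = (\<Sum>(i, a, b)\<in>I \<times> I \<times> I. (2 * pi)^4 * \<kappa>^3 * low i * T i a b * (LINT x|T2. Im (wave (\<alpha> i) x) * Im (wave (\<alpha> a) x) * Re (wave (\<alpha> b) x)))"
    by (simp only: eq case_prod_unfold Bochner_Integration.integral_sum int Bochner_Integration.integral_mult_right_zero)
  also have "\<dots> = (\<Sum>(i, a, b)\<in>I \<times> I \<times> I. (2 * pi)^4 * \<kappa>^3 / 4 * (low i * triad (\<alpha> i) (\<alpha> a) (\<alpha> b)))"
    unfolding integral_triple_product by (intro sum.cong refl) (auto simp: T_def triad_def)
  finally show ?thesis
    by (simp add: split_beta sum_distrib_left I_def \<alpha>_def \<kappa>_def power_divide)
qed

text \<open>At least \<open>m^10\<close> resonant triads each contribute at least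
  \<open>m^4\<close>, and the total \<open>m^14 = t^42\<close> cancels the cube of the normalization
  \<open>t^14\<close>. This is what fixes that exponent.\<close>

lemma block_flux_lower_bound:
  assumes t: "t \<ge> 1"
  shows "4 * pi^4 \<le> (LINT x|T2. (\<Sum>l\<in>UNIV. block_field t low x $ l * (\<Sum>j\<in>UNIV. block_field t (\<lambda>_. 1) x $ j * block_grad t j x $ l)))"
proof -
  define m where "m = t^3"
  define I where "I = block_index m"
  define P where "P = {- int m..int m} \<times> {- int m..int m}"
  define G where "G i a b = low i * triad (block_freq m i) (block_freq m a) (block_freq m b)" for i a b
  \<comment> \<open>Five of the six grid points are free with coordinates at most \<open>m\<close>;
    resonance determines the sixth. As a signed sum of the other five it has coordinates at most
    \<open>5 * m\<close>, which is the reason for the size of \<open>grid\<close>.\<close>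
  define h where "h = (\<lambda>(\<mu>1, \<nu>1, \<nu>2, \<mu>3, \<nu>3). ((0::nat, \<mu>1, \<nu>1), (2::nat, \<mu>1 + \<nu>1 + \<mu>3 + \<nu>3 - \<nu>2, \<nu>2), (1::nat, \<mu>3, \<nu>3::int\<times>int)))"
  have m: "m \<ge> 1" using t by (simp add: m_def)
  have inj: "inj_on h (P \<times> P \<times> P \<times> P \<times> P)"
    by (auto simp: inj_on_def h_def)
  have sub: "h ` (P \<times> P \<times> P \<times> P \<times> P) \<subseteq> I \<times> I \<times> I"
    by (auto simp: h_def I_def block_index_def grid_def P_def)
  have "m^2 \<le> card P"
    by (simp add: card_cartesian_product P_def nat_add_distrib nat_mult_distrib power2_eq_square)
  then have "(m^2)^5 \<le> card P ^ 5" by (rule power_mono) simp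
  also have "card P ^ 5 = card (P \<times> P \<times> P \<times> P \<times> P)"
    unfolding card_cartesian_product by (simp add: numeral_eq_Suc)
  finally have "real ((m^2)^5) \<le> card (P \<times> P \<times> P \<times> P \<times> P)"
    by (simp only: of_nat_le_iff)
  then have card: "real m^10 \<le> card (P \<times> P \<times> P \<times> P \<times> P)"
    by (simp only: of_nat_power power_mult[symmetric]) simp
  have G_nn: "0 \<le> G i a b" if "i \<in> I" "a \<in> I" "b \<in> I" for i a b
  proof (cases "fst i = 0")
    case True
    from triad_cluster(1)[OF m that(1)[unfolded I_def] True that(2,3)[unfolded I_def]] True show ?thesis
      unfolding G_def low_def by simp
  qed (simp add: G_def low_def)
  have G_ge: "real m^4 \<le> G i a b" if hi: "h z = (i, a, b)" "z \<in> P \<times> P \<times> P \<times> P \<times> P" for z i a b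
  proof -
    have mem: "i \<in> block_index m" "a \<in> block_index m" "b \<in> block_index m"
      using subsetD[OF sub imageI[OF hi(2)]] unfolding hi(1) I_def by blast+
    have f: "fst i = 0" "fst a = 2" "fst b = 1" and r: "block_freq m i - block_freq m a + block_freq m b = 0"
      using hi by (auto simp: h_def block_freq_def vec2_eq_0_iff center_def split: prod.splits)
    have "int m^4 \<le> triad (block_freq m i) (block_freq m a) (block_freq m b)"
      by (rule triad_cluster(2)[OF m mem(1) f(1) mem(2,3) f(2,3) r])
    then have "real_of_int (int m^4) \<le> real_of_int (triad (block_freq m i) (block_freq m a) (block_freq m b))"
      by (simp only: of_int_le_iff)
    then show ?thesis using f by (simp add: G_def low_def)
  qed
  have "real m^10 * real m^4 \<le> card (P \<times> P \<times> P \<times> P \<times> P) * real m^4"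
    by (rule mult_right_mono[OF card]) simp
  also have "\<dots> = (\<Sum>z\<in>P \<times> P \<times> P \<times> P \<times> P. real m^4)" by simp
  also have "\<dots> \<le> (\<Sum>z\<in>P \<times> P \<times> P \<times> P \<times> P. case h z of (i, a, b) \<Rightarrow> G i a b)"
    by (rule sum_mono) (use G_ge in \<open>auto split: prod.splits\<close>)
  also have "\<dots> = (\<Sum>(i, a, b)\<in>h ` (P \<times> P \<times> P \<times> P \<times> P). G i a b)"
    by (simp add: sum.reindex[OF inj] o_def)
  also have "\<dots> \<le> (\<Sum>(i, a, b)\<in>I \<times> I \<times> I. G i a b)"
    by (rule sum_mono2) (use sub G_nn in \<open>auto simp: I_def\<close>)
  finally have "real m^14 \<le> (\<Sum>(i, a, b)\<in>I \<times> I \<times> I. G i a b)" by (simp flip: power_add)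
  then have "(2 * pi)^4 / (t^14)^3 / 4 * real m^14 \<le> (2 * pi)^4 / (t^14)^3 / 4 * (\<Sum>(i, a, b)\<in>I \<times> I \<times> I. G i a b)"
    by (intro mult_left_mono) auto
  moreover have "(2 * pi)^4 / (t^14)^3 / 4 * real m^14 = 4 * pi^4"
  proof -
    have "real m^14 = real ((t^14)^3)"
      unfolding m_def of_nat_power power_mult[symmetric] by simp
    moreover have "real ((t^14)^3) \<noteq> 0" using t by simp
    ultimately show ?thesis by (simp only: power_mult_distrib) simp
  qed
  ultimately have "4 * pi^4 \<le> (2 * pi)^4 / (t^14)^3 / 4 * (\<Sum>(i, a, b)\<in>I \<times> I \<times> I. G i a b)"
    by linarith
  then show ?thesis unfolding block_flux_eq unfolding G_def I_def m_def .
qed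

section \<open>Lebesgue norms of a single block\<close>

definition block_const :: real where
  "block_const = 2 * ((2 * pi * 2100) * 43923 + (2 * pi * 2100)^2 * 43923 * 363 + (2 * pi * 2100)^2 * 43923
     + (2 * pi * 2100)^4 * 43923 * 363 + (2 * pi * 2100)^2 * 1452)"

lemma block_const_ge_1: "1 \<le> block_const"
proof -
  have "1 \<le> (2 * pi * 2100) * 43923" using pi_ge_two by simp
  moreover have "0 \<le> (2 * pi * 2100)^2 * 43923 * 363" "0 \<le> (2 * pi * 2100)^2 * 43923"
    "0 \<le> (2 * pi * 2100)^4 * 43923 * 363" "0 \<le> (2 * pi * 2100)^2 * 1452"
    by simp_all
  moreover have "1 \<le> 2 * (a + b + c + d + e)" if "1 \<le> a" "0 \<le> b" "0 \<le> c" "0 \<le> d" "0 \<le> e" for a b c d e :: real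
    using that by argo
  ultimately show ?thesis unfolding block_const_def by blast
qed

lemma norm_vec2_le: "norm (z :: real^2) \<le> \<bar>z $ 1\<bar> + \<bar>z $ 2\<bar>"
  using norm_le_l1_cart[of z] by (simp add: sum_2)

lemma norm_vec2_square: "norm (z :: real^2) ^ 2 = (z $ 1)^2 + (z $ 2)^2"
  by (simp add: norm_vec_def L2_set_def sum_2)

lemma continuous_field [continuous_intros]: "continuous_on S (block_field t \<sigma>)"
  unfolding block_field_def[abs_def] by (intro continuous_on_vec_lambda continuous_intros)

lemma continuous_grad [continuous_intros]: "continuous_on S (block_grad t j)"
  unfolding block_grad_def[abs_def] by (intro continuous_on_vec_lambda continuous_intros)

lemma field_norm_sup:
  assumes "\<And>i. i \<in> block_index (t^3) \<Longrightarrow> \<bar>\<sigma> i\<bar> \<le> B" "t \<ge> 1" "0 \<le> B"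
  shows "norm (block_field t \<sigma> x) \<le> block_const * B * t"
proof -
  \<comment> \<open>The factor 2 in \<open>block_const\<close> pays for the passage from the two
    components to the vector norm.\<close>
  have "norm (block_field t \<sigma> x) \<le> 2 * ((2 * pi * 2100) * 43923) * B * t"
  proof -
    have "\<bar>block_field t \<sigma> x $ l\<bar> \<le> (2 * pi * 2100) * 43923 * B * t" for l
      by (rule field_sup) (use assms in auto)
    from this[of 1] this[of 2] show ?thesis
      using norm_vec2_le[of "block_field t \<sigma> x"] by linarith
  qed
  also have "\<dots> \<le> block_const * B * t"
    by (intro mult_right_mono) (use assms in \<open>auto simp: block_const_def\<close>)
  finally show ?thesis .
qed

lemma field_norm_L2:
  assumes "\<And>i. i \<in> block_index (t^3) \<Longrightarrow> \<bar>\<sigma> i\<bar> \<le> B" "t \<ge> 1" "0 \<le> B"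
  shows "(LINT x|T2. norm (block_field t \<sigma> x)^2) \<le> block_const * B^2 / t^4"
proof -
  have "integrable T2 (\<lambda>x. (block_field t \<sigma> x $ l)^2)" for l
    by (intro integrable_continuous_T2 continuous_intros)
  then have "(LINT x|T2. norm (block_field t \<sigma> x)^2) = (LINT x|T2. (block_field t \<sigma> x $ 1)^2) + (LINT x|T2. (block_field t \<sigma> x $ 2)^2)"
    by (simp add: norm_vec2_square)
  moreover have "(LINT x|T2. (block_field t \<sigma> x $ l)^2) \<le> (2 * pi * 2100)^2 * 43923 * 363 * B^2 / t^4" for l
    by (rule field_L2) (use assms in auto)
  note this[of 1] this[of 2]
  ultimately have "(LINT x|T2. norm (block_field t \<sigma> x)^2) \<le> 2 * ((2 * pi * 2100)^2 * 43923 * 363) * B^2 / t^4"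
    by simp
  also have "\<dots> \<le> block_const * B^2 / t^4"
    by (intro divide_right_mono mult_right_mono) (auto simp: block_const_def)
  finally show ?thesis .
qed

lemma grad_norm_sup:
  assumes "t \<ge> 1" shows "norm (block_grad t j x) \<le> block_const * t^4"
proof -
  have "norm (block_grad t j x) \<le> 2 * ((2 * pi * 2100)^2 * 43923) * t^4"
    using norm_vec2_le[of "block_grad t j x"] grad_sup[OF assms, of j x 1] grad_sup[OF assms, of j x 2] by linarith
  also have "\<dots> \<le> block_const * t^4"
    by (intro mult_right_mono) (auto simp: block_const_def)
  finally show ?thesis .
qed

lemma grad_norm_L2:
  assumes "t \<ge> 1" shows "(LINT x|T2. norm (block_grad t j x)^2) \<le> block_const * t^2"
proof -
  have "integrable T2 (\<lambda>x. (block_grad t j x $ l)^2)" for l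
    by (intro integrable_continuous_T2 continuous_intros)
  then have "(LINT x|T2. norm (block_grad t j x)^2) \<le> 2 * ((2 * pi * 2100)^4 * 43923 * 363) * t^2"
    using grad_L2[OF assms, of j 1] grad_L2[OF assms, of j 2] by (simp add: norm_vec2_square)
  also have "\<dots> \<le> block_const * t^2"
    by (intro mult_right_mono) (auto simp: block_const_def)
  finally show ?thesis .
qed

lemma grad_norm_L1:
  assumes "t \<ge> 1" shows "(LINT x|T2. norm (block_grad t j x)) \<le> block_const / t^2"
proof -
  have int: "integrable T2 (\<lambda>x. \<bar>block_grad t j x $ l\<bar>)" for l
    by (intro integrable_continuous_T2 continuous_intros)
  have "(LINT x|T2. norm (block_grad t j x)) \<le> (LINT x|T2. \<bar>block_grad t j x $ 1\<bar> + \<bar>block_grad t j x $ 2\<bar>)"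
    by (rule integral_mono) (use int norm_vec2_le in \<open>auto intro!: integrable_continuous_T2 continuous_intros\<close>)
  also have "\<dots> \<le> 2 * ((2 * pi * 2100)^2 * 1452) / t^2"
    using grad_L1[OF assms, of j 1] grad_L1[OF assms, of j 2] int by simp
  also have "\<dots> \<le> block_const / t^2"
    by (intro divide_right_mono) (auto simp: block_const_def)
  finally show ?thesis .
qed

text \<open>Young's inequality with weight \<open>t^2\<close> derives this from the L^2 bound.
  Concentration is not exploited, but the decay \<open>t^-2\<close> is enough for the interactions
  between blocks.\<close>

lemma field_norm_L1:
  assumes "\<And>i. i \<in> block_index (t^3) \<Longrightarrow> \<bar>\<sigma> i\<bar> \<le> 1" "t \<ge> 1"
  shows "(LINT x|T2. norm (block_field t \<sigma> x)) \<le> block_const / t^2"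
proof -
  have int: "integrable T2 (\<lambda>x. norm (block_field t \<sigma> x)^2)" "integrable T2 (\<lambda>x. norm (block_field t \<sigma> x))"
    by (intro integrable_continuous_T2 continuous_intros)+
  have fm: "integrable T2 (\<lambda>x. c::real)" for c by (intro integrable_continuous_T2 continuous_intros)
  have "(LINT x|T2. norm (block_field t \<sigma> x)) \<le> (LINT x|T2. (t^2 * norm (block_field t \<sigma> x)^2 + 1 / t^2) / 2)"
  proof (rule integral_mono)
    fix x
    have "0 \<le> (t * norm (block_field t \<sigma> x) - 1 / t)^2" by simp
    also have "\<dots> = t^2 * norm (block_field t \<sigma> x)^2 + 1 / t^2 - 2 * norm (block_field t \<sigma> x)"
      using assms(2) by (simp add: power2_diff power_mult_distrib power_divide)
    finally show "norm (block_field t \<sigma> x) \<le> (t^2 * norm (block_field t \<sigma> x)^2 + 1 / t^2) / 2" by simp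
  qed (use int fm in auto)
  also have "\<dots> = (t^2 * (LINT x|T2. norm (block_field t \<sigma> x)^2) + 1 / t^2) / 2"
    using int fm measure_space_T2 by simp
  also have "\<dots> \<le> (t^2 * (block_const / t^4) + block_const / t^2) / 2"
    using field_norm_L2[of t \<sigma> 1] assms block_const_ge_1
    by (intro divide_right_mono add_mono mult_left_mono) auto
  also have "\<dots> = block_const / t^2"
    using assms(2) by (simp add: field_simps flip: power_add)
  finally show ?thesis .
qed

text \<open>All intermediate L^p bounds come from the supremum and one lower exponent:
  \<open>r = 1\<close> for gradients, \<open>r = 2\<close> for fields.\<close>

lemma Lp_interpolation:
  fixes f :: "real^2 \<Rightarrow> real^2"
  assumes c: "continuous_on UNIV f" and p: "0 < r" "r \<le> p" and A: "\<And>x. norm (f x) \<le> A"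
    and B: "(LINT x|T2. norm (f x) powr r) \<le> B"
  shows "(LINT x|T2. norm (f x) powr p) \<le> A powr (p - r) * B"
proof -
  have int: "integrable T2 (\<lambda>x. norm (f x) powr s)" if "s > 0" for s
    by (intro integrable_continuous_T2 continuous_on_powr' continuous_intros c) (use that in auto)
  have "(LINT x|T2. norm (f x) powr p) \<le> (LINT x|T2. A powr (p - r) * norm (f x) powr r)"
  proof (rule integral_mono)
    fix x
    have "norm (f x) powr p = norm (f x) powr (p - r) * norm (f x) powr r"
      by (simp flip: powr_add)
    also have "\<dots> \<le> A powr (p - r) * norm (f x) powr r"
      by (intro mult_right_mono powr_mono2) (use p A in auto)
    finally show "norm (f x) powr p \<le> A powr (p - r) * norm (f x) powr r" .
  qed (use int p in auto)
  also have "\<dots> = A powr (p - r) * (LINT x|T2. norm (f x) powr r)" by simp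
  also have "\<dots> \<le> A powr (p - r) * B" by (rule mult_left_mono[OF B]) simp
  finally show ?thesis .
qed

text \<open>The exponent is \<open>4 * (p - 1) - 2\<close>, negative exactly for
  \<open>p < 3 / 2\<close>; this is where the range of the Sobolev exponent comes from.\<close>

lemma grad_Lp:
  assumes "t \<ge> 1" "1 \<le> p"
  shows "(LINT x|T2. norm (block_grad t j x) powr p) \<le> block_const powr p * t powr (- (6 - 4 * p))"
proof -
  have "(LINT x|T2. norm (block_grad t j x) powr p) \<le> (block_const * t^4) powr (p - 1) * (block_const / t^2)"
    by (rule Lp_interpolation[where r = 1]) (use assms grad_norm_sup grad_norm_L1 continuous_grad in auto)
  also have "\<dots> = block_const powr p * t powr (- (6 - 4 * p))"
  proof -
    have t: "real (t ^ 4) = t powr 4" "real (t ^ 2) = t powr 2" using assms by (simp_all add: powr_numeral)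
    have K: "block_const powr (p - 1) * block_const = block_const powr p"
      using block_const_ge_1 by (simp add: powr_diff)
    have "(block_const * t powr 4) powr (p - 1) * (block_const / t powr 2)
        = (block_const powr (p - 1) * block_const) * (t powr (4 * (p - 1)) / t powr 2)"
      using block_const_ge_1 by (simp only: powr_powr powr_mult times_divide_eq_right times_divide_eq_left mult_ac)
    also have "t powr (4 * (p - 1)) / t powr 2 = t powr (- (6 - 4 * p))"
      unfolding powr_diff[symmetric] by (simp add: algebra_simps)
    finally show ?thesis unfolding t K .
  qed
  finally show ?thesis .
qed

text \<open>The power of \<open>t\<close> decays exactly for \<open>p < 6\<close>. For
  \<open>p = 3\<close> it is \<open>t^-3 = 1 / m\<close>, the Besov scaling. The bound
  \<open>B\<close> on the weights makes the estimate available for Littlewood-Paley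
  components.\<close>

lemma field_Lp:
  assumes "\<And>i. i \<in> block_index (t^3) \<Longrightarrow> \<bar>\<sigma> i\<bar> \<le> B" "t \<ge> 1" "0 \<le> B" "2 \<le> p"
  shows "(LINT x|T2. norm (block_field t \<sigma> x) powr p) \<le> (block_const * B) powr (p - 2) * (block_const * B^2) * t powr (- (6 - p))"
proof -
  have e: "norm (block_field t \<sigma> x) powr 2 = norm (block_field t \<sigma> x)^2" for x by (simp add: powr_numeral)
  have "(LINT x|T2. norm (block_field t \<sigma> x) powr p) \<le> (block_const * B * t) powr (p - 2) * (block_const * B^2 / t^4)"
    by (rule Lp_interpolation[where r = 2])
       (use assms field_norm_sup[OF assms(1-3)] field_norm_L2[OF assms(1-3)] continuous_field in \<open>auto simp: e\<close>)
  also have "\<dots> = (block_const * B) powr (p - 2) * (block_const * B^2) * t powr (- (6 - p))"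
  proof -
    have t: "real (t ^ 4) = t powr 4" using assms by (simp add: powr_numeral)
    have "(block_const * B * t) powr (p - 2) * (block_const * B^2 / t powr 4)
        = (block_const * B) powr (p - 2) * (block_const * B^2) * (t powr (p - 2) / t powr 4)"
      using block_const_ge_1 assms by (simp add: powr_mult)
    also have "t powr (p - 2) / t powr 4 = t powr (- (6 - p))"
      unfolding powr_diff[symmetric] by (simp add: algebra_simps)
    finally show ?thesis unfolding t .
  qed
  finally show ?thesis .
qed

text \<open>A power of two, so that \<open>1024 * scale k ^ 3\<close> is itself a dyadic frequency.
  Each scale is the 20th power of its predecessor and thus dominates the low powers of it that arise
  in the error terms.\<close>

definition scale :: "nat \<Rightarrow> nat" where "scale k = 2 ^ (20 ^ k)"

lemma scale_Suc: "scale (Suc k) = scale k ^ 20"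
  by (simp add: scale_def power_mult[symmetric] mult.commute)

lemma scale_ge_2: "scale k \<ge> 2"
proof -
  have "(2::nat)^1 \<le> 2 ^ (20 ^ k)" by (rule power_increasing) auto
  then show ?thesis by (simp add: scale_def)
qed

lemma scale_ge_1 [simp]: "scale k \<ge> 1" using scale_ge_2[of k] by linarith

lemma scale_mono: "k \<le> n \<Longrightarrow> scale k \<le> scale n"
  unfolding scale_def by (intro power_increasing) auto

text \<open>The scales grow doubly exponentially, so any negative power of them absorbs the
  geometric weights of \<open>Lp_series\<close>.\<close>

lemma scale_summable:
  assumes "0 < e"
  shows "summable (\<lambda>k. 2 powr (real k * p) * real (scale k) powr (- e))"
proof (rule summable_comparison_test_ev)
  have "eventually (\<lambda>k. 2 powr (real k * p) * (2 powr (20 ^ k)) powr (- e) \<le> (1/2)^k) sequentially"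
  proof -
    obtain N :: nat where N: "(p + 1) / e < N" using reals_Archimedean2 by blast
    have "2 powr (real k * p) * (2 powr (20 ^ k)) powr (- e) \<le> (1/2)^k" if "k \<ge> N" for k
    proof -
      have "p + 1 \<le> e * k"
        using N that assms by (simp add: field_simps) (smt (verit) mult_left_mono of_nat_le_iff)
      then have "(p + 1) * k \<le> e * k * k" by (rule mult_right_mono) simp
      also have "\<dots> \<le> e * (2^k * 2^k)"
        unfolding mult.assoc using assms of_nat_less_two_power[of k, where 'a = real]
        by (intro mult_left_mono mult_mono) auto
      also have "\<dots> \<le> e * 20 ^ k"
        unfolding power_mult_distrib[symmetric] using assms by (intro mult_left_mono power_mono) auto
      finally have "real k * p - e * 20 ^ k \<le> - real k" by (simp add: algebra_simps)
      then have "2 powr (real k * p - e * 20 ^ k) \<le> 2 powr (- real k)" by simp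
      also have "\<dots> = (1/2)^k" by (simp add: powr_minus powr_realpow power_one_over inverse_eq_divide)
      finally show ?thesis by (simp add: powr_powr powr_diff powr_minus field_simps)
    qed
    then show ?thesis by (auto simp: eventually_sequentially)
  qed
  moreover have "real (scale k) = 2 powr (20 ^ k)" for k
    by (simp add: scale_def powr_realpow[symmetric])
  ultimately show "eventually (\<lambda>k. norm (2 powr (real k * p) * real (scale k) powr (- e)) \<le> (1/2)^k) sequentially"
    by simp
  show "summable (\<lambda>k. (1/2::real)^k)" by (rule summable_geometric) simp
qed

text \<open>The decay of block \<open>n + k\<close> is split evenly: one half is at most the
  corresponding power of \<open>scale n\<close> and measures the tail, the other is compared with
  \<open>scale k\<close> and pays for summability.\<close>

lemma Lp_block_series:
  fixes f :: "nat \<Rightarrow> real^2 \<Rightarrow> real^2"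
  assumes p: "0 < p" and e: "0 < e" and c: "\<And>k. continuous_on UNIV (f k)"
    and b: "\<And>k. (LINT x|T2. norm (f k x) powr p) \<le> A * scale k powr (- e)" and A: "0 \<le> A"
  obtains C where "0 \<le> C" "\<And>n. AE x in T2. summable (\<lambda>k. norm (f (n + k) x))"
    "\<And>n. integrable T2 (\<lambda>x. norm (\<Sum>k. f (n + k) x) powr p)"
    "\<And>n. (LINT x|T2. norm (\<Sum>k. f (n + k) x) powr p) \<le> C * scale n powr (- e / 2)"
proof -
  define D where "D = (\<Sum>k. 2 powr (real k * p) * real (scale k) powr (- (e / 2)))"
  have sD: "summable (\<lambda>k. 2 powr (real k * p) * real (scale k) powr (- (e / 2)))"
    by (rule scale_summable) (use e in simp)
  have D: "0 \<le> D" unfolding D_def by (rule suminf_nonneg[OF sD]) simp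
  have int: "integrable T2 (\<lambda>x. norm (f k x) powr p)" for k
    by (intro integrable_continuous_T2 continuous_on_powr' continuous_intros c) (use p in auto)
  have meas: "f k \<in> borel_measurable T2" for k using integrable_continuous_T2[OF c] by auto
  have le: "2 powr (real k * p) * (LINT x|T2. norm (f (n + k) x) powr p) \<le> A * scale n powr (- e / 2) * (2 powr (real k * p) * real (scale k) powr (- (e / 2)))" for n k
  proof -
    have "real (scale (n + k)) powr (- e) = scale (n + k) powr (- e / 2) * scale (n + k) powr (- (e / 2))"
      by (simp flip: powr_add)
    also have "\<dots> \<le> scale n powr (- e / 2) * scale k powr (- (e / 2))"
      by (intro mult_mono powr_mono2') (use e scale_mono[of n "n + k"] scale_mono[of k "n + k"] scale_ge_2[of n] scale_ge_2[of k] in auto)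
    finally have "A * real (scale (n + k)) powr (- e) \<le> A * (scale n powr (- e / 2) * scale k powr (- (e / 2)))"
      by (rule mult_left_mono) (rule A)
    then have "(LINT x|T2. norm (f (n + k) x) powr p) \<le> A * (scale n powr (- e / 2) * scale k powr (- (e / 2)))"
      using b[of "n + k"] by linarith
    from mult_left_mono[OF this, of "2 powr (real k * p)"] show ?thesis by (simp add: mult_ac)
  qed
  have sm: "summable (\<lambda>k. 2 powr (real k * p) * (LINT x|T2. norm (f (n + k) x) powr p))" for n
    by (rule summable_comparison_test'[OF summable_mult[OF sD, of "A * scale n powr (- e / 2)"], of 0]) (use le in simp)
  note S = Lp_series[of p "\<lambda>k. f (n + k)" T2 for n, OF p meas int sm]
  have "(LINT x|T2. norm (\<Sum>k. f (n + k) x) powr p) \<le> (2 powr p * A * D) * scale n powr (- e / 2)" for n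
  proof -
    have "(\<Sum>k. 2 powr (real k * p) * (LINT x|T2. norm (f (n + k) x) powr p)) \<le> A * scale n powr (- e / 2) * D"
      unfolding D_def suminf_mult[OF sD, symmetric] by (rule suminf_le[OF le sm summable_mult[OF sD]])
    from mult_left_mono[OF this, of "2 powr p"] have "2 powr p * (\<Sum>k. 2 powr (real k * p) * (LINT x|T2. norm (f (n + k) x) powr p)) \<le> 2 powr p * (A * scale n powr (- e / 2) * D)"
      by simp
    with S(3)[of n] show ?thesis by (simp only: mult_ac)
  qed
  then show thesis
    by (intro that[of "2 powr p * A * D"] S(1,2)) (use A D in auto)
qed

section \<open>The vector field\<close>

lemma scale_pos [simp]: "Suc 0 \<le> scale k" "0 < scale k"
  using scale_ge_2[of k] by simp_all

abbreviation (input) all_modes :: "mode \<Rightarrow> real" where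
  "all_modes \<equiv> \<lambda>_. 1"

text \<open>The series is summed pointwise and converges almost everywhere. Since
  \<open>suminf\<close> depends only on the sequence of its terms, the function is exactly periodic,
  including at points of divergence.\<close>

definition flow :: "real^2 \<Rightarrow> real^2" where
  "flow x = (\<Sum>k. block_field (scale k) all_modes x)"

definition flow_grad :: "2 \<Rightarrow> real^2 \<Rightarrow> real^2" where
  "flow_grad j x = (\<Sum>k. block_grad (scale k) j x)"

lemma powr_minus_nat: "t \<ge> 1 \<Longrightarrow> real t powr (- real n) = 1 / t^n"
  by (simp add: powr_minus powr_realpow inverse_eq_divide)

lemma periodic_block_field: "periodic (block_field t \<sigma>)"
  by (simp only: periodic_def block_field_def periodic_trig_poly[unfolded periodic_def, rule_format] simp_thms)

lemma periodic_block_grad: "periodic (block_grad t j)"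
  by (simp only: periodic_def block_grad_def periodic_trig_poly[unfolded periodic_def, rule_format] simp_thms)

lemma field_tail_L1:
  obtains C where "0 \<le> C" "\<And>n. AE x in T2. summable (\<lambda>k. norm (block_field (scale (n + k)) all_modes x))"
    "\<And>n. integrable T2 (\<lambda>x. \<Sum>k. block_field (scale (n + k)) all_modes x)"
    "\<And>n. (LINT x|T2. norm (\<Sum>k. block_field (scale (n + k)) all_modes x)) \<le> C / scale n"
proof -
  have b: "(LINT x|T2. norm (block_field (scale k) all_modes x) powr 1) \<le> block_const * scale k powr (- 2)" for k
    using field_norm_L1[of "scale k" all_modes] powr_minus_nat[of "scale k" 2] by simp
  obtain C where C: "0 \<le> C" "\<And>n. AE x in T2. summable (\<lambda>k. norm (block_field (scale (n + k)) all_modes x))"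
    "\<And>n. integrable T2 (\<lambda>x. norm (\<Sum>k. block_field (scale (n + k)) all_modes x) powr 1)"
    "\<And>n. (LINT x|T2. norm (\<Sum>k. block_field (scale (n + k)) all_modes x) powr 1) \<le> C * scale n powr (- 2 / 2)"
    by (rule Lp_block_series[OF _ _ continuous_field b]) (use block_const_ge_1 in auto)
  have [measurable]: "block_field t \<sigma> \<in> borel_measurable T2" for t \<sigma>
    using integrable_continuous_T2[OF continuous_field] by auto
  have meas: "(\<lambda>x. \<Sum>k. block_field (scale (n + k)) all_modes x) \<in> borel_measurable T2" for n by measurable
  have "integrable T2 (\<lambda>x. \<Sum>k. block_field (scale (n + k)) all_modes x)" for n
    using C(3)[of n] integrable_norm_iff[OF meas[of n]] by simp
  moreover have "(LINT x|T2. norm (\<Sum>k. block_field (scale (n + k)) all_modes x)) \<le> C / scale n" for n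
    using C(4)[of n] powr_minus_nat[of "scale n" 1] by simp
  ultimately show thesis using that C by blast
qed

lemma grad_tail:
  assumes p: "1 \<le> p" "p < 3 / 2"
  obtains C where "0 \<le> C" "\<And>n. AE x in T2. summable (\<lambda>k. norm (block_grad (scale (n + k)) j x))"
    "\<And>n. integrable T2 (\<lambda>x. norm (\<Sum>k. block_grad (scale (n + k)) j x) powr p)"
    "\<And>n. (LINT x|T2. norm (\<Sum>k. block_grad (scale (n + k)) j x) powr p) \<le> C * scale n powr (- (6 - 4 * p) / 2)"
proof (rule Lp_block_series[of p "6 - 4 * p" "\<lambda>k. block_grad (scale k) j"])
  show "(LINT x|T2. norm (block_grad (scale k) j x) powr p) \<le> block_const powr p * scale k powr (- (6 - 4 * p))" for k
    by (rule grad_Lp) (use p in auto)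
qed (use p continuous_grad in \<open>auto intro: that\<close>)

lemma field_tail:
  assumes p: "2 \<le> p" "p < 6"
  obtains C where "0 \<le> C" "\<And>n. AE x in T2. summable (\<lambda>k. norm (block_field (scale (n + k)) all_modes x))"
    "\<And>n. integrable T2 (\<lambda>x. norm (\<Sum>k. block_field (scale (n + k)) all_modes x) powr p)"
    "\<And>n. (LINT x|T2. norm (\<Sum>k. block_field (scale (n + k)) all_modes x) powr p) \<le> C * scale n powr (- (6 - p) / 2)"
proof (rule Lp_block_series[of p "6 - p" "\<lambda>k. block_field (scale k) all_modes"])
  show "(LINT x|T2. norm (block_field (scale k) all_modes x) powr p) \<le> (block_const * 1) powr (p - 2) * (block_const * 1^2) * scale k powr (- (6 - p))" for k
    by (rule field_Lp) (use p in auto)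
  show "0 \<le> (block_const * 1) powr (p - 2) * (block_const * 1^2)"
    using block_const_ge_1 by simp
qed (use p continuous_field in \<open>auto intro: that\<close>)

lemma measurable_grad_series: "(\<lambda>x. \<Sum>k. block_grad (scale (n + k)) j x) \<in> borel_measurable T2"
proof -
  have [measurable]: "block_grad t j \<in> borel_measurable T2" for t
    using integrable_continuous_T2[OF continuous_grad] by auto
  show ?thesis by measurable
qed

lemma grad_tail_L1:
  obtains C where "0 \<le> C" "\<And>n. AE x in T2. summable (\<lambda>k. norm (block_grad (scale (n + k)) j x))"
    "\<And>n. integrable T2 (\<lambda>x. \<Sum>k. block_grad (scale (n + k)) j x)"
    "\<And>n. (LINT x|T2. norm (\<Sum>k. block_grad (scale (n + k)) j x)) \<le> C / scale n"
proof -
  obtain C where C: "0 \<le> C" "\<And>n. AE x in T2. summable (\<lambda>k. norm (block_grad (scale (n + k)) j x))"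
    "\<And>n. integrable T2 (\<lambda>x. norm (\<Sum>k. block_grad (scale (n + k)) j x) powr 1)"
    "\<And>n. (LINT x|T2. norm (\<Sum>k. block_grad (scale (n + k)) j x) powr 1) \<le> C * scale n powr (- (6 - 4 * 1) / 2)"
    by (rule grad_tail[of 1 j]) auto
  have "integrable T2 (\<lambda>x. \<Sum>k. block_grad (scale (n + k)) j x)" for n
    using C(3)[of n] integrable_norm_iff[OF measurable_grad_series[of n j]] by simp
  moreover have "(LINT x|T2. norm (\<Sum>k. block_grad (scale (n + k)) j x)) \<le> C / scale n" for n
    using C(4)[of n] powr_minus_nat[of "scale n" 1] by simp
  ultimately show thesis using that C by blast
qed

lemma summable_inverse_scale: "summable (\<lambda>k. A / real (scale k ^ 2))"
proof -
  have "summable (\<lambda>k. A * (2 powr (real k * 0) * real (scale k) powr (- 2)))"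
    by (intro summable_mult scale_summable) simp
  moreover have "A * (2 powr (real k * 0) * real (scale k) powr (- 2)) = A / real (scale k ^ 2)" for k
    using powr_minus_nat[of "scale k" 2] scale_ge_2[of k] by simp
  ultimately show ?thesis by (simp only:)
qed

lemma summable_field_L1: "summable (\<lambda>k. LINT x|T2. norm (block_field (scale k) all_modes x))"
proof (rule summable_comparison_test'[OF summable_inverse_scale[of block_const], of 0])
  show "norm (LINT x|T2. norm (block_field (scale k) all_modes x)) \<le> block_const / real (scale k ^ 2)" for k
    using field_norm_L1[of "scale k" all_modes] by simp
qed

lemma summable_grad_L1: "summable (\<lambda>k. LINT x|T2. norm (block_grad (scale k) j x))"
proof (rule summable_comparison_test'[OF summable_inverse_scale[of block_const], of 0])
  show "norm (LINT x|T2. norm (block_grad (scale k) j x)) \<le> block_const / real (scale k ^ 2)" for k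
    using grad_norm_L1[of "scale k" j] by simp
qed

lemma flow_AE_summable: "AE x in T2. summable (\<lambda>k. norm (block_field (scale k) all_modes x))"
proof -
  obtain C where "\<And>n. AE x in T2. summable (\<lambda>k. norm (block_field (scale (n + k)) all_modes x))"
    using field_tail_L1 by blast
  from this[of 0] show ?thesis by simp
qed

lemma flow_grad_AE_summable: "AE x in T2. summable (\<lambda>k. norm (block_grad (scale k) j x))"
proof -
  obtain C where "\<And>n. AE x in T2. summable (\<lambda>k. norm (block_grad (scale (n + k)) j x))"
    using grad_tail_L1[of j] by blast
  from this[of 0] show ?thesis by simp
qed

lemma integrable_flow: "integrable T2 flow"
proof -
  obtain C where "\<And>n. integrable T2 (\<lambda>x. \<Sum>k. block_field (scale (n + k)) all_modes x)"
    using field_tail_L1 by blast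
  from this[of 0] show ?thesis by (simp add: flow_def[abs_def])
qed

lemma integrable_flow_grad: "integrable T2 (flow_grad j)"
proof -
  obtain C where "\<And>n. integrable T2 (\<lambda>x. \<Sum>k. block_grad (scale (n + k)) j x)"
    using grad_tail_L1[of j] by blast
  from this[of 0] show ?thesis by (simp add: flow_grad_def[abs_def])
qed

text \<open>The continuous factor is bounded on the cube, so integration term by term is justified
  by L^1 summability. Weak derivatives of the flow are thereby reduced to classical ones of the
  blocks.\<close>

lemma integral_scaleR_series:
  fixes f :: "nat \<Rightarrow> real^2 \<Rightarrow> real^2"
  assumes G: "continuous_on UNIV G" and f: "\<And>k. continuous_on UNIV (f k)"
    and ae: "AE x in T2. summable (\<lambda>k. norm (f k x))" and sm: "summable (\<lambda>k. LINT x|T2. norm (f k x))"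
  shows "(\<lambda>k. LINT x|T2. G x *\<^sub>R f k x) sums (LINT x|T2. G x *\<^sub>R (\<Sum>k. f k x))"
proof -
  obtain B where B: "\<And>x. x \<in> cbox 0 1 \<Longrightarrow> norm (G x) \<le> B"
    using continuous_bounded_on_cube[OF G] by blast
  have int: "integrable T2 (\<lambda>x. G x *\<^sub>R f k x)" "integrable T2 (\<lambda>x. norm (f k x))" for k
    by (intro integrable_continuous_T2 continuous_intros G f)+
  have le: "(LINT x|T2. norm (G x *\<^sub>R f k x)) \<le> B * (LINT x|T2. norm (f k x))" for k
  proof -
    have "(LINT x|T2. norm (G x *\<^sub>R f k x)) \<le> (LINT x|T2. B * norm (f k x))"
    proof (rule integral_mono)
      show "norm (G x *\<^sub>R f k x) \<le> B * norm (f k x)" if "x \<in> space T2" for x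
        using B[of x] that by (auto intro: mult_right_mono)
    qed (use int in \<open>auto intro!: integrable_norm[OF int(1), simplified]\<close>)
    then show ?thesis by simp
  qed
  have "(\<lambda>k. LINT x|T2. G x *\<^sub>R f k x) sums (LINT x|T2. (\<Sum>k. G x *\<^sub>R f k x))"
  proof (rule sums_integral)
    show "AE x in T2. summable (\<lambda>k. norm (G x *\<^sub>R f k x))"
      using ae by eventually_elim (simp add: summable_mult)
    show "summable (\<lambda>k. LINT x|T2. norm (G x *\<^sub>R f k x))"
      by (rule summable_comparison_test'[OF summable_mult[OF sm, of B], of 0]) (use le in \<open>simp add: abs_of_nonneg\<close>)
  qed (use int in auto)
  moreover have "(LINT x|T2. (\<Sum>k. G x *\<^sub>R f k x)) = (LINT x|T2. G x *\<^sub>R (\<Sum>k. f k x))"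
  proof (rule integral_cong_AE)
    have [measurable]: "f k \<in> borel_measurable T2" "G \<in> borel_measurable T2" for k
      using integrable_continuous_T2[OF f] integrable_continuous_T2[OF G] by auto
    show "(\<lambda>x. \<Sum>k. G x *\<^sub>R f k x) \<in> borel_measurable T2" by measurable
    show "(\<lambda>x. G x *\<^sub>R (\<Sum>k. f k x)) \<in> borel_measurable T2" by measurable
    show "AE x in T2. (\<Sum>k. G x *\<^sub>R f k x) = G x *\<^sub>R (\<Sum>k. f k x)"
      using ae by eventually_elim (simp add: suminf_scaleR_right summable_norm_cancel)
  qed
  ultimately show ?thesis by simp
qed

lemma C1_block_field: "C1 (\<lambda>x. block_field t \<sigma> x $ l)"
  using C1_trig_poly by (simp add: block_field_def)

lemma partial_block_field: "partial j (\<lambda>x. block_field t all_modes x $ l) = (\<lambda>x. block_grad t j x $ l)"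
proof -
  have "2 * pi * \<i> * of_int (block_freq (t^3) i $ j) * (of_real 1 * (- \<i> * of_real (2 * pi / t^14 * perp (block_freq (t^3) i) l)))
     = complex_of_real ((2 * pi)^2 / t^14 * (block_freq (t^3) i $ j * perp (block_freq (t^3) i) l))" for i
    by (simp add: complex_eq_iff power2_eq_square)
  then show ?thesis
    using partial_trig_poly[of j "block_index (t^3)" "\<lambda>i. of_real 1 * (- \<i> * of_real (2 * pi / t^14 * perp (block_freq (t^3) i) l))" "block_freq (t^3)"]
    by (simp add: block_field_def block_grad_def)
qed

lemma block_field_by_parts:
  assumes "C1 \<phi>"
  shows "(LINT x|T2. partial j \<phi> x *\<^sub>R block_field t all_modes x) = - (LINT x|T2. \<phi> x *\<^sub>R block_grad t j x)"
proof -
  have i1: "integrable T2 (\<lambda>x. partial j \<phi> x *\<^sub>R block_field t all_modes x)"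
    by (intro integrable_continuous_T2 continuous_intros C1_partial assms)
  have i2: "integrable T2 (\<lambda>x. \<phi> x *\<^sub>R block_grad t j x)"
    by (intro integrable_continuous_T2 continuous_intros C1_continuous assms)
  show ?thesis
    using integral_by_parts_T2[OF assms C1_block_field[of t all_modes], of j]
      integral_vec_nth[OF i1] integral_vec_nth[OF i2]
    by (simp add: vec_eq_iff partial_block_field)
qed

lemma flow_has_weak_partial: "has_weak_partial j flow (flow_grad j)"
  unfolding has_weak_partial_def
proof (intro conjI allI impI integrable_flow integrable_flow_grad)
  show "periodic flow" "periodic (flow_grad j)"
    using periodic_block_field periodic_block_grad by (auto simp: periodic_def flow_def flow_grad_def)
  fix \<phi> assume "test_fun \<phi>"
  then have \<phi>: "C1 \<phi>" by (rule test_fun_C1)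
  have "(\<lambda>k. LINT x|T2. partial j \<phi> x *\<^sub>R block_field (scale k) all_modes x) sums (LINT x|T2. partial j \<phi> x *\<^sub>R flow x)"
    unfolding flow_def
    by (rule integral_scaleR_series[OF C1_partial(1)[OF \<phi>] continuous_field flow_AE_summable summable_field_L1])
  moreover have "(\<lambda>k. LINT x|T2. \<phi> x *\<^sub>R block_grad (scale k) j x) sums (LINT x|T2. \<phi> x *\<^sub>R flow_grad j x)"
    unfolding flow_grad_def
    by (rule integral_scaleR_series[OF C1_continuous[OF \<phi>] continuous_grad flow_grad_AE_summable summable_grad_L1])
  ultimately show "(LINT x|T2. partial j \<phi> x *\<^sub>R flow x) = - (LINT x|T2. \<phi> x *\<^sub>R flow_grad j x)"
    using sums_unique2[OF _ sums_minus] by (simp add: block_field_by_parts[OF \<phi>])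
qed

text \<open>Every mode contributes a multiple of the inner product of \<open>\<alpha>\<close> with
  \<open>perp \<alpha>\<close>, which is zero.\<close>

lemma block_grad_trace: "block_grad t 1 x $ 1 + block_grad t 2 x $ 2 = 0"
  by (simp add: block_grad_def trig_poly_def perp_def mult_ac flip: sum.distrib)

text \<open>The weak derivatives move off the test function, leaving the trace of
  \<open>flow_grad\<close>. That trace vanishes almost everywhere as a convergent series of block
  traces.\<close>

lemma flow_divergence_free: "divergence_free flow"
  unfolding divergence_free_def
proof (intro conjI allI impI integrable_flow)
  fix \<phi> assume \<phi>: "test_fun \<phi>"
  have w: "(LINT x|T2. partial j \<phi> x *\<^sub>R flow x) = - (LINT x|T2. \<phi> x *\<^sub>R flow_grad j x)" for j
    using flow_has_weak_partial[of j] \<phi> by (auto simp: has_weak_partial_def)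
  have i1: "integrable T2 (\<lambda>x. partial j \<phi> x *\<^sub>R flow x)" for j
    by (intro integrable_continuous_scaleR integrable_flow C1_partial test_fun_C1 \<phi>)
  have i2: "integrable T2 (\<lambda>x. \<phi> x *\<^sub>R flow_grad j x)" for j
    by (intro integrable_continuous_scaleR integrable_flow_grad C1_continuous test_fun_C1 \<phi>)
  have "(LINT x|T2. (\<Sum>j\<in>UNIV. flow x $ j * partial j \<phi> x)) = (\<Sum>j\<in>UNIV. LINT x|T2. (partial j \<phi> x *\<^sub>R flow x) $ j)"
    using integrable_vec_nth[OF i1] by (simp add: mult.commute)
  also have "\<dots> = - (\<Sum>j\<in>UNIV. LINT x|T2. (\<phi> x *\<^sub>R flow_grad j x) $ j)"
    unfolding integral_vec_nth[OF i1] integral_vec_nth[OF i2] w by (simp add: sum_negf)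
  also have "(\<Sum>j\<in>UNIV. LINT x|T2. (\<phi> x *\<^sub>R flow_grad j x) $ j) = (LINT x|T2. \<phi> x * (flow_grad 1 x $ 1 + flow_grad 2 x $ 2))"
    using integrable_vec_nth[OF i2, of 1 1] integrable_vec_nth[OF i2, of 2 2] by (simp add: sum_2 distrib_left)
  also have "\<dots> = 0"
  proof (rule integral_eq_zero_AE)
    show "AE x in T2. \<phi> x * (flow_grad 1 x $ 1 + flow_grad 2 x $ 2) = 0"
      using flow_grad_AE_summable[of 1] flow_grad_AE_summable[of 2]
    proof eventually_elim
      case (elim x)
      have c: "(\<lambda>k. block_grad (scale k) j x $ l) sums (flow_grad j x $ l)" if "summable (\<lambda>k. norm (block_grad (scale k) j x))" for j l
        unfolding flow_grad_def
        by (rule bounded_linear.sums[OF bounded_linear_vec_nth summable_sums[OF summable_norm_cancel[OF that]]])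
      have "(\<lambda>k. block_grad (scale k) 1 x $ 1 + block_grad (scale k) 2 x $ 2) sums (flow_grad 1 x $ 1 + flow_grad 2 x $ 2)"
        by (intro sums_add c elim)
      then have "flow_grad 1 x $ 1 + flow_grad 2 x $ 2 = 0"
        unfolding block_grad_trace by (rule sums_unique2[OF _ sums_zero])
      then show ?case by simp
    qed
  qed
  finally show "(LINT x|T2. (\<Sum>j\<in>UNIV. flow x $ j * partial j \<phi> x)) = 0" by simp
qed

lemma flow_in_Lp:
  assumes "2 \<le> p" "p < 6" shows "in_Lp p flow"
proof -
  obtain C where "\<And>n. integrable T2 (\<lambda>x. norm (\<Sum>k. block_field (scale (n + k)) all_modes x) powr p)"
    using field_tail[OF assms] by blast
  from this[of 0] show ?thesis
    using integrable_flow by (auto simp: in_Lp_def flow_def[abs_def])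
qed

lemma flow_grad_in_Lp:
  assumes "1 \<le> p" "p < 3 / 2" shows "in_Lp p (flow_grad j)"
proof -
  obtain C where "\<And>n. integrable T2 (\<lambda>x. norm (\<Sum>k. block_grad (scale (n + k)) j x) powr p)"
    using grad_tail[OF assms] by blast
  from this[of 0] show ?thesis
    using integrable_flow_grad[of j] by (auto simp: in_Lp_def flow_grad_def[abs_def])
qed

lemma in_Lp_mono_T2:
  assumes "in_Lp r f" "0 < p" "p \<le> r"
  shows "in_Lp p f"
proof -
  have [measurable]: "f \<in> borel_measurable T2" using assms by (simp add: in_Lp_def)
  have "integrable T2 (\<lambda>x. norm (f x) powr p)"
  proof (rule Bochner_Integration.integrable_bound[of _ "\<lambda>x. 1 + norm (f x) powr r"])
    have "integrable T2 (\<lambda>x. 1::real)" by (intro integrable_continuous_T2 continuous_intros)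
    then show "integrable T2 (\<lambda>x. 1 + norm (f x) powr r)"
      using assms by (simp add: in_Lp_def)
    have "norm (f x) powr p \<le> 1 + norm (f x) powr r" for x
    proof (cases "norm (f x) \<le> 1")
      case True
      then have "norm (f x) powr p \<le> 1 powr p" using assms by (intro powr_mono2) auto
      then show ?thesis by (simp add: add_increasing2)
    next
      case False
      then have "norm (f x) powr p \<le> norm (f x) powr r" using assms by (intro powr_mono) auto
      then show ?thesis by simp
    qed
    then show "AE x in T2. norm (norm (f x) powr p) \<le> norm (1 + norm (f x) powr r)"
      by (intro AE_I2) (simp add: add_nonneg_nonneg)
  qed measurable
  then show ?thesis using assms by (simp add: in_Lp_def)
qed

lemma flow_in_W1p:
  assumes "1 \<le> p" "p < 3 / 2" shows "in_W1p p flow"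
proof -
  have "in_Lp p flow" by (rule in_Lp_mono_T2[OF flow_in_Lp[of 3]]) (use assms in auto)
  then show ?thesis
    using flow_has_weak_partial flow_grad_in_Lp[OF assms] unfolding in_W1p_def has_weak_partial_def by blast
qed

lemma flow_advection: "AE x in T2. advection flow x = (\<Sum>j\<in>UNIV. (flow x $ j) *\<^sub>R flow_grad j x)"
proof -
  have "has_weak_partial j flow (weak_partial j flow)" for j
    unfolding weak_partial_def by (rule someI[of "has_weak_partial j flow" "flow_grad j"]) (rule flow_has_weak_partial)
  then have "AE x in T2. weak_partial j flow x = flow_grad j x" for j
    by (rule has_weak_partial_unique[OF _ flow_has_weak_partial])
  from this[of 1] this[of 2] show ?thesis
    by eventually_elim (simp add: advection_def sum_2)
qed

text \<open>The conjugate exponents 4 and 4/3 lie below the thresholds 6 for the field and 3/2 for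
  its gradient, so this pairing makes the advection term integrable. Comparing \<open>b\<close> with
  \<open>a powr 3\<close> gives the inequality with constants 1.\<close>

lemma young_4:
  fixes a b :: real
  assumes "0 \<le> a" "0 \<le> b"
  shows "a * b \<le> a powr 4 + b powr (4/3)"
proof (cases "b \<le> a powr 3")
  case True
  then have "a * b \<le> a * a powr 3" by (rule mult_left_mono) (rule assms)
  also have "\<dots> = a powr 4" using assms by (simp add: eval_nat_numeral)
  finally show ?thesis by (simp add: add_increasing2)
next
  case False
  then have "a powr 3 \<le> b" by simp
  then have "(a powr 3) powr (1/3) \<le> b powr (1/3)" by (rule powr_mono2[rotated 2]) auto
  moreover have "(a powr 3) powr (1/3) = a"
    using assms by (simp add: powr_powr del: powr_numeral)
  ultimately have "a \<le> b powr (1/3)" by simp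
  then have "a * b \<le> b powr (1/3) * b" by (rule mult_right_mono) (rule assms)
  also have "\<dots> = b powr (4/3)" using assms by (simp add: powr_mult_base mult.commute)
  finally show ?thesis by (simp add: add_increasing)
qed

lemma flow_advection_integrable:
  shows "integrable T2 (\<lambda>x. (flow x $ j) *\<^sub>R flow_grad j x)"
proof (rule Bochner_Integration.integrable_bound[of _ "\<lambda>x. norm (flow x) powr 4 + norm (flow_grad j x) powr (4/3)"])
  show "integrable T2 (\<lambda>x. norm (flow x) powr 4 + norm (flow_grad j x) powr (4/3))"
    using flow_in_Lp[of 4] flow_grad_in_Lp[of "4/3" j] by (simp add: in_Lp_def)
  have [measurable]: "flow \<in> borel_measurable T2" "flow_grad j \<in> borel_measurable T2"
    using integrable_flow integrable_flow_grad by auto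
  have [measurable]: "(\<lambda>x. flow x $ j) \<in> borel_measurable T2"
    using integrable_vec_nth[OF integrable_flow] by auto
  show "(\<lambda>x. (flow x $ j) *\<^sub>R flow_grad j x) \<in> borel_measurable T2" by measurable
  show "AE x in T2. norm ((flow x $ j) *\<^sub>R flow_grad j x) \<le> norm (norm (flow x) powr 4 + norm (flow_grad j x) powr (4/3))"
  proof (rule AE_I2)
    fix x
    have "norm ((flow x $ j) *\<^sub>R flow_grad j x) \<le> norm (flow x) * norm (flow_grad j x)"
      by (simp add: mult_right_mono component_le_norm_cart)
    also have "\<dots> \<le> norm (flow x) powr 4 + norm (flow_grad j x) powr (4/3)"
      by (rule young_4)  simp_all
    finally show "norm ((flow x $ j) *\<^sub>R flow_grad j x) \<le> norm (norm (flow x) powr 4 + norm (flow_grad j x) powr (4/3))"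
      by simp
  qed
qed

section \<open>Littlewood-Paley components of the vector field\<close>

lemma scale_neq_0 [simp]: "scale k \<noteq> 0"
  by (simp add: scale_def)

lemma fourier_coeff_cong_AE:
  assumes [measurable]: "f \<in> borel_measurable T2" "g \<in> borel_measurable T2" and ae: "AE x in T2. f x = g x"
  shows "fourier_coeff f \<alpha> = fourier_coeff g \<alpha>"
proof -
  have [measurable]: "wave \<beta> \<in> borel_measurable T2" for \<beta> using integrable_wave by auto
  show ?thesis
    unfolding fourier_coeff_wave by (rule integral_cong_AE) (use ae in \<open>auto elim: eventually_mono\<close>)
qed

lemma block_field_cong:
  "(\<And>i. i \<in> block_index (t^3) \<Longrightarrow> \<sigma> i = \<sigma>' i) \<Longrightarrow> block_field t \<sigma> = block_field t \<sigma>'"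
  by (rule ext) (simp add: block_field_def trig_poly_def vec_eq_iff)

lemma block_field_zero:
  "(\<And>i. i \<in> block_index (t^3) \<Longrightarrow> \<sigma> i = 0) \<Longrightarrow> block_field t \<sigma> x = 0"
  by (simp add: block_field_def trig_poly_def vec_eq_iff)

lemma fourier_multiplier_block_field:
  assumes "finite_symbol m"
  shows "fourier_multiplier m (\<lambda>x. block_field t \<sigma> x $ l) = (\<lambda>x. block_field t (\<lambda>i. m (freq (block_freq (t^3) i)) * \<sigma> i) x $ l)"
  unfolding block_field_def vec_lambda_beta
  by (simp only: fourier_multiplier_trig_poly[OF assms] of_real_mult mult.assoc)

text \<open>L^1 convergence passes to Fourier coefficients, and a finite symbol uses only finitely
  many of them. On each block the multiplier merely changes the mode weights.\<close>

lemma flow_multiplier: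
  assumes m: "finite_symbol m"
  shows "(\<lambda>k. block_field (scale k) (\<lambda>i. m (freq (block_freq (scale k ^ 3) i))) x) sums fourier_multiplier_vec m flow x"
proof -
  have "(\<lambda>k. block_field (scale k) (\<lambda>i. m (freq (block_freq (scale k ^ 3) i))) x $ l) sums (fourier_multiplier_vec m flow x $ l)" for l
  proof -
    let ?f = "\<lambda>k y. block_field (scale k) all_modes y $ l"
    have int: "integrable T2 (?f k)" "integrable T2 (\<lambda>y. \<bar>?f k y\<bar>)" "integrable T2 (\<lambda>y. norm (block_field (scale k) all_modes y))" for k
      by (intro integrable_continuous_T2 continuous_intros)+
    have ae: "AE y in T2. summable (\<lambda>k. \<bar>?f k y\<bar>)"
      using flow_AE_summable
    proof eventually_elim
      case (elim y)
      show ?case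
        by (rule summable_comparison_test'[OF elim, of 0]) (simp add: component_le_norm_cart)
    qed
    have le: "(LINT y|T2. \<bar>?f k y\<bar>) \<le> (LINT y|T2. norm (block_field (scale k) all_modes y))" for k
      by (rule integral_mono[OF int(2,3)]) (rule component_le_norm_cart)
    have sm: "summable (\<lambda>k. LINT y|T2. \<bar>?f k y\<bar>)"
    proof (rule summable_comparison_test'[OF summable_field_L1, of 0])
      show "norm (LINT y|T2. \<bar>?f k y\<bar>) \<le> (LINT y|T2. norm (block_field (scale k) all_modes y))" for k
        using le[of k] by simp
    qed
    have "(\<lambda>k. fourier_multiplier m (?f k) x) sums fourier_multiplier m (\<lambda>y. \<Sum>k. ?f k y) x"
      by (rule fourier_multiplier_sums[OF m int(1) ae sm])
    moreover have "fourier_coeff (\<lambda>y. \<Sum>k. ?f k y) \<alpha> = fourier_coeff (\<lambda>y. flow y $ l) \<alpha>" for \<alpha>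
    proof (rule fourier_coeff_cong_AE)
      have [measurable]: "?f k \<in> borel_measurable T2" for k using int by auto
      show "(\<lambda>y. \<Sum>k. ?f k y) \<in> borel_measurable T2" by measurable
      show "(\<lambda>y. flow y $ l) \<in> borel_measurable T2"
        using integrable_vec_nth[OF integrable_flow] by auto
      show "AE y in T2. (\<Sum>k. ?f k y) = flow y $ l"
        using flow_AE_summable
      proof eventually_elim
        case (elim y)
        have "(\<lambda>k. ?f k y) sums (flow y $ l)"
          unfolding flow_def
          by (rule bounded_linear.sums[OF bounded_linear_vec_nth summable_sums[OF summable_norm_cancel[OF elim]]])
        then show ?case by (rule sums_unique[symmetric])
      qed
    qed
    ultimately show ?thesis
      by (simp add: fourier_multiplier_block_field[OF m] fourier_multiplier_vec_def fourier_multiplier_finite[OF m] del: times_complex.sel)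
  qed
  then show ?thesis unfolding sums_def by (intro vec_tendstoI) simp
qed

section \<open>Cut-off functions and frequency supports\<close>

lemma finite_freq_ball: "finite {\<alpha>. norm (freq \<alpha>) < r}"
proof (rule finite_subset)
  show "{\<alpha>. norm (freq \<alpha>) < r} \<subseteq> vec2 ` ({- \<lceil>r\<rceil>..\<lceil>r\<rceil>} \<times> {- \<lceil>r\<rceil>..\<lceil>r\<rceil>})"
  proof
    fix \<alpha> assume "\<alpha> \<in> {\<alpha>. norm (freq \<alpha>) < r}"
    then have r: "norm (freq \<alpha>) < r" by simp
    have "\<bar>\<alpha> $ j\<bar> \<le> \<lceil>r\<rceil>" for j
    proof -
      have "real_of_int \<bar>\<alpha> $ j\<bar> = \<bar>freq \<alpha> $ j\<bar>" by (simp add: freq_def)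
      then have "real_of_int \<bar>\<alpha> $ j\<bar> \<le> real_of_int \<lceil>r\<rceil>"
        using component_le_norm_cart[of "freq \<alpha>" j] r le_of_int_ceiling[of r] by linarith
      then show ?thesis by (simp only: of_int_le_iff)
    qed
    then have "(\<alpha> $ 1, \<alpha> $ 2) \<in> {- \<lceil>r\<rceil>..\<lceil>r\<rceil>} \<times> {- \<lceil>r\<rceil>..\<lceil>r\<rceil>}"
      by (simp add: abs_le_iff minus_le_iff)
    moreover have "\<alpha> = vec2 (\<alpha> $ 1, \<alpha> $ 2)" by (simp add: vec_eq_iff forall_2)
    ultimately show "\<alpha> \<in> vec2 ` ({- \<lceil>r\<rceil>..\<lceil>r\<rceil>} \<times> {- \<lceil>r\<rceil>..\<lceil>r\<rceil>})"
      by (rule rev_image_eqI)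
  qed
qed (intro finite_imageI finite_cartesian_product finite_atLeastAtMost_int)

lemma LP_cutoffD:
  assumes "LP_cutoff c"
  shows "smooth c" "norm \<xi> = norm \<eta> \<Longrightarrow> c \<xi> = c \<eta>"
    "closure {\<xi>. c \<xi> \<noteq> 0} \<subseteq> ball 0 1" "norm \<xi> \<le> 1 / 2 \<Longrightarrow> c \<xi> = 1"
proof -
  note d = assms[unfolded LP_cutoff_def]
  show "smooth c" by (rule conjunct1[OF d])
  show "norm \<xi> = norm \<eta> \<Longrightarrow> c \<xi> = c \<eta>"
    by (rule conjunct1[OF conjunct2[OF conjunct2[OF d]], rule_format])
  show "closure {\<xi>. c \<xi> \<noteq> 0} \<subseteq> ball 0 1"
    by (rule conjunct1[OF conjunct2[OF conjunct2[OF conjunct2[OF d]]]])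
  show "norm \<xi> \<le> 1 / 2 \<Longrightarrow> c \<xi> = 1"
    by (rule conjunct2[OF conjunct2[OF conjunct2[OF conjunct2[OF d]]], rule_format])
qed

lemma LP_cutoff_even: "LP_cutoff c \<Longrightarrow> c (- \<xi>) = c \<xi>"
  using LP_cutoffD(2)[of c "- \<xi>" \<xi>] norm_minus_cancel[of \<xi>] by blast

lemmas LP_cutoff_one = LP_cutoffD(4)

lemma LP_cutoff_zero: "LP_cutoff c \<Longrightarrow> 1 \<le> norm \<xi> \<Longrightarrow> c \<xi> = 0"
proof (rule ccontr)
  assume c: "LP_cutoff c" and n: "1 \<le> norm \<xi>" and nz: "c \<xi> \<noteq> 0"
  have "\<xi> \<in> {\<xi>. c \<xi> \<noteq> 0}" using nz by simp
  from subsetD[OF LP_cutoffD(3)[OF c] subsetD[OF closure_subset this]] show False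
    using n by simp
qed

text \<open>The bound comes from continuity on the closed unit ball, outside of which the cut-off
  vanishes.\<close>

lemma LP_cutoff_bounded:
  assumes c: "LP_cutoff c"
  obtains B where "0 \<le> B" "\<And>\<xi>. \<bar>c \<xi>\<bar> \<le> B"
proof -
  have "iter_partial [] c differentiable (at x)" for x
    by (rule LP_cutoffD(1)[OF c, unfolded smooth_def, rule_format])
  then have "continuous_on (cball 0 1) c"
    by (simp add: continuous_at_imp_continuous_on differentiable_imp_continuous_within)
  then have "bounded (c ` cball 0 1)"
    by (intro compact_imp_bounded compact_continuous_image) auto
  then obtain B where "\<forall>y\<in>c ` cball 0 1. norm y \<le> B" unfolding bounded_iff by blast
  then have B: "\<xi> \<in> cball 0 1 \<Longrightarrow> \<bar>c \<xi>\<bar> \<le> B" for \<xi> by auto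
  have "\<bar>c \<xi>\<bar> \<le> max B 0" for \<xi>
    using B[of \<xi>] LP_cutoff_zero[OF c, of \<xi>] by (cases "norm \<xi> \<le> 1") (auto simp: le_max_iff_disj)
  then show thesis by (intro that[of "max B 0"]) auto
qed

lemma freq_scale_pos [simp]: "0 < freq_scale q" by (simp add: freq_scale_def)

lemma norm_rescale: "norm (inverse (freq_scale q) *\<^sub>R \<xi>) = norm \<xi> / freq_scale q"
  by (simp add: abs_of_pos[OF freq_scale_pos] divide_inverse mult.commute)

lemma finite_symbol_truncation:
  assumes c: "LP_cutoff c"
  shows "finite_symbol (\<lambda>\<xi>. c (inverse (freq_scale q) *\<^sub>R \<xi>))"
  unfolding finite_symbol_def
proof (intro conjI allI)
  show "c (inverse (freq_scale q) *\<^sub>R - \<xi>) = c (inverse (freq_scale q) *\<^sub>R \<xi>)" for \<xi>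
    using LP_cutoff_even[OF c, of "inverse (freq_scale q) *\<^sub>R \<xi>"] by simp
  have "norm (freq \<alpha>) < freq_scale q" if "c (inverse (freq_scale q) *\<^sub>R freq \<alpha>) \<noteq> 0" for \<alpha>
  proof -
    have "\<not> 1 \<le> norm (inverse (freq_scale q) *\<^sub>R freq \<alpha>)" using LP_cutoff_zero[OF c] that by blast
    then show ?thesis unfolding norm_rescale by simp
  qed
  then show "finite {\<alpha>. c (inverse (freq_scale q) *\<^sub>R freq \<alpha>) \<noteq> 0}"
    by (intro finite_subset[OF _ finite_freq_ball]) auto
qed

text \<open>In the difference \<open>c (\<xi> / 2) - c \<xi>\<close> both terms are 1 for norm at
  most 1/2 and both are 0 for norm at least 2.\<close>

lemma LP_annulus_support:
  assumes c: "LP_cutoff c" and "LP_annulus c (inverse (freq_scale q) *\<^sub>R \<xi>) \<noteq> 0"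
  shows "freq_scale q / 2 < norm \<xi>" "norm \<xi> < 2 * freq_scale q"
proof -
  let ?\<eta> = "inverse (freq_scale q) *\<^sub>R \<xi>"
  have n: "norm ?\<eta> = norm \<xi> / freq_scale q" by (rule norm_rescale)
  have "\<not> norm ?\<eta> \<le> 1 / 2" "\<not> norm ?\<eta> \<ge> 2"
    using assms(2) LP_cutoff_one[OF c] LP_cutoff_zero[OF c] by (auto simp: LP_annulus_def freq_scale_def)
  then show "freq_scale q / 2 < norm \<xi>" "norm \<xi> < 2 * freq_scale q"
    unfolding n by (simp_all add: field_simps)
qed

lemma finite_symbol_annulus:
  assumes c: "LP_cutoff c"
  shows "finite_symbol (\<lambda>\<xi>. LP_annulus c (inverse (freq_scale q) *\<^sub>R \<xi>))"
  unfolding finite_symbol_def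
proof (intro conjI allI)
  show "LP_annulus c (inverse (freq_scale q) *\<^sub>R - \<xi>) = LP_annulus c (inverse (freq_scale q) *\<^sub>R \<xi>)" for \<xi>
    using LP_cutoff_even[OF c] unfolding LP_annulus_def by (simp add: scaleR_minus_right)
  show "finite {\<alpha>. LP_annulus c (inverse (freq_scale q) *\<^sub>R freq \<alpha>) \<noteq> 0}"
    by (rule finite_subset[OF _ finite_freq_ball[of "2 * freq_scale q"]]) (use LP_annulus_support(2)[OF c] in auto)
qed

text \<open>The last two bounds place cluster 0 inside the ball of radius \<open>512 * m\<close>,
  where the cut-off at \<open>1024 * m\<close> is 1, and the other clusters outside radius
  \<open>1024 * m\<close>, where it is 0.\<close>

lemma block_freq_norm:
  assumes i: "i \<in> block_index m"
  shows "norm (freq (block_freq m i)) \<le> 4200 * real m" "246 * real m \<le> norm (freq (block_freq m i))"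
    and "fst i = 0 \<Longrightarrow> norm (freq (block_freq m i)) \<le> 276 * real m"
    and "fst i \<noteq> 0 \<Longrightarrow> 2038 * real m \<le> norm (freq (block_freq m i))"
proof -
  let ?\<alpha> = "block_freq m i"
  have comp: "\<bar>freq ?\<alpha> $ j\<bar> = real_of_int \<bar>?\<alpha> $ j\<bar>" for j by (simp add: freq_def)
  have up: "norm (freq ?\<alpha>) \<le> real_of_int (\<bar>?\<alpha> $ 1\<bar> + \<bar>?\<alpha> $ 2\<bar>)"
    using norm_vec2_le[of "freq ?\<alpha>"] by (simp add: comp)
  have lo: "real_of_int \<bar>?\<alpha> $ j\<bar> \<le> norm (freq ?\<alpha>)" for j
    using component_le_norm_cart[of "freq ?\<alpha>" j] by (simp add: comp)
  have s: "fst i = 0 \<or> fst i = 1 \<or> fst i = 2" using i by (auto simp: block_index_def)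
  note near = block_freq_near[OF i]
  have ints: "\<bar>?\<alpha> $ 1\<bar> + \<bar>?\<alpha> $ 2\<bar> \<le> 4200 * int m" "246 * int m \<le> \<bar>?\<alpha> $ 1\<bar>"
    "fst i = 0 \<Longrightarrow> \<bar>?\<alpha> $ 1\<bar> + \<bar>?\<alpha> $ 2\<bar> \<le> 276 * int m" "fst i \<noteq> 0 \<Longrightarrow> 2038 * int m \<le> \<bar>?\<alpha> $ 2\<bar>"
    using s near by (auto simp: center_def)
  show "norm (freq (block_freq m i)) \<le> 4200 * real m"
    using up of_int_le_iff[where 'a = real, THEN iffD2, OF ints(1)] by simp
  show "246 * real m \<le> norm (freq (block_freq m i))"
    using lo[of 1] of_int_le_iff[where 'a = real, THEN iffD2, OF ints(2)] by simp
  show "fst i = 0 \<Longrightarrow> norm (freq (block_freq m i)) \<le> 276 * real m"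
    using up of_int_le_iff[where 'a = real, THEN iffD2, OF ints(3)] by simp
  show "fst i \<noteq> 0 \<Longrightarrow> 2038 * real m \<le> norm (freq (block_freq m i))"
    using lo[of 2] of_int_le_iff[where 'a = real, THEN iffD2, OF ints(4)] by simp
qed

lemma scale_gap: "k < n \<Longrightarrow> 1000 * real (scale k ^ 3) \<le> real (scale n ^ 3)"
proof -
  assume "k < n"
  then have "scale (Suc k) \<le> scale n" by (intro scale_mono) simp
  then have "scale k ^ 20 \<le> scale n" by (simp add: scale_Suc)
  have "(1000::nat) \<le> 2 ^ 19" by simp
  also have "\<dots> \<le> scale k ^ 19" by (intro power_mono scale_ge_2) simp
  finally have "1000 * scale k \<le> scale k ^ 19 * scale k" by (rule mult_right_mono) simp
  also have "\<dots> = scale k ^ 20" by (simp flip: power_Suc2)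
  also have "\<dots> \<le> scale n" by fact
  finally have a: "1000 * scale k \<le> scale n" .
  have "1000 * scale k ^ 3 \<le> (1000 * scale k) ^ 3" by (simp add: power_mult_distrib)
  also have "\<dots> \<le> scale n ^ 3" by (rule power_mono[OF a]) simp
  finally have "1000 * scale k ^ 3 \<le> scale n ^ 3" .
  then have "real (1000 * scale k ^ 3) \<le> real (scale n ^ 3)" by (simp only: of_nat_le_iff)
  then show "1000 * real (scale k ^ 3) \<le> real (scale n ^ 3)" by simp
qed

text \<open>A dyadic annulus meets at most one block, and then its frequency is comparable to
  \<open>m = scale n ^ 3\<close>. The third power of the L^3 norm of that block is of order
  \<open>1 / m\<close>, which the frequency weight compensates uniformly in
  \<open>q\<close>.\<close>

lemma flow_in_Besov:
  assumes c: "LP_cutoff c"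
  shows "in_Besov_third c flow"
proof -
  obtain B where B: "0 \<le> B" "\<And>\<xi>. \<bar>c \<xi>\<bar> \<le> B" using LP_cutoff_bounded[OF c] by blast
  define D where "D = (block_const * (2 * B)) * (block_const * (2 * B)^2)"
  have D: "0 \<le> D" using B block_const_ge_1 by (simp add: D_def)
  have "freq_scale q powr (1/3) * Lp_norm 3 (LP_component c q flow) \<le> (8400 * D) powr (1/3)" for q
  proof -
    let ?m = "\<lambda>\<xi>. LP_annulus c (inverse (freq_scale q) *\<^sub>R \<xi>)"
    let ?\<sigma> = "\<lambda>k i. ?m (freq (block_freq (scale k ^ 3) i))"
    let ?act = "\<lambda>k. \<exists>i\<in>block_index (scale k ^ 3). ?\<sigma> k i \<noteq> 0"
    have sums: "(\<lambda>k. block_field (scale k) (?\<sigma> k) x) sums LP_component c q flow x" for x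
      using flow_multiplier[OF finite_symbol_annulus[OF c]] by (simp add: LP_component_def)
    have act: "freq_scale q < 8400 * real (scale k ^ 3)" "123 * real (scale k ^ 3) < freq_scale q" if A: "?act k" for k
    proof -
      obtain i where i: "i \<in> block_index (scale k ^ 3)" "?\<sigma> k i \<noteq> 0" using A by blast
      show "freq_scale q < 8400 * real (scale k ^ 3)" "123 * real (scale k ^ 3) < freq_scale q"
        using LP_annulus_support[OF c i(2)] block_freq_norm(1,2)[OF i(1)] by linarith+
    qed
    \<comment> \<open>Two active blocks would have frequency scales within a factor
      \<open>8400 / 123\<close>, less than the gap 1000 between different blocks.\<close>
    have uniq: "k = n" if "?act k" "?act n" for k n
      using act[OF that(1)] act[OF that(2)] scale_gap[of k n] scale_gap[of n k] by (cases k n rule: linorder_cases) auto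
    show ?thesis
    proof (cases "\<exists>k. ?act k")
      case False
      have "LP_component c q flow x = 0" for x
      proof -
        have "block_field (scale k) (?\<sigma> k) x = 0" for k by (rule block_field_zero) (use False in blast)
        then show ?thesis using sums[of x] sums_unique2[OF _ sums_zero] by simp
      qed
      then show ?thesis by (simp add: Lp_norm_def)
    next
      case True
      then obtain n where n: "?act n" by blast
      have "LP_component c q flow x = block_field (scale n) (?\<sigma> n) x" for x
      proof -
        have "block_field (scale k) (?\<sigma> k) x = 0" if "k \<notin> {n}" for k
          by (rule block_field_zero) (use uniq[OF n] that in blast)
        from sums_finite[of "{n}", OF _ this] have "(\<lambda>k. block_field (scale k) (?\<sigma> k) x) sums block_field (scale n) (?\<sigma> n) x"
          by simp
        then show ?thesis using sums[of x] sums_unique2 by blast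
      qed
      then have eq: "LP_component c q flow = block_field (scale n) (?\<sigma> n)" by blast
      have b: "\<bar>?\<sigma> n i\<bar> \<le> 2 * B" for i
        using B(2)[of "inverse (freq_scale 1) *\<^sub>R inverse (freq_scale q) *\<^sub>R freq (block_freq (scale n ^ 3) i)"]
          B(2)[of "inverse (freq_scale q) *\<^sub>R freq (block_freq (scale n ^ 3) i)"]
        unfolding LP_annulus_def by linarith
      define J where "J = (LINT x|T2. norm (block_field (scale n) (?\<sigma> n) x) powr 3)"
      have "J \<le> (block_const * (2 * B)) powr (3 - 2) * (block_const * (2 * B)^2) * scale n powr (- (6 - 3))"
        unfolding J_def by (rule field_Lp) (use b B in auto)
      also have "\<dots> = D / real (scale n ^ 3)"
        using powr_minus_nat[of "scale n" 3] B block_const_ge_1 by (simp add: D_def)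
      finally have J: "J \<le> D / real (scale n ^ 3)" .
      have J0: "0 \<le> J" unfolding J_def by simp
      have "freq_scale q * J \<le> (8400 * real (scale n ^ 3)) * (D / real (scale n ^ 3))"
        by (rule mult_mono) (use act(1)[OF n] J J0 in auto)
      also have "\<dots> = 8400 * D" by simp
      finally have "(freq_scale q * J) powr (1/3) \<le> (8400 * D) powr (1/3)"
        by (intro powr_mono2) (use J0 less_imp_le[OF freq_scale_pos] in auto)
      moreover have "Lp_norm 3 (LP_component c q flow) = J powr (1/3)"
        unfolding Lp_norm_def eq J_def ..
      ultimately show ?thesis using J0 by (simp add: powr_mult)
    qed
  qed
  then have "bdd_above (range (\<lambda>q. freq_scale q powr (1/3) * Lp_norm 3 (LP_component c q flow)))"
    by (intro bdd_aboveI[of _ "(8400 * D) powr (1/3)"]) auto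
  then show ?thesis
    using flow_in_Lp[of 3] flow_has_weak_partial[of 1] by (simp add: in_Besov_third_def has_weak_partial_def)
qed

definition low_flow :: "nat \<Rightarrow> real^2 \<Rightarrow> real^2" where
  "low_flow K x = (\<Sum>k<K. block_field (scale k) all_modes x) + block_field (scale K) low x"

text \<open>At this frequency the cut-off is 1 on all earlier blocks and 0 on all later ones, and it
  separates cluster 0 of block \<open>K\<close> from the others. Its shape in the transition region
  is never seen.\<close>

lemma truncation_flow:
  assumes c: "LP_cutoff c" and q: "freq_scale q = 1024 * real (scale K ^ 3)"
  shows "LP_truncation c q flow x = low_flow K x"
    and "k < K \<Longrightarrow> i \<in> block_index (scale k ^ 3) \<Longrightarrow> c (inverse (freq_scale q) *\<^sub>R freq (block_freq (scale k ^ 3) i)) = 1"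
    and "i \<in> block_index (scale K ^ 3) \<Longrightarrow> c (inverse (freq_scale q) *\<^sub>R freq (block_freq (scale K ^ 3) i)) = low i"
proof -
  let ?\<sigma> = "\<lambda>k i. c (inverse (freq_scale q) *\<^sub>R freq (block_freq (scale k ^ 3) i))"
  have TK: "0 < real (scale K ^ 3)" by simp
  have one: "c (inverse (freq_scale q) *\<^sub>R \<xi>) = 1" if "norm \<xi> \<le> 512 * real (scale K ^ 3)" for \<xi>
    by (rule LP_cutoff_one[OF c]) (use that TK in \<open>simp only: norm_rescale q\<close>, simp add: field_simps)
  have zero: "c (inverse (freq_scale q) *\<^sub>R \<xi>) = 0" if "norm \<xi> \<ge> 1024 * real (scale K ^ 3)" for \<xi>
    by (rule LP_cutoff_zero[OF c]) (use that TK in \<open>simp only: norm_rescale q\<close>, simp add: field_simps)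
  show lo: "?\<sigma> k i = 1" if "k < K" "i \<in> block_index (scale k ^ 3)" for k i
    by (rule one) (use block_freq_norm(1)[OF that(2)] scale_gap[OF that(1)] TK in linarith)
  show mid: "?\<sigma> K i = low i" if "i \<in> block_index (scale K ^ 3)" for i
  proof (cases "fst i = 0")
    case True
    have "norm (freq (block_freq (scale K ^ 3) i)) \<le> 512 * real (scale K ^ 3)"
      using block_freq_norm(3)[OF that True] TK by linarith
    from one[OF this] show ?thesis using True by (simp add: low_def)
  next
    case False
    have "1024 * real (scale K ^ 3) \<le> norm (freq (block_freq (scale K ^ 3) i))"
      using block_freq_norm(4)[OF that False] TK by linarith
    from zero[OF this] show ?thesis using False by (simp add: low_def)
  qed
  have hi: "?\<sigma> k i = 0" if "K < k" "i \<in> block_index (scale k ^ 3)" for k i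
    by (rule zero) (use block_freq_norm(2)[OF that(2)] scale_gap[OF that(1)] TK in linarith)
  have "(\<lambda>k. block_field (scale k) (?\<sigma> k) x) sums LP_truncation c q flow x"
    using flow_multiplier[OF finite_symbol_truncation[OF c]] by (simp add: LP_truncation_def)
  moreover have "(\<lambda>k. block_field (scale k) (?\<sigma> k) x) sums (\<Sum>k<Suc K. block_field (scale k) (?\<sigma> k) x)"
    by (rule sums_finite) (use hi in \<open>auto intro!: block_field_zero\<close>)
  moreover have "(\<Sum>k<Suc K. block_field (scale k) (?\<sigma> k) x) = low_flow K x"
  proof -
    have "block_field (scale k) (?\<sigma> k) = block_field (scale k) all_modes" if "k < K" for k
      by (rule block_field_cong) (rule lo[OF that])
    moreover have "block_field (scale K) (?\<sigma> K) = block_field (scale K) low"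
      by (rule block_field_cong) (rule mid)
    ultimately show ?thesis by (simp add: low_flow_def)
  qed
  ultimately show "LP_truncation c q flow x = low_flow K x" using sums_unique2 by fastforce
qed

lemma block_field_self_adjoint:
  assumes m: "finite_symbol m" and F: "integrable T2 F"
    and \<sigma>: "\<And>i. i \<in> block_index (t^3) \<Longrightarrow> m (freq (block_freq (t^3) i)) * \<sigma> i = \<sigma> i"
  shows "(LINT x|T2. block_field t \<sigma> x $ l * fourier_multiplier m F x) = (LINT x|T2. block_field t \<sigma> x $ l * F x)"
proof -
  have "(LINT x|T2. block_field t \<sigma> x $ l * fourier_multiplier m F x) = (LINT x|T2. fourier_multiplier m (\<lambda>x. block_field t \<sigma> x $ l) x * F x)"
    unfolding block_field_def vec_lambda_beta by (rule fourier_multiplier_self_adjoint[OF m F])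
  also have "fourier_multiplier m (\<lambda>x. block_field t \<sigma> x $ l) = (\<lambda>x. block_field t \<sigma> x $ l)"
    unfolding fourier_multiplier_block_field[OF m] using block_field_cong[of t "\<lambda>i. m (freq (block_freq (t^3) i)) * \<sigma> i" \<sigma>] \<sigma> by simp
  finally show ?thesis .
qed

text \<open>By self-adjointness the truncation of the advection term moves onto
  \<open>low_flow\<close>. It acts there as the identity, because the symbol equals 1 on every mode
  that carries a nonzero weight.\<close>

lemma flow_energy_flux:
  assumes c: "LP_cutoff c" and q: "freq_scale q = 1024 * real (scale K ^ 3)"
  shows "energy_flux c flow q = (LINT x|T2. low_flow K x \<bullet> (\<Sum>j\<in>UNIV. (flow x $ j) *\<^sub>R flow_grad j x))"
proof -
  let ?m = "\<lambda>\<xi>. c (inverse (freq_scale q) *\<^sub>R \<xi>)"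
  define F where "F x = (\<Sum>j\<in>UNIV. (flow x $ j) *\<^sub>R flow_grad j x)" for x
  note m = finite_symbol_truncation[OF c, of q]
  have F: "integrable T2 F"
    unfolding F_def[abs_def] by (intro Bochner_Integration.integrable_sum flow_advection_integrable)
  have Fl: "integrable T2 (\<lambda>x. F x $ l)" for l by (rule integrable_vec_nth[OF F])
  have meas: "advection flow \<in> borel_measurable T2"
  proof -
    have w: "has_weak_partial j flow (weak_partial j flow)" for j
      unfolding weak_partial_def by (rule someI[of "has_weak_partial j flow" "flow_grad j"]) (rule flow_has_weak_partial)
    have [measurable]: "weak_partial j flow \<in> borel_measurable T2" "(\<lambda>x. flow x $ j) \<in> borel_measurable T2" for j
      using w[of j] integrable_vec_nth[OF integrable_flow] by (auto simp: has_weak_partial_def)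
    show ?thesis unfolding advection_def[abs_def] by measurable
  qed
  have fm: "fourier_multiplier ?m (\<lambda>y. advection flow y $ l) = fourier_multiplier ?m (\<lambda>y. F y $ l)" for l
  proof -
    have "fourier_coeff (\<lambda>y. advection flow y $ l) \<alpha> = fourier_coeff (\<lambda>y. F y $ l) \<alpha>" for \<alpha>
    proof (rule fourier_coeff_cong_AE)
      show "(\<lambda>y. advection flow y $ l) \<in> borel_measurable T2"
        using borel_measurable_continuous_onI[OF linear_continuous_on[OF bounded_linear_vec_nth]] meas
        by (rule measurable_compose[rotated])
      show "(\<lambda>y. F y $ l) \<in> borel_measurable T2" using Fl by auto
      show "AE y in T2. advection flow y $ l = F y $ l"
        using flow_advection by eventually_elim (simp add: F_def)
    qed
    then show ?thesis by (intro ext) (simp only: fourier_multiplier_finite[OF m])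
  qed
  have cm: "continuous_on UNIV (fourier_multiplier ?m (\<lambda>y. F y $ l))" for l
    unfolding fourier_multiplier_finite[OF m, abs_def] by (intro continuous_intros)
  have i1: "integrable T2 (\<lambda>x. block_field t \<sigma> x $ l * fourier_multiplier ?m (\<lambda>y. F y $ l) x)" for t \<sigma> l
    by (intro integrable_continuous_T2 continuous_intros cm)
  have i2: "integrable T2 (\<lambda>x. block_field t \<sigma> x $ l * F x $ l)" for t \<sigma> l
  proof -
    have "integrable T2 (\<lambda>x. (block_field t \<sigma> x $ l) *\<^sub>R (F x $ l))"
      by (intro integrable_continuous_scaleR Fl continuous_intros)
    then show ?thesis by simp
  qed
  have main: "(LINT x|T2. low_flow K x $ l * fourier_multiplier ?m (\<lambda>y. F y $ l) x) = (LINT x|T2. low_flow K x $ l * F x $ l)" for l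
  proof -
    have s1: "(LINT x|T2. block_field (scale k) all_modes x $ l * fourier_multiplier ?m (\<lambda>y. F y $ l) x) = (LINT x|T2. block_field (scale k) all_modes x $ l * F x $ l)" if "k < K" for k
      by (rule block_field_self_adjoint[OF m Fl]) (use truncation_flow(2)[OF c q that] in simp)
    have s2: "(LINT x|T2. block_field (scale K) low x $ l * fourier_multiplier ?m (\<lambda>y. F y $ l) x) = (LINT x|T2. block_field (scale K) low x $ l * F x $ l)"
      by (rule block_field_self_adjoint[OF m Fl]) (use truncation_flow(3)[OF c q] in \<open>auto simp: low_def\<close>)
    have "(LINT x|T2. low_flow K x $ l * fourier_multiplier ?m (\<lambda>y. F y $ l) x)
      = (\<Sum>k<K. LINT x|T2. block_field (scale k) all_modes x $ l * fourier_multiplier ?m (\<lambda>y. F y $ l) x) + (LINT x|T2. block_field (scale K) low x $ l * fourier_multiplier ?m (\<lambda>y. F y $ l) x)"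
      by (simp add: low_flow_def distrib_right sum_distrib_right i1)
    also have "\<dots> = (\<Sum>k<K. LINT x|T2. block_field (scale k) all_modes x $ l * F x $ l) + (LINT x|T2. block_field (scale K) low x $ l * F x $ l)"
      using s1 s2 by simp
    also have "\<dots> = (LINT x|T2. low_flow K x $ l * F x $ l)"
      by (simp add: low_flow_def distrib_right sum_distrib_right i2)
    finally show ?thesis .
  qed
  have j1: "integrable T2 (\<lambda>x. low_flow K x $ l * fourier_multiplier ?m (\<lambda>y. F y $ l) x)" for l
    by (simp add: low_flow_def distrib_right sum_distrib_right i1)
  have j2: "integrable T2 (\<lambda>x. low_flow K x $ l * F x $ l)" for l
    by (simp add: low_flow_def distrib_right sum_distrib_right i2)
  have "energy_flux c flow q = (LINT x|T2. (\<Sum>l\<in>UNIV. low_flow K x $ l * fourier_multiplier ?m (\<lambda>y. F y $ l) x))"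
    unfolding energy_flux_def truncation_flow(1)[OF c q]
    by (simp add: inner_vec_def LP_truncation_def fourier_multiplier_vec_def fm)
  also have "\<dots> = (LINT x|T2. (\<Sum>l\<in>UNIV. low_flow K x $ l * F x $ l))"
    using j1 j2 main by simp
  also have "\<dots> = (LINT x|T2. low_flow K x \<bullet> F x)" by (simp add: inner_vec_def)
  finally show ?thesis unfolding F_def .
qed

section \<open>The energy flux\<close>

text \<open>The flux density: \<open>w\<close> tested against the derivative of a field along
  \<open>a\<close>, where \<open>b j\<close> stands for the derivative of that field in direction
  \<open>j\<close>.\<close>

definition trilinear :: "real^2 \<Rightarrow> real^2 \<Rightarrow> (2 \<Rightarrow> real^2) \<Rightarrow> real" where
  "trilinear w a b = w \<bullet> (\<Sum>j\<in>UNIV. (a $ j) *\<^sub>R b j)"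

definition grad_size :: "(2 \<Rightarrow> real^2) \<Rightarrow> real" where
  "grad_size b = norm (b 1) + norm (b 2)"

lemma grad_size_nonneg: "0 \<le> grad_size b"
  by (simp add: grad_size_def)

lemma trilinear_bound: "\<bar>trilinear w a b\<bar> \<le> norm w * norm a * grad_size b"
proof -
  have "norm ((a $ j) *\<^sub>R b j) \<le> norm a * norm (b j)" for j
    by (simp add: mult_right_mono component_le_norm_cart)
  from this[of 1] this[of 2] have "norm (\<Sum>j\<in>UNIV. (a $ j) *\<^sub>R b j) \<le> norm a * grad_size b"
    using norm_triangle_ineq[of "(a $ 1) *\<^sub>R b 1" "(a $ 2) *\<^sub>R b 2"] by (simp add: sum_2 grad_size_def distrib_left)
  then have "norm w * norm (\<Sum>j\<in>UNIV. (a $ j) *\<^sub>R b j) \<le> norm w * (norm a * grad_size b)"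
    by (rule mult_left_mono) simp
  then show ?thesis
    unfolding trilinear_def using Cauchy_Schwarz_ineq2[of w "\<Sum>j\<in>UNIV. (a $ j) *\<^sub>R b j"] by (simp add: mult.assoc)
qed

lemma trilinear_bound':
  assumes "norm w \<le> A" "norm a \<le> B" "grad_size b \<le> D"
  shows "\<bar>trilinear w a b\<bar> \<le> A * B * D"
proof -
  have "0 \<le> A" "0 \<le> B" using assms order_trans[OF norm_ge_zero] by blast+
  then have "norm w * norm a * grad_size b \<le> A * B * D"
    by (intro mult_mono mult_nonneg_nonneg assms grad_size_nonneg) auto
  then show ?thesis using trilinear_bound[of w a b] by linarith
qed

text \<open>The two retained terms are the one that vanishes by the divergence-free condition and the flux
  of the block at the critical scale.\<close>

lemma trilinear_decomposition:
  "trilinear (U + L) (U + V + R) (\<lambda>j. A j + B j + G j) = trilinear U U A + trilinear L V B +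
    (trilinear U U B + trilinear U V A + trilinear U V B + trilinear L U A + trilinear L U B + trilinear L V A
     + trilinear (U + L) R (\<lambda>j. A j + B j) + trilinear (U + L) (U + V) G + trilinear (U + L) R G)"
  by (simp add: trilinear_def sum_2 inner_add_left inner_add_right algebra_simps)

lemma C1_sum:
  assumes "\<And>i. i \<in> I \<Longrightarrow> C1 (f i)" "finite I"
  shows "C1 (\<lambda>x. \<Sum>i\<in>I. f i x) \<and> partial j (\<lambda>x. \<Sum>i\<in>I. f i x) = (\<lambda>x. \<Sum>i\<in>I. partial j (f i) x)"
  using assms(2,1)
proof (induction I rule: finite_induct)
  case empty
  have "C1 (\<lambda>x. 0)"
    using C1_trig_poly[of "{} :: unit set" "\<lambda>_. 0" "\<lambda>_. 0"] by (simp add: trig_poly_def[abs_def])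
  moreover have "partial j (\<lambda>x. 0) = (\<lambda>x. 0)" by (rule ext, rule partial_eqI) simp
  ultimately show ?case by simp
next
  case (insert i I)
  then have "C1 (f i)" "C1 (\<lambda>x. \<Sum>i\<in>I. f i x)" by auto
  then show ?case
    using insert C1_add by (auto simp: partial_add C1_partial(2))
qed

text \<open>The integrand is half the derivative along \<open>U\<close> of the square of its norm;
  integration by parts moves the derivative onto \<open>U\<close>, where it becomes the
  divergence.\<close>

lemma trilinear_self_zero:
  fixes U :: "real^2 \<Rightarrow> real^2" and D :: "2 \<Rightarrow> real^2 \<Rightarrow> real^2"
  assumes C1: "\<And>l. C1 (\<lambda>x. U x $ l)" and D: "\<And>j l. partial j (\<lambda>x. U x $ l) = (\<lambda>x. D j x $ l)"
    and div: "\<And>x. D 1 x $ 1 + D 2 x $ 2 = 0"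
  shows "(LINT x|T2. trilinear (U x) (U x) (\<lambda>j. D j x)) = 0"
proof -
  have Dc: "continuous_on UNIV (\<lambda>x. D j x $ l)" for j l
    using C1_partial(1)[OF C1, of j l] by (simp only: D)
  have Uc: "continuous_on UNIV (\<lambda>x. U x $ l)" for l by (rule C1_continuous[OF C1])
  have i1: "integrable T2 (\<lambda>x. D j x $ i * (U x $ l * U x $ l))" for i j l
    by (intro integrable_continuous_T2 continuous_intros Uc Dc)
  have i2: "integrable T2 (\<lambda>x. U x $ j * (U x $ l * D j x $ l))" for j l
    by (intro integrable_continuous_T2 continuous_intros Uc Dc)
  have "(LINT x|T2. D j x $ j * (U x $ l * U x $ l)) = - 2 * (LINT x|T2. U x $ j * (U x $ l * D j x $ l))" for j l
  proof -
    have "(LINT x|T2. partial j (\<lambda>x. U x $ j) x * (U x $ l * U x $ l)) = - (LINT x|T2. U x $ j * partial j (\<lambda>x. U x $ l * U x $ l) x)"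
      by (rule integral_by_parts_T2[OF C1 C1_mult[OF C1 C1]])
    moreover have "partial j (\<lambda>x. U x $ l * U x $ l) = (\<lambda>x. 2 * (U x $ l * D j x $ l))"
      using C1_partial(2)[OF C1[of l]] by (intro ext) (simp add: partial_mult D)
    ultimately show ?thesis by (simp add: D mult.left_commute)
  qed
  note e = this
  have "(LINT x|T2. trilinear (U x) (U x) (\<lambda>j. D j x)) = (\<Sum>l\<in>UNIV. \<Sum>j\<in>UNIV. LINT x|T2. U x $ j * (U x $ l * D j x $ l))"
  proof -
    have "trilinear (U x) (U x) (\<lambda>j. D j x) = (\<Sum>l\<in>UNIV. \<Sum>j\<in>UNIV. U x $ j * (U x $ l * D j x $ l))" for x
      by (simp add: trilinear_def inner_vec_def sum_2 algebra_simps)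
    then show ?thesis using i2 by simp
  qed
  also have "\<dots> = (\<Sum>l\<in>UNIV. - 1 / 2 * (\<Sum>j\<in>UNIV. LINT x|T2. D j x $ j * (U x $ l * U x $ l)))"
    by (simp add: e sum_distrib_left)
  also have "\<dots> = (\<Sum>l\<in>UNIV. - 1 / 2 * (LINT x|T2. (D 1 x $ 1 + D 2 x $ 2) * (U x $ l * U x $ l)))"
    using i1[of 1 1] i1[of 2 2] by (simp add: sum_2 distrib_right)
  also have "\<dots> = 0" unfolding div by simp
  finally show ?thesis .
qed

definition low_part :: "nat \<Rightarrow> real^2 \<Rightarrow> real^2" where
  "low_part K x = (\<Sum>k<Suc K. block_field (scale k) all_modes x)"

definition low_grad :: "nat \<Rightarrow> 2 \<Rightarrow> real^2 \<Rightarrow> real^2" where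
  "low_grad K j x = (\<Sum>k<Suc K. block_grad (scale k) j x)"

lemma low_part_self_zero: "(LINT x|T2. trilinear (low_part K x) (low_part K x) (\<lambda>j. low_grad K j x)) = 0"
proof (rule trilinear_self_zero)
  have eq: "(\<lambda>x. low_part K x $ l) = (\<lambda>x. \<Sum>k<Suc K. block_field (scale k) all_modes x $ l)" for l
    by (simp add: low_part_def)
  show "C1 (\<lambda>x. low_part K x $ l)" "partial j (\<lambda>x. low_part K x $ l) = (\<lambda>x. low_grad K j x $ l)" for j l
    using C1_sum[of "{..<Suc K}" "\<lambda>k x. block_field (scale k) all_modes x $ l" j] C1_block_field
    unfolding eq by (simp_all add: low_grad_def partial_block_field)
  show "low_grad K 1 x $ 1 + low_grad K 2 x $ 2 = 0" for x
    by (simp only: low_grad_def sum_component sum.distrib[symmetric] block_grad_trace sum.neutral_const)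
qed

text \<open>Consecutive powers of the scales at least double, so the last term dominates the
  sum.\<close>

lemma scale_power_sum: "n \<ge> 1 \<Longrightarrow> (\<Sum>k<Suc K. real (scale k) ^ n) \<le> 2 * real (scale K) ^ n"
proof (induction K)
  case (Suc K)
  have "(2::real) * scale K ^ n \<le> scale (Suc K) ^ n"
  proof -
    have "2 * scale K \<le> scale K ^ 20"
      using mult_right_mono[of 2 "scale K ^ 19" "scale K"] power_mono[OF scale_ge_2, of 19 K]
      by (simp flip: power_Suc2)
    then have "(2 * scale K) ^ n \<le> scale (Suc K) ^ n" unfolding scale_Suc by (rule power_mono) simp
    moreover have "2 * scale K ^ n \<le> (2 * scale K) ^ n"
      using Suc.prems self_le_power[of "2::nat" n] by (simp add: power_mult_distrib)
    ultimately have "2 * scale K ^ n \<le> scale (Suc K) ^ n" by linarith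
    then have "real (2 * scale K ^ n) \<le> real (scale (Suc K) ^ n)" by (simp only: of_nat_le_iff)
    then show ?thesis by simp
  qed
  then show ?case using Suc by simp
qed simp

lemma low_part_sup: "norm (low_part K x) \<le> 2 * block_const * scale K"
proof -
  have "norm (low_part K x) \<le> (\<Sum>k<Suc K. block_const * real (scale k))"
    unfolding low_part_def
  proof (rule sum_norm_le)
    show "norm (block_field (scale k) all_modes x) \<le> block_const * real (scale k)" for k
      using field_norm_sup[of "scale k" all_modes 1 x] by simp
  qed
  also have "\<dots> = block_const * (\<Sum>k<Suc K. real (scale k) ^ 1)" by (simp only: sum_distrib_left power_one_right)
  also have "\<dots> \<le> block_const * (2 * real (scale K) ^ 1)"
    by (intro mult_left_mono scale_power_sum) (use block_const_ge_1 in auto)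
  finally show ?thesis by (simp add: mult_ac)
qed

lemma low_grad_sup: "norm (low_grad K j x) \<le> 2 * block_const * scale K ^ 4"
proof -
  have "norm (low_grad K j x) \<le> (\<Sum>k<Suc K. block_const * real (scale k) ^ 4)"
    unfolding low_grad_def
  proof (rule sum_norm_le)
    show "norm (block_grad (scale k) j x) \<le> block_const * real (scale k) ^ 4" for k
      using grad_norm_sup[of "scale k" j x] by simp
  qed
  also have "\<dots> = block_const * (\<Sum>k<Suc K. real (scale k) ^ 4)" by (simp only: sum_distrib_left)
  also have "\<dots> \<le> block_const * (2 * real (scale K) ^ 4)"
    by (intro mult_left_mono scale_power_sum) (use block_const_ge_1 in auto)
  finally show ?thesis by (simp add: mult_ac)
qed

text \<open>The weight \<open>t^3\<close> balances the squared L^2 norms of a block,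
  \<open>t^-4\<close> for the field and \<open>t^2\<close> for the gradient: both terms integrate to
  order \<open>1 / t\<close>.\<close>

lemma sq_le_mult_bound:
  fixes a b1 b2 t :: real
  assumes "0 < t"
  shows "a * (b1 + b2) \<le> t^3 * a^2 + (b1^2 + b2^2) / t^3"
proof -
  have "a * b \<le> (t^3 * a^2 + b^2 / t^3) / 2" for b
  proof -
    have "0 \<le> (t^3 * a - b)^2 / (2 * t^3)" using assms by simp
    also have "\<dots> = (t^3 * a^2 + b^2 / t^3) / 2 - a * b"
      using assms by (simp add: field_simps power2_eq_square)
    finally show ?thesis by simp
  qed
  from this[of b1] this[of b2] have "a * (b1 + b2) \<le> (t^3 * a^2 + b1^2 / t^3) / 2 + (t^3 * a^2 + b2^2 / t^3) / 2"
    by (simp add: distrib_left add_mono)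
  also have "\<dots> = t^3 * a^2 + (b1^2 + b2^2) / t^3 / 2" by (simp add: add_divide_distrib)
  also have "\<dots> \<le> t^3 * a^2 + (b1^2 + b2^2) / t^3"
  proof -
    have "0 \<le> (b1^2 + b2^2) / t^3" using assms by simp
    then show ?thesis by simp
  qed
  finally show ?thesis .
qed

text \<open>Here \<open>U\<close> and \<open>A\<close> belong to the earlier blocks,
  \<open>V\<close>, \<open>L\<close> and \<open>B\<close> to the current one, \<open>R\<close> and
  \<open>G\<close> to the tail. The first six terms contain a factor from the earlier blocks,
  bounded by a small power of \<open>s\<close>, and the integral of the rest decays in
  \<open>t\<close>; the last three contain a factor from the tail.\<close>

lemma error_term_bound:
  assumes UU: "norm U \<le> 2 * k * s" and V: "norm V \<le> k * t" and L: "norm L \<le> k * t"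
    and A: "grad_size A \<le> 4 * k * s^4" and B: "grad_size B \<le> 2 * k * t^4" and st: "0 < s" "s \<le> t" and k: "0 \<le> k"
  shows "\<bar>trilinear U U B + trilinear U V A + trilinear U V B + trilinear L U A + trilinear L U B + trilinear L V A
     + trilinear (U + L) R (\<lambda>j. A j + B j) + trilinear (U + L) (U + V) G + trilinear (U + L) R G\<bar>
   \<le> 4 * k^2 * s^2 * grad_size B + 8 * k^2 * s^5 * (norm V + norm L)
     + 2 * k * s * ((t^3 * norm V^2 + (norm (B 1)^2 + norm (B 2)^2) / t^3) + (t^3 * norm L^2 + (norm (B 1)^2 + norm (B 2)^2) / t^3))
     + 4 * k * s^4 * (norm V^2 + norm L^2) + 18 * k^2 * t^5 * norm R + 9 * k^2 * t^2 * grad_size G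
     + 3 * k * t * ((norm R powr 4 + norm (G 1) powr (4/3)) + (norm R powr 4 + norm (G 2) powr (4/3)))"
proof -
  have t: "0 < t" using st by simp
  have ks: "0 \<le> k * s" "0 \<le> k * t" using k st t by simp_all
  have "2 * k * s \<le> 2 * k * t" using k st by (intro mult_left_mono) auto
  then have UL: "norm (U + L) \<le> 3 * k * t" and UV: "norm (U + V) \<le> 3 * k * t"
    using UU L V norm_triangle_ineq[of U L] norm_triangle_ineq[of U V] by linarith+
  have "4 * k * s^4 \<le> 4 * k * t^4" using k st by (intro mult_left_mono power_mono) auto
  moreover have "grad_size (\<lambda>j. A j + B j) \<le> grad_size A + grad_size B"
    using norm_triangle_ineq[of "A 1" "B 1"] norm_triangle_ineq[of "A 2" "B 2"] by (simp add: grad_size_def)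
  ultimately have AB: "grad_size (\<lambda>j. A j + B j) \<le> 6 * k * t^4" using A B by linarith
  have 1: "\<bar>trilinear U U B\<bar> \<le> 4 * k^2 * s^2 * grad_size B"
    using trilinear_bound'[OF UU UU order_refl, of B] by (simp add: power2_eq_square mult_ac)
  have 2: "\<bar>trilinear U V A\<bar> \<le> 8 * k^2 * s^5 * norm V"
    using trilinear_bound'[OF UU order_refl A, of V] by (simp add: power2_eq_square eval_nat_numeral mult_ac)
  have 4: "\<bar>trilinear L U A\<bar> \<le> 8 * k^2 * s^5 * norm L"
    using trilinear_bound'[OF order_refl UU A, of L] by (simp add: power2_eq_square eval_nat_numeral mult_ac)
  have 3: "\<bar>trilinear U V B\<bar> \<le> 2 * k * s * (t^3 * norm V^2 + (norm (B 1)^2 + norm (B 2)^2) / t^3)"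
  proof -
    have "\<bar>trilinear U V B\<bar> \<le> 2 * k * s * (norm V * grad_size B)"
      using trilinear_bound'[OF UU order_refl order_refl, of V B] by (simp add: mult.assoc)
    also have "\<dots> \<le> 2 * k * s * (t^3 * norm V^2 + (norm (B 1)^2 + norm (B 2)^2) / t^3)"
      unfolding grad_size_def by (intro mult_left_mono sq_le_mult_bound t) (use ks in simp)
    finally show ?thesis .
  qed
  have 5: "\<bar>trilinear L U B\<bar> \<le> 2 * k * s * (t^3 * norm L^2 + (norm (B 1)^2 + norm (B 2)^2) / t^3)"
  proof -
    have "\<bar>trilinear L U B\<bar> \<le> 2 * k * s * (norm L * grad_size B)"
      using trilinear_bound'[OF order_refl UU order_refl, of L B] by (simp add: mult_ac)
    also have "\<dots> \<le> 2 * k * s * (t^3 * norm L^2 + (norm (B 1)^2 + norm (B 2)^2) / t^3)"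
      unfolding grad_size_def by (intro mult_left_mono sq_le_mult_bound t) (use ks in simp)
    finally show ?thesis .
  qed
  have 6: "\<bar>trilinear L V A\<bar> \<le> 4 * k * s^4 * (norm V^2 + norm L^2)"
  proof -
    have "\<bar>trilinear L V A\<bar> \<le> 4 * k * s^4 * (norm L * norm V)"
      using trilinear_bound'[OF order_refl order_refl A, of L V] by (simp add: mult_ac)
    also have "norm L * norm V \<le> norm V^2 + norm L^2"
    proof -
      have "0 \<le> (norm L - norm V)^2 + norm L^2 + norm V^2" by simp
      then show ?thesis by (simp add: power2_diff)
    qed
    then have "4 * k * s^4 * (norm L * norm V) \<le> 4 * k * s^4 * (norm V^2 + norm L^2)"
      by (rule mult_left_mono) (use k st in simp)
    finally show ?thesis by simp
  qed
  have 7: "\<bar>trilinear (U + L) R (\<lambda>j. A j + B j)\<bar> \<le> 18 * k^2 * t^5 * norm R"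
    using trilinear_bound'[OF UL order_refl AB, of R] by (simp add: power2_eq_square eval_nat_numeral mult_ac)
  have 8: "\<bar>trilinear (U + L) (U + V) G\<bar> \<le> 9 * k^2 * t^2 * grad_size G"
    using trilinear_bound'[OF UL UV order_refl, of G] by (simp add: power2_eq_square mult_ac)
  have 9: "\<bar>trilinear (U + L) R G\<bar> \<le> 3 * k * t * ((norm R powr 4 + norm (G 1) powr (4/3)) + (norm R powr 4 + norm (G 2) powr (4/3)))"
  proof -
    have "\<bar>trilinear (U + L) R G\<bar> \<le> 3 * k * t * (norm R * grad_size G)"
      using trilinear_bound'[OF UL order_refl order_refl, of R G] by (simp add: mult.assoc)
    also have "\<dots> \<le> 3 * k * t * ((norm R powr 4 + norm (G 1) powr (4/3)) + (norm R powr 4 + norm (G 2) powr (4/3)))"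
      unfolding grad_size_def distrib_left[of "norm R"]
      by (intro mult_left_mono add_mono young_4 norm_ge_zero) (use ks in simp)
    finally show ?thesis .
  qed
  have comb: "\<bar>x1 + x2 + x3 + x4 + x5 + x6 + x7 + x8 + x9\<bar> \<le> y1 + (y2 + y4) + (y3 + y5) + y6 + y7 + y8 + y9"
    if "\<bar>x1\<bar> \<le> y1" "\<bar>x2\<bar> \<le> y2" "\<bar>x3\<bar> \<le> y3" "\<bar>x4\<bar> \<le> y4" "\<bar>x5\<bar> \<le> y5" "\<bar>x6\<bar> \<le> y6" "\<bar>x7\<bar> \<le> y7" "\<bar>x8\<bar> \<le> y8" "\<bar>x9\<bar> \<le> y9"
    for x1 x2 x3 x4 x5 x6 x7 x8 x9 y1 y2 y3 y4 y5 y6 y7 y8 y9 :: real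
    using that unfolding abs_le_iff by (intro conjI) linarith+
  have e1: "8 * k^2 * s^5 * (norm V + norm L) = 8 * k^2 * s^5 * norm V + 8 * k^2 * s^5 * norm L"
    by (rule distrib_left)
  have e2: "2 * k * s * (y + z) = 2 * k * s * y + 2 * k * s * z" for y z
    by (rule distrib_left)
  show ?thesis
    unfolding e1 e2[of "t^3 * norm V^2 + (norm (B 1)^2 + norm (B 2)^2) / t^3" "t^3 * norm L^2 + (norm (B 1)^2 + norm (B 2)^2) / t^3"]
    by (rule comb[OF 1 2 3 4 5 6 7 8 9])
qed

lemma summable_tail_split:
  fixes f :: "nat \<Rightarrow> real^2"
  assumes "summable (\<lambda>k. norm (f k))"
  shows "(\<Sum>k. f k) = (\<Sum>k<Suc K. f k) + f (Suc K) + (\<Sum>k. f (K + 2 + k))"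
  using suminf_split_initial_segment[OF summable_norm_cancel[OF assms], of "K + 2"] by (simp add: add_ac)

lemma power_ratio_le:
  fixes s :: real
  assumes "1 \<le> s" "a + 1 \<le> b"
  shows "s^a / s^b \<le> 1 / s"
proof -
  have "s ^ (a + 1) \<le> s ^ b" by (rule power_increasing) (use assms in auto)
  then show ?thesis using assms by (simp add: field_simps)
qed

text \<open>Cutting at block \<open>Suc K\<close> leaves three groups, governed by \<open>s\<close>,
  \<open>t = s^20\<close> and \<open>r = t^20\<close>. The self-interaction of the earlier blocks
  vanishes, the current block supplies the constant, and the remaining interactions are at most
  \<open>M / s\<close> in total.\<close>

lemma truncated_flux_bound:
  obtains M where "\<And>K. 4 * pi^4 - M / scale K \<le> (LINT x|T2. trilinear (low_flow (Suc K) x) (flow x) (\<lambda>j. flow_grad j x))"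
proof -
  define k where "k = block_const"
  have k: "1 \<le> k" by (simp add: k_def block_const_ge_1)
  define R where "R n x = (\<Sum>i. block_field (scale (n + i)) all_modes x)" for n x
  define G where "G n j x = (\<Sum>i. block_grad (scale (n + i)) j x)" for n j x
  obtain C1 where C1: "0 \<le> C1" "\<And>n. integrable T2 (R n)" "\<And>n. (LINT x|T2. norm (R n x)) \<le> C1 / scale n"
    unfolding R_def[abs_def] by (rule field_tail_L1) blast
  obtain C4 where C4: "0 \<le> C4" "\<And>n. integrable T2 (\<lambda>x. norm (R n x) powr 4)"
    "\<And>n. (LINT x|T2. norm (R n x) powr 4) \<le> C4 * scale n powr (- (6 - 4) / 2)"
    unfolding R_def by (rule field_tail[of 4]) auto
  have "\<exists>C. 0 \<le> C \<and> (\<forall>n. integrable T2 (G n j) \<and> (LINT x|T2. norm (G n j x)) \<le> C / scale n)" for j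
    unfolding G_def[abs_def] by (rule grad_tail_L1[of j]) blast
  then obtain C2 where C2: "\<And>j. 0 \<le> C2 j" "\<And>n j. integrable T2 (G n j)" "\<And>n j. (LINT x|T2. norm (G n j x)) \<le> C2 j / scale n"
    by metis
  have "\<exists>C. 0 \<le> C \<and> (\<forall>n. integrable T2 (\<lambda>x. norm (G n j x) powr (4/3)) \<and> (LINT x|T2. norm (G n j x) powr (4/3)) \<le> C * scale n powr (- (6 - 4 * (4/3)) / 2))" for j
    unfolding G_def by (rule grad_tail[of "4/3" j]) (simp, simp, blast)
  then obtain C5 where C5: "\<And>j. 0 \<le> C5 j" "\<And>n j. integrable T2 (\<lambda>x. norm (G n j x) powr (4/3))"
    "\<And>n j. (LINT x|T2. norm (G n j x) powr (4/3)) \<le> C5 j * scale n powr (- (6 - 4 * (4/3)) / 2)"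
    by metis
  \<comment> \<open>One coefficient for each of the seven groups of the error bound; every
    integrated group turns out to be at most its coefficient divided by \<open>s\<close>.\<close>
  define M where "M = 8 * k^3 + 16 * k^3 + 12 * k^2 + 8 * k^2 + 18 * k^2 * C1 + 9 * k^2 * (C2 1 + C2 2) + 3 * k * (2 * C4 + (C5 1 + C5 2))"
  have "4 * pi^4 - M / scale K \<le> (LINT x|T2. trilinear (low_flow (Suc K) x) (flow x) (\<lambda>j. flow_grad j x))" for K
  proof -
    define s t r where "s = real (scale K)" and "t = real (scale (Suc K))" and "r = real (scale (K + 2))"
    have s: "1 \<le> s" by (simp add: s_def)
    have t: "t = s^20" and r: "r = t^20" by (simp_all add: s_def t_def r_def scale_Suc)
    have st: "s \<le> t" "1 \<le> t" unfolding t using s self_le_power[of s 20] one_le_power[of s 20] by auto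
    define U V L where "U = low_part K" and "V = block_field (scale (Suc K)) all_modes" and "L = block_field (scale (Suc K)) low"
    define A B where "A = low_grad K" and "B = block_grad (scale (Suc K))"
    have cU: "continuous_on UNIV U" "continuous_on UNIV V" "continuous_on UNIV L"
      unfolding U_def V_def L_def low_part_def[abs_def] by (intro continuous_intros)+
    have cA: "continuous_on UNIV (A j)" "continuous_on UNIV (B j)" for j
      unfolding A_def B_def low_grad_def[abs_def] by (intro continuous_intros)+
    define h where "h x = 4 * k^2 * s^2 * grad_size (\<lambda>j. B j x) + 8 * k^2 * s^5 * (norm (V x) + norm (L x))
     + 2 * k * s * ((t^3 * norm (V x)^2 + (norm (B 1 x)^2 + norm (B 2 x)^2) / t^3) + (t^3 * norm (L x)^2 + (norm (B 1 x)^2 + norm (B 2 x)^2) / t^3))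
     + 4 * k * s^4 * (norm (V x)^2 + norm (L x)^2) + 18 * k^2 * t^5 * norm (R (K + 2) x) + 9 * k^2 * t^2 * grad_size (\<lambda>j. G (K + 2) j x)
     + 3 * k * t * ((norm (R (K + 2) x) powr 4 + norm (G (K + 2) 1 x) powr (4/3)) + (norm (R (K + 2) x) powr 4 + norm (G (K + 2) 2 x) powr (4/3)))" for x
    have lw: "\<bar>low i\<bar> \<le> 1" for i by (simp add: low_def)
    have sup: "norm (U x) \<le> 2 * k * s" "norm (V x) \<le> k * t" "norm (L x) \<le> k * t"
      "grad_size (\<lambda>j. A j x) \<le> 4 * k * s^4" "grad_size (\<lambda>j. B j x) \<le> 2 * k * t^4" for x
      using low_part_sup[of K x] field_norm_sup[of "scale (Suc K)" all_modes 1 x] field_norm_sup[of "scale (Suc K)" low 1 x]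
        low_grad_sup[of K 1 x] low_grad_sup[of K 2 x] grad_norm_sup[of "scale (Suc K)" 1 x] grad_norm_sup[of "scale (Suc K)" 2 x] lw
      by (auto simp: U_def V_def L_def A_def B_def k_def s_def t_def grad_size_def)
    have low_flow: "low_flow (Suc K) x = U x + L x" for x
      by (simp add: low_flow_def U_def L_def low_part_def)
    \<comment> \<open>After inserting the splittings of \<open>flow\<close> and
      \<open>flow_grad\<close>, exactly the nine error terms of
      \<open>trilinear_decomposition\<close> remain.\<close>
    define E where "E x = trilinear (low_flow (Suc K) x) (flow x) (\<lambda>j. flow_grad j x) - trilinear (U x) (U x) (\<lambda>j. A j x) - trilinear (L x) (V x) (\<lambda>j. B j x)" for x
    have bound: "AE x in T2. \<bar>E x\<bar> \<le> h x"
      using flow_AE_summable flow_grad_AE_summable[of 1] flow_grad_AE_summable[of 2]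
    proof eventually_elim
      case (elim x)
      have f: "flow x = U x + V x + R (K + 2) x"
        unfolding flow_def U_def V_def R_def low_part_def by (rule summable_tail_split[OF elim(1)])
      have "summable (\<lambda>k. norm (block_grad (scale k) j x))" for j
        using exhaust_2[of j] elim by auto
      then have g: "flow_grad j x = A j x + B j x + G (K + 2) j x" for j
        unfolding flow_grad_def A_def B_def G_def low_grad_def by (rule summable_tail_split)
      show ?case
        unfolding E_def low_flow f g trilinear_decomposition h_def add_diff_cancel_left'
        using error_term_bound[OF sup[of x], of "R (K + 2) x" "\<lambda>j. G (K + 2) j x"] s st k by simp
    qed
    have i1: "integrable T2 (\<lambda>x. norm (V x))" "integrable T2 (\<lambda>x. norm (L x))" "integrable T2 (\<lambda>x. norm (V x)^2)"
      "integrable T2 (\<lambda>x. norm (L x)^2)" "integrable T2 (\<lambda>x. norm (B j x))" "integrable T2 (\<lambda>x. norm (B j x)^2)" for j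
      by (intro integrable_continuous_T2 continuous_intros cU cA)+
    have i2: "integrable T2 (\<lambda>x. norm (R n x))" "integrable T2 (\<lambda>x. norm (G n j x))" for n j
      using C1(2) C2(2) by auto
    note ints = i1 i2 C4(2) C5(2)
    have h_int: "integrable T2 h"
      unfolding h_def[abs_def] grad_size_def
      by (intro Bochner_Integration.integrable_add integrable_mult_right integrable_divide ints)
    have h_eq: "(LINT x|T2. h x) = 4 * k^2 * s^2 * ((LINT x|T2. norm (B 1 x)) + (LINT x|T2. norm (B 2 x)))
      + 8 * k^2 * s^5 * ((LINT x|T2. norm (V x)) + (LINT x|T2. norm (L x)))
      + 2 * k * s * ((t^3 * (LINT x|T2. norm (V x)^2) + ((LINT x|T2. norm (B 1 x)^2) + (LINT x|T2. norm (B 2 x)^2)) / t^3)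
          + (t^3 * (LINT x|T2. norm (L x)^2) + ((LINT x|T2. norm (B 1 x)^2) + (LINT x|T2. norm (B 2 x)^2)) / t^3))
      + 4 * k * s^4 * ((LINT x|T2. norm (V x)^2) + (LINT x|T2. norm (L x)^2)) + 18 * k^2 * t^5 * (LINT x|T2. norm (R (K + 2) x))
      + 9 * k^2 * t^2 * ((LINT x|T2. norm (G (K + 2) 1 x)) + (LINT x|T2. norm (G (K + 2) 2 x)))
      + 3 * k * t * (((LINT x|T2. norm (R (K + 2) x) powr 4) + (LINT x|T2. norm (G (K + 2) 1 x) powr (4/3)))
         + ((LINT x|T2. norm (R (K + 2) x) powr 4) + (LINT x|T2. norm (G (K + 2) 2 x) powr (4/3))))"
      unfolding h_def grad_size_def
      by (simp only: Bochner_Integration.integral_add Bochner_Integration.integrable_add integrable_mult_right integrable_divide ints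
          Bochner_Integration.integral_mult_right_zero Bochner_Integration.integral_divide_zero)
    have b1: "(LINT x|T2. norm (V x)) \<le> k / t^2" "(LINT x|T2. norm (L x)) \<le> k / t^2"
      "(LINT x|T2. norm (V x)^2) \<le> k / t^4" "(LINT x|T2. norm (L x)^2) \<le> k / t^4"
      "(LINT x|T2. norm (B j x)) \<le> k / t^2" "(LINT x|T2. norm (B j x)^2) \<le> k * t^2" for j
    proof -
      have f1: "(LINT x|T2. norm (block_field (scale (Suc K)) \<sigma> x)) \<le> block_const / (scale (Suc K))^2"
        and f2: "(LINT x|T2. norm (block_field (scale (Suc K)) \<sigma> x)^2) \<le> block_const * 1^2 / (scale (Suc K))^4"
        if "\<And>i. \<bar>\<sigma> i\<bar> \<le> 1" for \<sigma>
        by (rule field_norm_L1 field_norm_L2; simp add: that)+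
      show "(LINT x|T2. norm (V x)) \<le> k / t^2" "(LINT x|T2. norm (L x)) \<le> k / t^2"
        unfolding V_def L_def k_def t_def of_nat_power[symmetric] by (rule f1, simp add: lw)+
      show "(LINT x|T2. norm (V x)^2) \<le> k / t^4" "(LINT x|T2. norm (L x)^2) \<le> k / t^4"
        unfolding V_def L_def k_def t_def of_nat_power[symmetric]
        by (rule order_trans[OF f2], simp_all add: lw)+
      show "(LINT x|T2. norm (B j x)) \<le> k / t^2" "(LINT x|T2. norm (B j x)^2) \<le> k * t^2"
        unfolding B_def k_def t_def of_nat_power[symmetric] by (rule grad_norm_L1 grad_norm_L2, simp)+
    qed
    have r1: "r powr (- (6 - 4) / 2) = 1 / r"
    proof -
      have "- (6 - 4) / 2 = - real 1" by simp
      then show ?thesis unfolding r_def by (simp only: powr_minus_nat[OF scale_ge_1] power_one_right)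
    qed
    \<comment> \<open>The tail of the gradient in L^(4/3) decays only like \<open>r\<close> to the
      power -1/3. Since \<open>r = t^20\<close> this is still below \<open>t^-2\<close>, enough to
      absorb the factor \<open>t\<close> in front.\<close>
    have r2: "r powr (- (6 - 4 * (4/3)) / 2) \<le> 1 / t^2"
    proof -
      have "r = t powr real 20" unfolding r by (rule powr_realpow[symmetric]) (use st in linarith)
      then have "r powr (- (6 - 4 * (4/3)) / 2) = t powr (real 20 * (- (6 - 4 * (4/3)) / 2))"
        by (simp only: powr_powr)
      also have "\<dots> \<le> t powr (- real 2)" by (rule powr_mono) (use st in auto)
      also have "\<dots> = 1 / t^2" unfolding t_def by (simp only: powr_minus_nat[OF scale_ge_1] of_nat_power)
      finally show ?thesis .
    qed
    have b2: "(LINT x|T2. norm (R (K + 2) x)) \<le> C1 / r" "(LINT x|T2. norm (G (K + 2) j x)) \<le> C2 j / r"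
      "(LINT x|T2. norm (R (K + 2) x) powr 4) \<le> C4 / r" "(LINT x|T2. norm (G (K + 2) j x) powr (4/3)) \<le> C5 j / t^2" for j
    proof -
      show "(LINT x|T2. norm (R (K + 2) x)) \<le> C1 / r" "(LINT x|T2. norm (G (K + 2) j x)) \<le> C2 j / r"
        using C1(3)[of "K + 2"] C2(3)[of "K + 2" j] by (simp_all add: r_def)
      show "(LINT x|T2. norm (R (K + 2) x) powr 4) \<le> C4 / r"
        using C4(3)[of "K + 2"] r1 unfolding r_def by simp
      have "(LINT x|T2. norm (G (K + 2) j x) powr (4/3)) \<le> C5 j * r powr (- (6 - 4 * (4/3)) / 2)"
        using C5(3)[of "K + 2" j] unfolding r_def .
      also have "\<dots> \<le> C5 j * (1 / t^2)" by (rule mult_left_mono[OF r2 C5(1)])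
      finally show "(LINT x|T2. norm (G (K + 2) j x) powr (4/3)) \<le> C5 j / t^2" by simp
    qed
    have "(LINT x|T2. h x) \<le> 4 * k^2 * s^2 * (k / t^2 + k / t^2) + 8 * k^2 * s^5 * (k / t^2 + k / t^2)
      + 2 * k * s * ((t^3 * (k / t^4) + (k * t^2 + k * t^2) / t^3) + (t^3 * (k / t^4) + (k * t^2 + k * t^2) / t^3))
      + 4 * k * s^4 * (k / t^4 + k / t^4) + 18 * k^2 * t^5 * (C1 / r) + 9 * k^2 * t^2 * (C2 1 / r + C2 2 / r)
      + 3 * k * t * ((C4 / r + C5 1 / t^2) + (C4 / r + C5 2 / t^2))"
      unfolding h_eq by (intro add_mono mult_left_mono divide_right_mono b1 b2) (use k s st in auto)
    also have "\<dots> = 8 * k^3 * (s^2 / t^2) + 16 * k^3 * (s^5 / t^2) + 12 * k^2 * (s / t) + 8 * k^2 * (s^4 / t^4)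
      + 18 * k^2 * C1 * (t^5 / r) + 9 * k^2 * (C2 1 + C2 2) * (t^2 / r) + 3 * k * (2 * C4 * (t / r) + (C5 1 + C5 2) * (1 / t))"
    proof -
      have "t^3 * (k / t^4) = k / t" "(k * t^2 + k * t^2) / t^3 = 2 * k / t" "t * (c / t^2) = c / t" for c
        using st by (simp_all add: field_simps eval_nat_numeral)
      then show ?thesis by (simp add: algebra_simps power2_eq_square power3_eq_cube add_divide_distrib)
    qed
    also have "\<dots> \<le> 8 * k^3 * (1 / s) + 16 * k^3 * (1 / s) + 12 * k^2 * (1 / s) + 8 * k^2 * (1 / s)
      + 18 * k^2 * C1 * (1 / s) + 9 * k^2 * (C2 1 + C2 2) * (1 / s) + 3 * k * (2 * C4 * (1 / s) + (C5 1 + C5 2) * (1 / s))"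
    proof -
      \<comment> \<open>Written in powers of \<open>s\<close>, with \<open>t = s^20\<close> and
        \<open>r = s^400\<close>, every ratio has a denominator exponent larger by at least
        one.\<close>
      have "s^2 / t^2 \<le> 1 / s" "s^5 / t^2 \<le> 1 / s" "s / t \<le> 1 / s" "s^4 / t^4 \<le> 1 / s"
        "t^5 / r \<le> 1 / s" "t^2 / r \<le> 1 / s" "t / r \<le> 1 / s" "1 / t \<le> 1 / s"
        using power_ratio_le[OF s, of 2 40] power_ratio_le[OF s, of 5 40] power_ratio_le[OF s, of 1 20] power_ratio_le[OF s, of 4 80]
          power_ratio_le[OF s, of 100 400] power_ratio_le[OF s, of 40 400] power_ratio_le[OF s, of 20 400] power_ratio_le[OF s, of 0 20]
        unfolding r t power_mult[symmetric] by simp_all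
      then show ?thesis
        by (intro add_mono mult_left_mono) (use k C1(1) C2(1) C4(1) C5(1) in auto)
    qed
    also have "\<dots> = M / s" by (simp add: M_def add_divide_distrib algebra_simps)
    finally have h_le: "(LINT x|T2. h x) \<le> M / s" .
    have iU: "integrable T2 (\<lambda>x. trilinear (U x) (U x) (\<lambda>j. A j x))" "integrable T2 (\<lambda>x. trilinear (L x) (V x) (\<lambda>j. B j x))"
      unfolding trilinear_def by (intro integrable_continuous_T2 continuous_intros cU cA)+
    have iF: "integrable T2 (\<lambda>x. trilinear (low_flow (Suc K) x) (flow x) (\<lambda>j. flow_grad j x))"
    proof -
      have F: "integrable T2 (\<lambda>x. \<Sum>j\<in>UNIV. (flow x $ j) *\<^sub>R flow_grad j x)"
        by (intro Bochner_Integration.integrable_sum flow_advection_integrable)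
      have "integrable T2 (\<lambda>x. (low_flow (Suc K) x $ l) *\<^sub>R ((\<Sum>j\<in>UNIV. (flow x $ j) *\<^sub>R flow_grad j x) $ l))" for l
        unfolding low_flow by (intro integrable_continuous_scaleR integrable_vec_nth[OF F] continuous_intros cU)
      then show ?thesis unfolding trilinear_def inner_vec_def by (simp only: Bochner_Integration.integrable_sum inner_real_def real_scaleR_def)
    qed
    have iE: "integrable T2 E"
      unfolding E_def[abs_def] by (intro Bochner_Integration.integrable_diff iU iF)
    have "- (LINT x|T2. h x) = (LINT x|T2. - h x)" by simp
    also have "\<dots> \<le> (LINT x|T2. E x)"
      by (rule integral_mono_AE) (use iE h_int bound in \<open>auto elim!: eventually_mono\<close>)
    finally have E: "- (M / s) \<le> (LINT x|T2. E x)" using h_le by linarith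
    have "(LINT x|T2. E x) = (LINT x|T2. trilinear (low_flow (Suc K) x) (flow x) (\<lambda>j. flow_grad j x))
       - (LINT x|T2. trilinear (U x) (U x) (\<lambda>j. A j x)) - (LINT x|T2. trilinear (L x) (V x) (\<lambda>j. B j x))"
      unfolding E_def by (simp only: Bochner_Integration.integral_diff Bochner_Integration.integrable_diff iF iU)
    moreover have "(LINT x|T2. trilinear (U x) (U x) (\<lambda>j. A j x)) = 0"
      unfolding U_def A_def by (rule low_part_self_zero)
    moreover have "4 * pi^4 \<le> (LINT x|T2. trilinear (L x) (V x) (\<lambda>j. B j x))"
      using block_flux_lower_bound[of "scale (Suc K)"] by (simp add: trilinear_def inner_vec_def L_def V_def B_def)
    ultimately show ?thesis using E by (simp add: s_def)
  qed
  then show thesis by (rule that)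
qed

theorem theorem3:
  fixes c :: "real ^ 2 \<Rightarrow> real"
  assumes "LP_cutoff c"
  shows "\<exists>u :: real ^ 2 \<Rightarrow> real ^ 2.
           periodic u \<and> divergence_free u \<and>
           in_Besov_third c u \<and>
           (\<forall>p. 1 \<le> p \<and> p < 3 / 2 \<longrightarrow> in_W1p p u) \<and>
           limsup (\<lambda>q. ereal (energy_flux c u q)) \<noteq> 0"
proof (intro exI[of _ flow] conjI allI impI)
  show "periodic flow" using flow_has_weak_partial[of 1] by (simp add: has_weak_partial_def)
  show "divergence_free flow" by (rule flow_divergence_free)
  show "in_Besov_third c flow" by (rule flow_in_Besov[OF assms])
  show "in_W1p p flow" if "1 \<le> p \<and> p < 3 / 2" for p using flow_in_W1p that by blast
  obtain M where M: "\<And>K. 4 * pi^4 - M / scale K \<le> (LINT x|T2. trilinear (low_flow (Suc K) x) (flow x) (\<lambda>j. flow_grad j x))"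
    using truncated_flux_bound by blast
  \<comment> \<open>Chosen so that \<open>2 ^ q K\<close> is
    \<open>1024 * scale (Suc K) ^ 3\<close>: the exponent 10 gives the factor 1024 and the rest the
    cube of the scale.\<close>
  define q :: "nat \<Rightarrow> nat" where "q K = 10 + 3 * 20 ^ Suc K" for K
  have q: "strict_mono q" by (rule strict_monoI) (simp add: q_def)
  have freq_q: "freq_scale (q K) = 1024 * real (scale (Suc K) ^ 3)" for K
  proof -
    have "(2::real) ^ (3 * e) = (2 ^ e) ^ 3" for e by (simp add: power_mult[symmetric] mult.commute)
    then have "freq_scale (q K) = 2 ^ 10 * (2 ^ (20 ^ Suc K)) ^ 3"
      unfolding freq_scale_def q_def power_add by (simp only:)
    also have "(2::real) ^ 10 = 1024" by simp
    finally show ?thesis by (simp only: scale_def of_nat_power of_nat_numeral)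
  qed
  have flux: "energy_flux c flow (q K) = (LINT x|T2. trilinear (low_flow (Suc K) x) (flow x) (\<lambda>j. flow_grad j x))" for K
    unfolding trilinear_def by (rule flow_energy_flux[OF assms freq_q])
  \<comment> \<open>Half of the main term \<open>4 * pi^4\<close> survives as soon as the error
    \<open>M / scale K\<close> is at most \<open>2 * pi^4\<close>, which holds for large
    \<open>K\<close> because \<open>K \<le> scale K\<close>.\<close>
  have "eventually (\<lambda>K. ereal (2 * pi^4) \<le> ereal (energy_flux c flow (q K))) sequentially"
  proof -
    obtain N :: nat where N: "M / (2 * pi^4) < N" using reals_Archimedean2 by blast
    have "2 * pi^4 \<le> energy_flux c flow (q K)" if "K \<ge> N" for K
    proof -
      have "K \<le> scale K"
      proof -
        have "K < 20 ^ K" by (rule less_exp[THEN less_le_trans]) (simp add: power_mono)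
        also have "(20::nat) ^ K < 2 ^ (20 ^ K)" by (rule less_exp)
        finally show ?thesis by (simp add: scale_def)
      qed
      then have "M / (2 * pi^4) \<le> scale K" using N that by linarith
      then have "M / scale K \<le> 2 * pi^4" by (simp add: field_simps)
      then show ?thesis using M[of K] unfolding flux by linarith
    qed
    then show ?thesis by (auto simp: eventually_sequentially)
  qed
  then have "ereal (2 * pi^4) \<le> limsup ((\<lambda>q. ereal (energy_flux c flow q)) \<circ> q)"
    by (intro le_Limsup) auto
  also have "\<dots> \<le> limsup (\<lambda>q. ereal (energy_flux c flow q))" by (rule limsup_subseq_mono[OF q])
  finally have "ereal (2 * pi^4) \<le> limsup (\<lambda>q. ereal (energy_flux c flow q))" .
  moreover have "0 < ereal (2 * pi^4)" by simp
  ultimately show "limsup (\<lambda>q. ereal (energy_flux c flow q)) \<noteq> 0" by auto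
qed

end
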